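(* Let $\alpha,s\in\mathbb{N}$ and let $\boldsymbol{\gamma}=(\gamma_u)_{u\subseteq 1:s}$ be weights with $\gamma_u\ge 0$. Then the following hold. 1. For $\alpha=1$, $$\mathcal{H}(K_{1,\boldsymbol{\gamma},s}^{\mathrm{cos}})\leftrightharpoons\mathcal{H}(K_{1,\boldsymbol{\gamma},s}^{\mathrm{kor}+\mathrm{cos}})\leftrightharpoons\mathcal{H}(K_{1,\boldsymbol{\gamma},s}^{\mathrm{sob}})=\mathcal{H}(K_{1,\boldsymbol{\gamma},s}^{\mathrm{sob(odd)}})=\mathcal{H}(K_{1,\boldsymbol{\gamma},s}^{\mathrm{sob(odd}+\alpha)})=\mathcal{H}(K_{1,\boldsymbol{\gamma},s}^{\mathrm{sob(odd-bdry0)}}).$$ 2. For odd $\alpha>1$, $$\mathcal{H}(K_{\alpha,\boldsymbol{\gamma},s}^{\mathrm{cos}})\leftrightharpoons\mathcal{H}(K_{\alpha,\boldsymbol{\gamma},s}^{\mathrm{sob(odd-bdry0)}})\hookrightarrow\mathcal{H}(K_{\alpha,\boldsymbol{\gamma},s}^{\mathrm{kor}+\mathrm{cos}})\leftrightharpoons\mathcal{H}(K_{\alpha,\boldsymbol{\gamma},s}^{\mathrm{sob(odd)}})=\mathcal{H}(K_{\alpha,\boldsymbol{\gamma},s}^{\mathrm{sob(odd}+\alpha)})\hookrightarrow\mathcal{H}(K_{\alpha,\boldsymbol{\gamma},s}^{\mathrm{sob}}).$$ 3. For even $\alpha$, $$\mathcal{H}(K_{\alpha,\boldsymbol{\gamma},s}^{\mathrm{cos}})\leftrightharpoons\mathcal{H}(K_{\alpha,\boldsymbol{\gamma},s}^{\mathrm{sob(odd-bdry0)}})\hookrightarrow\mathcal{H}(K_{\alpha,\boldsymbol{\gamma},s}^{\mathrm{kor}+\mathrm{cos}})\leftrightharpoons\mathcal{H}(K_{\alpha,\boldsymbol{\gamma},s}^{\mathrm{sob(odd)}})\hookrightarrow\mathcal{H}(K_{\alpha,\boldsymbol{\gamma},s}^{\mathrm{sob(odd}+\alpha)})\hookrightarrow\mathcal{H}(K_{\alpha,\boldsymbol{\gamma},s}^{\mathrm{sob}}),$$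 where moreover $\mathcal{H}(K_{\alpha,\boldsymbol{\gamma},s}^{\mathrm{sob(odd}+\alpha)})=\mathcal{H}(K_{\alpha,\boldsymbol{\gamma},s}^{\mathrm{sob}})$ when $\alpha=2$.
   Context: $\mathbb{N}$ is the set of positive integers and $1:s=\{1,\ldots,s\}$. For a reproducing kernel $K:[0,1]^s\times[0,1]^s\to\mathbb{R}$, $\mathcal{H}(K)$ is the reproducing kernel Hilbert space (RKHS) of real-valued functions on $[0,1]^s$ with kernel $K$, and $\|\cdot\|_K$ is its norm. We write $\mathcal{H}(K_1)\hookrightarrow\mathcal{H}(K_2)$ if $\mathcal{H}(K_1)\subseteq\mathcal{H}(K_2)$ as sets and there is a constant $C>0$ with $\|f\|_{K_2}\le C\|f\|_{K_1}$ for all $f\in\mathcal{H}(K_1)$. We write $\mathcal{H}(K_1)\leftrightharpoons\mathcal{H}(K_2)$ (norm equivalence) if both $\mathcal{H}(K_1)\hookrightarrow\mathcal{H}(K_2)$ and $\mathcal{H}(K_2)\hookrightarrow\mathcal{H}(K_1)$. All kernels have the form $$K_{\alpha,\boldsymbol{\gamma},s}^{\bullet}(\boldsymbol{x},\boldsymbol{y})=1+\sum_{\emptyset\ne u\subseteq 1:s}\gamma_u\prod_{j\in u}\left[-1+K_{\alpha,1,1}^{\bullet}(x_j,y_j)\right]$$ with the following univariate kernels ($B_\tau$ is the Bernoulli polynomial of degree $\tau$): (cos) $K_{\alpha,1,1}^{\mathrm{cos}}(x,y)=1+\sum_{k=1}^{\infty}k^{-2\alpha}\,2\cos(\pi kx)\cos(\pi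 ky)$ (half-period cosine space). (kor+cos) $K_{\alpha,1,1}^{\mathrm{kor}+\mathrm{cos}}(x,y)=1+\sum_{k=1}^{\infty}k^{-2\alpha}\left[\cos(2\pi k(x-y))+\cos(\pi kx)\cos(\pi ky)\right]$ (sum of Korobov and half-period cosine spaces). (sob) $K_{\alpha,1,1}^{\mathrm{sob}}(x,y)=1+\sum_{\tau=1}^{\alpha}\frac{B_\tau(x)B_\tau(y)}{(\tau!)^2}+(-1)^{\alpha+1}\frac{B_{2\alpha}(|x-y|)}{(2\alpha)!}$. As a set, $\mathcal{H}(K_{\alpha,1,1}^{\mathrm{sob}})$ consists of all $f:[0,1]\to\mathbb{R}$ with $f^{(\tau)}$ absolutely continuous for $\tau=0,\ldots,\alpha-1$ and $f^{(\alpha)}\in L^2[0,1]$; its squared norm is $\left(\int_0^1 f\right)^2+\sum_{\tau=1}^{\alpha-1}\left(\int_0^1 f^{(\tau)}\right)^2+\int_0^1 (f^{(\alpha)})^2$. (sob(odd), sob(odd+$\alpha$), sob(odd-bdry0)) These are the reproducing kernels of the following closed subspaces of $\mathcal{H}(K_{\alpha,1,1}^{\mathrm{sob}})$, equipped with the inherited inner product: - $\mathcal{H}(K_{\alpha,1,1}^{\mathrm{sob(odd)}})$: those $f$ with $f^{(\tau)}(0)=f^{(\tau)}(1)$ for all odd $\tau\le\alpha-1$; - $\mathcal{H}(K_{\alpha,1,1}^{\mathrm{sob(odd}+\alpha)})$: those $f$ with $f^{(\tau)}(0)=f^{(\tau)}(1)$ for all odd $\tau\le\alpha-2$; - $\mathcal{H}(K_{\alpha,1,1}^{\mathrm{sob(odd-bdry0)}})$: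 those $f$ with $f^{(\tau)}(0)=f^{(\tau)}(1)=0$ for all odd $\tau\le\alpha-1$. *)

theory Defs
  imports "HOL-Analysis.Analysis"
begin

section \<open>Reproducing kernel Hilbert spaces of real-valued functions\<close>

text \<open>
  A function on a set X is represented by a total function that vanishes outside X. An inner product
  space of functions is its set of elements together with an inner product, which is normalised to be
  0 unless both arguments are elements. With these two conventions, equality of two values of the
  following type is equality of the function sets and of the inner products.
\<close>

datatype 'a fun_space =
  Fun_Space (elems: "('a \<Rightarrow> real) set") (ip: "('a \<Rightarrow> real) \<Rightarrow> ('a \<Rightarrow> real) \<Rightarrow> real")

definition fnorm :: "'a fun_space \<Rightarrow> ('a \<Rightarrow> real) \<Rightarrow> real" where
  "fnorm V f = sqrt (ip V f f)"

definition inner_fun_space :: "'a set \<Rightarrow> 'a fun_space \<Rightarrow> bool" where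
  "inner_fun_space X V \<longleftrightarrow>
     (\<forall>f\<in>elems V. \<forall>x. x \<notin> X \<longrightarrow> f x = 0) \<and>
     (\<lambda>x. 0) \<in> elems V \<and>
     (\<forall>f\<in>elems V. \<forall>g\<in>elems V. (\<lambda>x. f x + g x) \<in> elems V) \<and>
     (\<forall>c. \<forall>f\<in>elems V. (\<lambda>x. c * f x) \<in> elems V) \<and>
     (\<forall>f g. f \<notin> elems V \<or> g \<notin> elems V \<longrightarrow> ip V f g = 0) \<and>
     (\<forall>f\<in>elems V. \<forall>g\<in>elems V. ip V f g = ip V g f) \<and>
     (\<forall>f\<in>elems V. \<forall>g\<in>elems V. \<forall>h\<in>elems V. ip V (\<lambda>x. f x + g x) h = ip V f h + ip V g h) \<and>
     (\<forall>c. \<forall>f\<in>elems V. \<forall>h\<in>elems V. ip V (\<lambda>x. c * f x) h = c * ip V f h) \<and>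
     (\<forall>f\<in>elems V. f \<noteq> (\<lambda>x. 0) \<longrightarrow> ip V f f > 0)"

definition hilbert_fun_space :: "'a set \<Rightarrow> 'a fun_space \<Rightarrow> bool" where
  "hilbert_fun_space X V \<longleftrightarrow>
     inner_fun_space X V \<and>
     Metric_space.mcomplete (elems V) (\<lambda>f g. fnorm V (\<lambda>x. f x - g x))"

definition kernel_section :: "'a set \<Rightarrow> ('a \<Rightarrow> 'a \<Rightarrow> real) \<Rightarrow> 'a \<Rightarrow> 'a \<Rightarrow> real" where
  "kernel_section X K y = (\<lambda>x. if x \<in> X then K x y else 0)"

definition is_rkhs :: "'a set \<Rightarrow> ('a \<Rightarrow> 'a \<Rightarrow> real) \<Rightarrow> 'a fun_space \<Rightarrow> bool" where
  "is_rkhs X K V \<longleftrightarrow>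
     hilbert_fun_space X V \<and>
     (\<forall>y\<in>X. kernel_section X K y \<in> elems V) \<and>
     (\<forall>y\<in>X. \<forall>f\<in>elems V. ip V f (kernel_section X K y) = f y)"

text \<open>By Moore--Aronszajn, the following space exists and is unique for every positive semidefinite K.\<close>

definition rkhs :: "'a set \<Rightarrow> ('a \<Rightarrow> 'a \<Rightarrow> real) \<Rightarrow> 'a fun_space" where
  "rkhs X K = (THE V. is_rkhs X K V)"

text \<open>A kernel is determined by its space on \<open>X \<times> X\<close> only, so its values elsewhere are fixed as 0.\<close>

definition reproducing_kernel :: "'a set \<Rightarrow> 'a fun_space \<Rightarrow> 'a \<Rightarrow> 'a \<Rightarrow> real" where
  "reproducing_kernel X V =
     (THE K. is_rkhs X K V \<and> (\<forall>x y. x \<notin> X \<or> y \<notin> X \<longrightarrow> K x y = 0))"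

definition subspace_where :: "'a fun_space \<Rightarrow> (('a \<Rightarrow> real) \<Rightarrow> bool) \<Rightarrow> 'a fun_space" where
  "subspace_where V P =
     Fun_Space {f \<in> elems V. P f}
       (\<lambda>f g. if f \<in> elems V \<and> P f \<and> g \<in> elems V \<and> P g then ip V f g else 0)"

definition embeds :: "'a fun_space \<Rightarrow> 'a fun_space \<Rightarrow> bool"  (infix "\<hookrightarrow>" 50) where
  "V \<hookrightarrow> W \<longleftrightarrow>
     elems V \<subseteq> elems W \<and> (\<exists>C>0. \<forall>f\<in>elems V. fnorm W f \<le> C * fnorm V f)"

definition norm_equivalent :: "'a fun_space \<Rightarrow> 'a fun_space \<Rightarrow> bool"  (infix "\<asymp>" 50) where
  "V \<asymp> W \<longleftrightarrow> V \<hookrightarrow> W \<and> W \<hookrightarrow> V"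


section \<open>Bernoulli polynomials\<close>

fun bernoulli_number :: "nat \<Rightarrow> real" where
  "bernoulli_number 0 = 1"
| "bernoulli_number (Suc n) =
     - (\<Sum>k\<le>n. real ((n + 2) choose k) * bernoulli_number k) / real (n + 2)"

definition bernoulli_poly :: "nat \<Rightarrow> real \<Rightarrow> real" where
  "bernoulli_poly n x = (\<Sum>k\<le>n. real (n choose k) * bernoulli_number k * x ^ (n - k))"


section \<open>Univariate kernels on the unit interval\<close>

text \<open>The summation index is shifted by one: the frequency is \<open>Suc k\<close>.\<close>

definition K_cos :: "nat \<Rightarrow> real \<Rightarrow> real \<Rightarrow> real" where
  "K_cos \<alpha> x y =
     1 + (\<Sum>k. 1 / real (Suc k) ^ (2 * \<alpha>) *
            (2 * cos (pi * real (Suc k) * x) * cos (pi * real (Suc k) * y)))"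

definition K_kor_cos :: "nat \<Rightarrow> real \<Rightarrow> real \<Rightarrow> real" where
  "K_kor_cos \<alpha> x y =
     1 + (\<Sum>k. 1 / real (Suc k) ^ (2 * \<alpha>) *
            (cos (2 * pi * real (Suc k) * (x - y)) +
             cos (pi * real (Suc k) * x) * cos (pi * real (Suc k) * y)))"

definition K_sob :: "nat \<Rightarrow> real \<Rightarrow> real \<Rightarrow> real" where
  "K_sob \<alpha> x y =
     1 + (\<Sum>\<tau>=1..\<alpha>. bernoulli_poly \<tau> x * bernoulli_poly \<tau> y / (fact \<tau>)\<^sup>2)
       + (-1) ^ (\<alpha> + 1) * bernoulli_poly (2 * \<alpha>) \<bar>x - y\<bar> / fact (2 * \<alpha>)"

text \<open>Derivatives on the unit interval, one-sided at the end points 0 and 1.\<close>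

primrec deriv01 :: "nat \<Rightarrow> (real \<Rightarrow> real) \<Rightarrow> real \<Rightarrow> real" where
  "deriv01 0 f = f"
| "deriv01 (Suc \<tau>) f = (\<lambda>x. vector_derivative (deriv01 \<tau> f) (at x within {0..1}))"

abbreviation H_sob :: "nat \<Rightarrow> real fun_space" where
  "H_sob \<alpha> \<equiv> rkhs {0..1} (K_sob \<alpha>)"

text \<open>
  The bounds on the order of the derivatives, \<open>\<alpha> - 1\<close> and \<open>\<alpha> - 2\<close>, are stated without subtraction.
  For every element of \<open>H_sob \<alpha>\<close> the derivatives of order below \<open>\<alpha>\<close> exist on the whole interval.
\<close>

definition K_sob_odd :: "nat \<Rightarrow> real \<Rightarrow> real \<Rightarrow> real" where
  "K_sob_odd \<alpha> = reproducing_kernel {0..1}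
     (subspace_where (H_sob \<alpha>)
       (\<lambda>f. \<forall>\<tau>. odd \<tau> \<and> \<tau> + 1 \<le> \<alpha> \<longrightarrow> deriv01 \<tau> f 0 = deriv01 \<tau> f 1))"

definition K_sob_odd_plus :: "nat \<Rightarrow> real \<Rightarrow> real \<Rightarrow> real" where
  "K_sob_odd_plus \<alpha> = reproducing_kernel {0..1}
     (subspace_where (H_sob \<alpha>)
       (\<lambda>f. \<forall>\<tau>. odd \<tau> \<and> \<tau> + 2 \<le> \<alpha> \<longrightarrow> deriv01 \<tau> f 0 = deriv01 \<tau> f 1))"

definition K_sob_odd_bdry0 :: "nat \<Rightarrow> real \<Rightarrow> real \<Rightarrow> real" where
  "K_sob_odd_bdry0 \<alpha> = reproducing_kernel {0..1}
     (subspace_where (H_sob \<alpha>)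
       (\<lambda>f. \<forall>\<tau>. odd \<tau> \<and> \<tau> + 1 \<le> \<alpha> \<longrightarrow> deriv01 \<tau> f 0 = 0 \<and> deriv01 \<tau> f 1 = 0))"


section \<open>Weighted multivariate spaces\<close>

definition unit_cube :: "nat \<Rightarrow> (nat \<Rightarrow> real) set" where
  "unit_cube s = {1..s} \<rightarrow>\<^sub>E {0..1}"

definition weighted_kernel ::
  "nat \<Rightarrow> (nat set \<Rightarrow> real) \<Rightarrow> (real \<Rightarrow> real \<Rightarrow> real) \<Rightarrow> (nat \<Rightarrow> real) \<Rightarrow> (nat \<Rightarrow> real) \<Rightarrow> real" where
  "weighted_kernel s \<gamma> K x y =
     1 + (\<Sum>u | u \<noteq> {} \<and> u \<subseteq> {1..s}. \<gamma> u * (\<Prod>j\<in>u. -1 + K (x j) (y j)))"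

definition H :: "nat \<Rightarrow> (nat set \<Rightarrow> real) \<Rightarrow> (real \<Rightarrow> real \<Rightarrow> real) \<Rightarrow> (nat \<Rightarrow> real) fun_space" where
  "H s \<gamma> K = rkhs (unit_cube s) (weighted_kernel s \<gamma> K)"

end

theory Submission
  imports Defs "HOL-Real_Asymp.Real_Asymp"
begin

text \<open>
  Everything is reduced to the order of positive semidefinite kernels. If \<open>c * L - K\<close> is positive
  semidefinite, then \<open>H(K)\<close> embeds into \<open>H(L)\<close>, and by Schur's product theorem a comparison of
  \<open>K - 1\<close> and \<open>L - 1\<close> for univariate kernels carries over to the weighted kernels.

  Let \<open>b n = B n / n!\<close> be the normalised Bernoulli polynomials, and let \<open>P\<close> and \<open>C\<close> be the full-period
  and the half-period cosine kernels. The Fourier series of \<open>b (2 * \<alpha>)\<close> shows that \<open>K_sob - 1\<close> is the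
  sum of \<open>P\<close> and of \<open>b n \<otimes> b n\<close> for \<open>1 \<le> n \<le> \<alpha>\<close>. As \<open>b n\<close> represents the functional
  \<open>f \<mapsto> f^(n-1) 1 - f^(n-1) 0\<close>, the conditions on the odd derivatives delete even \<open>n\<close> from the sum.

  The same Fourier series shows that \<open>P - C\<close> is a polynomial kernel whose sections span the odd
  polynomials in \<open>x - 1/2\<close> of degree below \<open>2 * \<alpha>\<close>. Hence these polynomials lie in the space of \<open>P + C\<close>,
  and the three kernels \<open>P + C\<close>, \<open>P\<close> plus all \<open>b n \<otimes> b n\<close> for odd \<open>n \<le> \<alpha>\<close>, and \<open>C\<close> plus all
  \<open>b n \<otimes> b n\<close> for odd \<open>n < \<alpha>\<close> are equivalent. In the last representation, the condition that the odd
  derivatives vanish at the boundary annihilates the coefficients of all \<open>b n\<close>, and \<open>C\<close> remains.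
\<close>

section \<open>Finitely supported functionals and positive semidefinite kernels\<close>

text \<open>Kernels are compared instead of function spaces because the elements of the weighted
  spaces in \<open>s\<close> variables have no convenient description, whereas the order of kernels
  survives products, sums and nonnegative weights. The price is that the univariate comparison must
  concern \<open>K - 1\<close>, and a bound of \<open>K\<close> by \<open>c * L\<close> alone does
  not yield it. For the kernels given by series the summand 1 can simply be dropped. The obstacle is
  the space with vanishing odd boundary derivatives: its kernel is only known to exist. It is
  therefore compared with the cosine space as a set of functions, and the result is turned back into
  an inequality of kernels minus 1; this works because in both spaces the integral over the interval
  is represented by the function 1. The spaces and several kernels are introduced by definite
  descriptions, so that the theorem of Moore and Aronszajn, uniqueness included, has to come before
  any comparison.\<close>

definition ev :: "(real \<times> 'a) list \<Rightarrow> ('a \<Rightarrow> real) \<Rightarrow> real" where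
  "ev v f = (\<Sum>(c, x)\<leftarrow>v. c * f x)"

definition scale_list :: "real \<Rightarrow> (real \<times> 'a) list \<Rightarrow> (real \<times> 'a) list" where
  "scale_list a v = map (\<lambda>(c, x). (a * c, x)) v"

text \<open>Lists of coefficients and points stand for combinations of point evaluations. Points may
  repeat, so that concatenation is the sum and \<open>scale_list\<close> the scalar
  multiple.\<close>

definition functionals :: "'a set \<Rightarrow> (real \<times> 'a) list set" where
  "functionals X = {v. snd ` set v \<subseteq> X}"

definition qf :: "('a \<Rightarrow> 'a \<Rightarrow> real) \<Rightarrow> (real \<times> 'a) list \<Rightarrow> (real \<times> 'a) list \<Rightarrow> real" where
  "qf K v w = ev v (\<lambda>x. ev w (K x))"

definition psd :: "'a set \<Rightarrow> ('a \<Rightarrow> 'a \<Rightarrow> real) \<Rightarrow> bool" where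
  "psd X K \<longleftrightarrow> (\<forall>x\<in>X. \<forall>y\<in>X. K x y = K y x) \<and> (\<forall>v\<in>functionals X. qf K v v \<ge> 0)"

definition restr :: "'a set \<Rightarrow> ('a \<Rightarrow> real) \<Rightarrow> 'a \<Rightarrow> real" where
  "restr X f = (\<lambda>x. if x \<in> X then f x else 0)"

text \<open>In a space with reproducing kernel \<open>K\<close> this is the function that represents
  the functional \<open>v\<close>.\<close>

definition section_comb :: "'a set \<Rightarrow> ('a \<Rightarrow> 'a \<Rightarrow> real) \<Rightarrow> (real \<times> 'a) list \<Rightarrow> 'a \<Rightarrow> real" where
  "section_comb X K v = restr X (\<lambda>x. ev v (K x))"

lemma ev_Nil [simp]: "ev [] f = 0"
  by (simp add: ev_def)

lemma ev_Cons [simp]: "ev ((c, x) # v) f = c * f x + ev v f"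
  by (simp add: ev_def)

lemma ev_append [simp]: "ev (v @ w) f = ev v f + ev w f"
  by (simp add: ev_def)

lemma ev_scale_list [simp]: "ev (scale_list a v) f = a * ev v f"
  by (induction v) (auto simp: scale_list_def ev_def algebra_simps)

lemma ev_add: "ev v (\<lambda>x. f x + g x) = ev v f + ev v g"
  by (induction v) (auto simp: algebra_simps)

lemma ev_diff: "ev v (\<lambda>x. f x - g x) = ev v f - ev v g"
  by (induction v) (auto simp: algebra_simps)

lemma ev_cmult: "ev v (\<lambda>x. c * f x) = c * ev v f"
  by (induction v) (auto simp: algebra_simps)

lemma ev_multc: "ev v (\<lambda>x. f x * c) = ev v f * c"
  by (induction v) (auto simp: algebra_simps)

lemma ev_zero [simp]: "ev v (\<lambda>x. 0) = 0"
  by (induction v) auto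

lemma ev_sum: "ev v (\<lambda>x. \<Sum>i\<in>I. f i x) = (\<Sum>i\<in>I. ev v (f i))"
proof (induction v)
  case (Cons p v)
  then show ?case by (cases p) (simp add: sum.distrib sum_distrib_left)
qed simp

lemma ev_sums:
  assumes "v \<in> functionals X" "\<And>x. x \<in> X \<Longrightarrow> (\<lambda>i. f i x) sums g x"
  shows "(\<lambda>i. ev v (f i)) sums ev v g"
  using assms(1)
proof (induction v)
  case (Cons p v)
  then show ?case
    by (cases p) (auto simp: functionals_def intro!: sums_add sums_mult assms(2))
qed simp

lemma ev_tendsto:
  assumes "v \<in> functionals X" "\<And>x. x \<in> X \<Longrightarrow> ((\<lambda>i. f i x) \<longlongrightarrow> g x) F"
  shows "((\<lambda>i. ev v (f i)) \<longlongrightarrow> ev v g) F"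
  using assms(1)
proof (induction v)
  case (Cons p v)
  then show ?case
    by (cases p) (auto simp: functionals_def intro!: tendsto_intros assms(2))
qed simp

lemma ev_cong:
  assumes "v \<in> functionals X" "\<And>x. x \<in> X \<Longrightarrow> f x = g x"
  shows "ev v f = ev v g"
  using assms(1)
proof (induction v)
  case (Cons p v)
  then show ?case by (cases p) (auto simp: functionals_def assms(2))
qed simp

lemma ev_restr [simp]: "v \<in> functionals X \<Longrightarrow> ev v (restr X f) = ev v f"
  by (rule ev_cong[of _ X]) (auto simp: restr_def)

lemma ev_swap: "ev v (\<lambda>x. ev w (K x)) = ev w (\<lambda>y. ev v (\<lambda>x. K x y))"
proof (induction v)
  case (Cons p v)
  then show ?case by (cases p) (simp add: ev_add ev_cmult)
qed simp

lemma functionals_simps [simp]: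
  "[] \<in> functionals X"
  "(c, x) # v \<in> functionals X \<longleftrightarrow> x \<in> X \<and> v \<in> functionals X"
  "v @ w \<in> functionals X \<longleftrightarrow> v \<in> functionals X \<and> w \<in> functionals X"
  "scale_list a v \<in> functionals X \<longleftrightarrow> v \<in> functionals X"
proof -
  have "snd ` set (scale_list a v) = snd ` set v" by (force simp: scale_list_def)
  then show "scale_list a v \<in> functionals X \<longleftrightarrow> v \<in> functionals X"
    by (simp add: functionals_def)
qed (auto simp: functionals_def)

lemma qf_simps [simp]:
  "qf K [] w = 0" "qf K v [] = 0"
  "qf K (v @ v') w = qf K v w + qf K v' w"
  "qf K v (w @ w') = qf K v w + qf K v w'"
  "qf K (scale_list a v) w = a * qf K v w"
  "qf K v (scale_list a w) = a * qf K v w"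
  by (auto simp: qf_def ev_add ev_cmult)

lemma qf_single: "qf K [(a, x)] [(b, y)] = a * b * K x y"
  by (simp add: qf_def)

lemma qf_cong:
  assumes "v \<in> functionals X" "w \<in> functionals X" "\<And>x y. x \<in> X \<Longrightarrow> y \<in> X \<Longrightarrow> K x y = L x y"
  shows "qf K v w = qf L v w"
  unfolding qf_def using assms by (intro ev_cong[of v X] ev_cong[of w X]) auto

lemma qf_add: "qf (\<lambda>x y. K x y + L x y) v w = qf K v w + qf L v w"
  by (simp add: qf_def ev_add)

lemma qf_diff: "qf (\<lambda>x y. K x y - L x y) v w = qf K v w - qf L v w"
  by (simp add: qf_def ev_diff)

lemma qf_cmult: "qf (\<lambda>x y. c * K x y) v w = c * qf K v w"
  by (simp add: qf_def ev_cmult)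

lemma qf_sum: "qf (\<lambda>x y. \<Sum>i\<in>I. K i x y) v w = (\<Sum>i\<in>I. qf (K i) v w)"
  by (simp add: qf_def ev_sum)

lemma qf_prod: "qf (\<lambda>x y. f x * g y) v w = ev v f * ev w g"
  by (simp add: qf_def ev_cmult ev_multc)

lemma qf_sym:
  assumes "psd X K" "v \<in> functionals X" "w \<in> functionals X"
  shows "qf K v w = qf K w v"
proof -
  have "qf K v w = qf (\<lambda>x y. K y x) v w"
    using assms by (intro qf_cong[of _ X]) (auto simp: psd_def)
  also have "\<dots> = qf K w v"
    unfolding qf_def by (rule ev_swap)
  finally show ?thesis .
qed

lemma psd_cong:
  assumes "\<And>x y. x \<in> X \<Longrightarrow> y \<in> X \<Longrightarrow> K x y = L x y"
  shows "psd X K \<longleftrightarrow> psd X L"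
proof -
  have "qf K v v = qf L v v" if "v \<in> functionals X" for v
    using that assms by (intro qf_cong[of v X]) auto
  then show ?thesis using assms by (auto simp: psd_def)
qed

lemma section_comb_simps:
  "section_comb X K (v @ w) = (\<lambda>x. section_comb X K v x + section_comb X K w x)"
  "section_comb X K (scale_list a v) = (\<lambda>x. a * section_comb X K v x)"
  by (auto simp: section_comb_def restr_def)

lemma section_comb_single: "section_comb X K [(1, y)] = kernel_section X K y"
  by (auto simp: section_comb_def restr_def kernel_section_def)

lemma ev_section_comb: "v \<in> functionals X \<Longrightarrow> ev v (section_comb X K w) = qf K v w"
  by (simp add: section_comb_def qf_def)

section \<open>The reproducing kernel Hilbert space of a positive semidefinite kernel\<close>

text \<open>The squared norm is taken as the Legendre-type supremum of \<open>2 v(f) - K(v, v)\<close> over all finitely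
  supported functionals. Substituting \<open>v \<plusminus> w\<close> in it yields the parallelogram law directly.\<close>

definition sqnorm :: "'a set \<Rightarrow> ('a \<Rightarrow> 'a \<Rightarrow> real) \<Rightarrow> ('a \<Rightarrow> real) \<Rightarrow> real" where
  "sqnorm X K f = (SUP v\<in>functionals X. 2 * ev v f - qf K v v)"

definition rk_elems :: "'a set \<Rightarrow> ('a \<Rightarrow> 'a \<Rightarrow> real) \<Rightarrow> ('a \<Rightarrow> real) set" where
  "rk_elems X K = {f. (\<forall>x. x \<notin> X \<longrightarrow> f x = 0) \<and>
     (\<exists>M. \<forall>v\<in>functionals X. 2 * ev v f - qf K v v \<le> M)}"

text \<open>Polarisation of \<open>sqnorm\<close>; the default 0 is the normalisation demanded by
  \<open>inner_fun_space\<close>.\<close>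

definition rk :: "'a set \<Rightarrow> ('a \<Rightarrow> 'a \<Rightarrow> real) \<Rightarrow> 'a fun_space" where
  "rk X K = Fun_Space (rk_elems X K)
     (\<lambda>f g. if f \<in> rk_elems X K \<and> g \<in> rk_elems X K
        then (sqnorm X K (\<lambda>x. f x + g x) - sqnorm X K (\<lambda>x. f x - g x)) / 4 else 0)"

lemma jordan_von_neumann:
  fixes E :: "('a \<Rightarrow> real) set" and N :: "('a \<Rightarrow> real) \<Rightarrow> real"
  defines "B \<equiv> \<lambda>f g. (N (\<lambda>x. f x + g x) - N (\<lambda>x. f x - g x)) / 4"
  assumes add: "\<And>f g. f \<in> E \<Longrightarrow> g \<in> E \<Longrightarrow> (\<lambda>x. f x + g x) \<in> E"
    and scale: "\<And>c f. f \<in> E \<Longrightarrow> (\<lambda>x. c * f x) \<in> E"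
    and par: "\<And>f g. f \<in> E \<Longrightarrow> g \<in> E \<Longrightarrow>
      N (\<lambda>x. f x + g x) + N (\<lambda>x. f x - g x) = 2 * N f + 2 * N g"
    and Nscale: "\<And>c f. f \<in> E \<Longrightarrow> N (\<lambda>x. c * f x) = c\<^sup>2 * N f"
    and pos: "\<And>f. f \<in> E \<Longrightarrow> N f \<ge> 0"
  shows "f \<in> E \<Longrightarrow> g \<in> E \<Longrightarrow> B f g = B g f"
    and "f \<in> E \<Longrightarrow> B f f = N f"
    and "f \<in> E \<Longrightarrow> g \<in> E \<Longrightarrow> h \<in> E \<Longrightarrow> B (\<lambda>x. f x + g x) h = B f h + B g h"
    and "f \<in> E \<Longrightarrow> h \<in> E \<Longrightarrow> B (\<lambda>x. c * f x) h = c * B f h"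
proof -
  have diff: "(\<lambda>x. f x - g x) \<in> E" if "f \<in> E" "g \<in> E" for f g
    using add[OF that(1) scale[OF that(2), of "-1"]] by simp
  have Nminus: "N (\<lambda>x. f x - g x) = N (\<lambda>x. g x - f x)" if "f \<in> E" "g \<in> E" for f g
    using Nscale[OF diff[OF that], of "-1"] by simp
  have N0: "N (\<lambda>x. 0) = 0" if "f \<in> E" for f
    using Nscale[OF that, of 0] by simp
  show sym: "B f g = B g f" if "f \<in> E" "g \<in> E" for f g
    using Nminus[OF that] by (simp add: B_def add.commute)
  show "B f f = N f" if "f \<in> E" for f
    using Nscale[OF that, of 2] N0[OF that] by (simp add: B_def)
  \<comment> \<open>The difference of the parallelogram laws for \<open>f + h\<close>,
    \<open>g + h\<close> and for \<open>f - h\<close>, \<open>g - h\<close>; the terms in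
    \<open>f - g\<close> cancel.\<close>
  have half: "B f h + B g h = B (\<lambda>x. f x + g x) (\<lambda>x. 2 * h x) / 2"
    if f: "f \<in> E" and g: "g \<in> E" and h: "h \<in> E" for f g h
    using par[OF add[OF f h] add[OF g h]] par[OF diff[OF f h] diff[OF g h]]
    by (simp add: B_def algebra_simps) (simp add: field_simps)
  have zero: "B (\<lambda>x. 0) h = 0" if "h \<in> E" for h
    using Nscale[OF that, of "-1"] by (simp add: B_def)
  show Badd: "B (\<lambda>x. f x + g x) h = B f h + B g h" if f: "f \<in> E" and g: "g \<in> E" and h: "h \<in> E" for f g h
  proof -
    have "(\<lambda>x. 0) \<in> E" using scale[OF f, of 0] by simp
    \<comment> \<open>Both instances have the same right-hand side.\<close>
    from half[OF add[OF f g] this h] half[OF f g h] show ?thesis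
      using zero[OF h] by simp
  qed
  show "B (\<lambda>x. c * f x) h = c * B f h" if f: "f \<in> E" and h: "h \<in> E" for f h c
  proof -
    \<comment> \<open>The defect of homogeneity is additive and vanishes on the integers, hence has
      period 1. Positivity bounds it on [0, 1], so it is bounded everywhere, and a bounded additive
      function is 0.\<close>
    define p where "p c = B (\<lambda>x. c * f x) h - c * B f h" for c
    have padd: "p (a + b) = p a + p b" for a b
      using Badd[OF scale[OF f, of a] scale[OF f, of b] h] by (simp add: p_def algebra_simps)
    have p1: "p 1 = 0" by (simp add: p_def)
    have p0: "p 0 = 0" using zero[OF h] by (simp add: p_def)
    have pn: "p (real n * a) = real n * p a" for n a
      by (induction n) (auto simp: p0 padd algebra_simps)
    have pneg: "p (- a) = - p a" for a using padd[of a "-a"] p0 by simp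
    have pnat: "p (real n) = 0" for n using pn[of n 1] p1 by simp
    have pint: "p (of_int k) = 0" for k
      by (cases k rule: int_cases2) (auto simp: pnat pneg)
    define M where "M = N f + N h + \<bar>B f h\<bar>"
    have bd1: "\<bar>p a\<bar> \<le> M" if "0 \<le> a" "a \<le> 1" for a
    proof -
      have aa: "a\<^sup>2 \<le> 1" using that by (simp add: power_le_one)
      have e: "a\<^sup>2 * N f \<le> N f" using mult_right_mono[OF aa pos[OF f]] by simp
      have s: "(\<lambda>x. a * f x) \<in> E" by (rule scale[OF f])
      have p1: "N (\<lambda>x. a * f x + h x) \<ge> 0" by (rule pos[OF add[OF s h]])
      have p2: "N (\<lambda>x. a * f x - h x) \<ge> 0" by (rule pos[OF diff[OF s h]])
      have p3: "N (\<lambda>x. a * f x + h x) + N (\<lambda>x. a * f x - h x) \<le> 2 * N f + 2 * N h"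
        using par[OF s h] Nscale[OF f, of a] e by simp
      have "\<bar>B (\<lambda>x. a * f x) h\<bar> \<le> N f + N h"
        using p1 p2 p3 pos[OF f] pos[OF h] by (simp add: B_def)
      moreover have "\<bar>a * B f h\<bar> \<le> \<bar>B f h\<bar>" using that by (simp add: abs_mult mult_left_le_one_le)
      ultimately show ?thesis by (simp add: p_def M_def)
    qed
    have bd: "\<bar>p a\<bar> \<le> M" for a
    proof -
      have "p a = p (of_int \<lfloor>a\<rfloor> + frac a)" by (simp add: frac_def)
      also have "\<dots> = p (frac a)" by (simp add: padd pint)
      finally show ?thesis using bd1[of "frac a"] frac_lt_1[of a] by simp
    qed
    have "p c = 0"
    proof (rule ccontr)
      assume "p c \<noteq> 0"
      then obtain n where "real n * \<bar>p c\<bar> > M" using reals_Archimedean3[of "\<bar>p c\<bar>"] by auto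
      with bd[of "real n * c"] show False by (simp add: pn abs_mult)
    qed
    then show ?thesis by (simp add: p_def)
  qed
qed

locale psd_kernel =
  fixes X :: "'a set" and K :: "'a \<Rightarrow> 'a \<Rightarrow> real"
  assumes psd: "psd X K"
begin

abbreviation "E \<equiv> rk_elems X K"
abbreviation "N \<equiv> sqnorm X K"

lemma K_sym: "x \<in> X \<Longrightarrow> y \<in> X \<Longrightarrow> K x y = K y x"
  using psd by (auto simp: psd_def)

lemma qf_nonneg: "v \<in> functionals X \<Longrightarrow> qf K v v \<ge> 0"
  using psd by (auto simp: psd_def)

lemma elems_outside: "f \<in> E \<Longrightarrow> x \<notin> X \<Longrightarrow> f x = 0"
  by (auto simp: rk_elems_def)

lemma sqnorm_upper: "f \<in> E \<Longrightarrow> v \<in> functionals X \<Longrightarrow> 2 * ev v f - qf K v v \<le> N f"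
  unfolding sqnorm_def by (rule cSUP_upper) (auto simp: rk_elems_def bdd_above_def)

lemma elemsI: "(\<And>x. x \<notin> X \<Longrightarrow> f x = 0) \<Longrightarrow>
    (\<And>v. v \<in> functionals X \<Longrightarrow> 2 * ev v f - qf K v v \<le> M) \<Longrightarrow> f \<in> E"
  by (auto simp: rk_elems_def)

lemma sqnorm_least: "(\<And>v. v \<in> functionals X \<Longrightarrow> 2 * ev v f - qf K v v \<le> M) \<Longrightarrow> N f \<le> M"
  unfolding sqnorm_def by (rule cSUP_least) (auto intro: exI[of _ "[]"] functionals_simps(1))

lemma sqnorm_nonneg: "f \<in> E \<Longrightarrow> N f \<ge> 0"
  using sqnorm_upper[of f "[]"] by simp

text \<open>Each of \<open>f\<close> and \<open>g\<close> is tested with half of \<open>v\<close>.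
  The crude bound serves to obtain closure under addition; the parallelogram law refines it.\<close>

lemma sqnorm_add_le:
  assumes f: "f \<in> E" and g: "g \<in> E"
  shows "(\<lambda>x. f x + g x) \<in> E \<and> N (\<lambda>x. f x + g x) \<le> 2 * N f + 2 * N g"
proof -
  have *: "2 * ev v (\<lambda>x. f x + g x) - qf K v v \<le> 2 * N f + 2 * N g" if v: "v \<in> functionals X" for v
  proof -
    have "scale_list (1/2) v \<in> functionals X" using v by simp
    from sqnorm_upper[OF f this] sqnorm_upper[OF g this] show ?thesis by (simp add: ev_add)
  qed
  moreover have "(\<lambda>x. f x + g x) \<in> E"
    by (rule elemsI[OF _ *]) (auto simp: elems_outside f g)
  ultimately show ?thesis by (auto intro: sqnorm_least)
qed

lemma add_elems: "f \<in> E \<Longrightarrow> g \<in> E \<Longrightarrow> (\<lambda>x. f x + g x) \<in> E"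
  using sqnorm_add_le by blast

lemma zero_elems: "(\<lambda>x. 0) \<in> E" and sqnorm_zero: "N (\<lambda>x. 0) = 0"
proof -
  have *: "2 * ev v (\<lambda>x. 0) - qf K v v \<le> 0" if "v \<in> functionals X" for v
    using qf_nonneg[OF that] by simp
  show "(\<lambda>x. 0) \<in> E" by (rule elemsI[OF _ *]) auto
  then show "N (\<lambda>x. 0) = 0" using sqnorm_least[OF *] sqnorm_nonneg by force
qed

text \<open>Testing \<open>c * f\<close> with \<open>v\<close> amounts to testing \<open>f\<close>
  with \<open>v\<close> divided by \<open>c\<close>. Applied to \<open>1 / c\<close> as well, the
  bound becomes an equality.\<close>

lemma scale_elems_le:
  assumes f: "f \<in> E"
  shows "(\<lambda>x. c * f x) \<in> E \<and> N (\<lambda>x. c * f x) \<le> c\<^sup>2 * N f"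
proof (cases "c = 0")
  case True
  then show ?thesis by (simp add: zero_elems sqnorm_zero)
next
  case False
  have *: "2 * ev v (\<lambda>x. c * f x) - qf K v v \<le> c\<^sup>2 * N f" if v: "v \<in> functionals X" for v
  proof -
    have "scale_list (1/c) v \<in> functionals X" using v by simp
    from mult_left_mono[OF sqnorm_upper[OF f this], of "c * c"]
    have "c * c * (2 * (1 / c * ev v f) - 1 / c * (1 / c * qf K v v)) \<le> c * c * N f" by simp
    moreover have "c * c * (2 * (1 / c * ev v f) - 1 / c * (1 / c * qf K v v)) = 2 * (c * ev v f) - qf K v v"
      using False by (simp add: field_simps)
    ultimately show ?thesis by (simp add: ev_cmult power2_eq_square)
  qed
  moreover have "(\<lambda>x. c * f x) \<in> E"
    by (rule elemsI[OF _ *]) (auto simp: elems_outside f)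
  ultimately show ?thesis by (auto intro: sqnorm_least)
qed

lemma scale_elems: "f \<in> E \<Longrightarrow> (\<lambda>x. c * f x) \<in> E"
  using scale_elems_le by blast

lemma sqnorm_scale:
  assumes f: "f \<in> E"
  shows "N (\<lambda>x. c * f x) = c\<^sup>2 * N f"
proof (cases "c = 0")
  case True
  then show ?thesis by (simp add: sqnorm_zero)
next
  case False
  have "N f \<le> (1/c)\<^sup>2 * N (\<lambda>x. c * f x)"
    using scale_elems_le[OF scale_elems[OF f, of c], of "1/c"] False by simp
  then have "c\<^sup>2 * N f \<le> N (\<lambda>x. c * f x)" using False by (simp add: field_simps)
  then show ?thesis using scale_elems_le[OF f, of c] by simp
qed

lemma diff_elems: "f \<in> E \<Longrightarrow> g \<in> E \<Longrightarrow> (\<lambda>x. f x - g x) \<in> E"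
  using add_elems[OF _ scale_elems[of g "-1"]] by simp

lemma parallelogram_ge:
  assumes f: "f \<in> E" and g: "g \<in> E"
  shows "2 * N f + 2 * N g \<le> N (\<lambda>x. f x + g x) + N (\<lambda>x. f x - g x)"
proof -
  let ?S = "N (\<lambda>x. f x + g x) + N (\<lambda>x. f x - g x)"
  have *: "2 * (2 * ev v f - qf K v v) + 2 * (2 * ev w g - qf K w w) \<le> ?S"
    if "v \<in> functionals X" "w \<in> functionals X" for v w
    using sqnorm_upper[OF add_elems[OF f g], of "v @ w"]
      sqnorm_upper[OF diff_elems[OF f g], of "v @ scale_list (-1) w"] that
    by (simp add: ev_add ev_diff algebra_simps)
  have "2 * ev v f - qf K v v \<le> ?S / 2 - N g" if v: "v \<in> functionals X" for v
  proof -
    have "N g \<le> ?S / 2 - (2 * ev v f - qf K v v)"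
      by (rule sqnorm_least) (use *[OF v] in \<open>simp add: field_simps\<close>)
    then show ?thesis by simp
  qed
  then have "N f \<le> ?S / 2 - N g" by (rule sqnorm_least)
  moreover have "2 * a + 2 * b \<le> c" if "a \<le> c / 2 - b" for a b c :: real using that by simp
  ultimately show ?thesis by blast
qed

text \<open>Applied to \<open>f + g\<close> and \<open>f - g\<close>, the inequality
  \<open>parallelogram_ge\<close> is its own converse, up to the factor 4 from
  \<open>sqnorm_scale\<close>.\<close>

lemma parallelogram:
  assumes f: "f \<in> E" and g: "g \<in> E"
  shows "N (\<lambda>x. f x + g x) + N (\<lambda>x. f x - g x) = 2 * N f + 2 * N g"
proof -
  have "2 * N (\<lambda>x. f x + g x) + 2 * N (\<lambda>x. f x - g x) \<le> N (\<lambda>x. 2 * f x) + N (\<lambda>x. 2 * g x)"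
    using parallelogram_ge[OF add_elems[OF f g] diff_elems[OF f g]] by simp
  also have "\<dots> = 4 * N f + 4 * N g" using f g by (simp add: sqnorm_scale)
  finally show ?thesis using parallelogram_ge[OF f g] by simp
qed

lemma elems_rk [simp]: "elems (rk X K) = E"
  by (simp add: rk_def)

lemma ip_rk: "f \<in> E \<Longrightarrow> g \<in> E \<Longrightarrow> ip (rk X K) f g = (N (\<lambda>x. f x + g x) - N (\<lambda>x. f x - g x)) / 4"
  by (simp add: rk_def)

lemma
  shows ip_rk_sym: "f \<in> E \<Longrightarrow> g \<in> E \<Longrightarrow> ip (rk X K) f g = ip (rk X K) g f"
    and ip_rk_self: "f \<in> E \<Longrightarrow> ip (rk X K) f f = N f"
    and ip_rk_add: "f \<in> E \<Longrightarrow> g \<in> E \<Longrightarrow> h \<in> E \<Longrightarrow>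
      ip (rk X K) (\<lambda>x. f x + g x) h = ip (rk X K) f h + ip (rk X K) g h"
    and ip_rk_scale: "f \<in> E \<Longrightarrow> h \<in> E \<Longrightarrow>
      ip (rk X K) (\<lambda>x. c * f x) h = c * ip (rk X K) f h"
proof -
  note [intro] = add_elems scale_elems parallelogram sqnorm_scale sqnorm_nonneg
  show "ip (rk X K) f g = ip (rk X K) g f" if "f \<in> E" "g \<in> E"
    unfolding ip_rk[OF that] ip_rk[OF that(2,1)]
    by (rule jordan_von_neumann(1)[where E = E]) (use that in auto)
  show "ip (rk X K) f f = N f" if "f \<in> E"
    unfolding ip_rk[OF that that]
    by (rule jordan_von_neumann(2)[where E = E]) (use that in auto)
  show "ip (rk X K) (\<lambda>x. f x + g x) h = ip (rk X K) f h + ip (rk X K) g h"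
    if "f \<in> E" "g \<in> E" "h \<in> E"
    unfolding ip_rk[OF add_elems[OF that(1,2)] that(3)] ip_rk[OF that(1,3)] ip_rk[OF that(2,3)]
    by (rule jordan_von_neumann(3)[where E = E]) (use that in auto)
  show "ip (rk X K) (\<lambda>x. c * f x) h = c * ip (rk X K) f h" if "f \<in> E" "h \<in> E"
    unfolding ip_rk[OF scale_elems[OF that(1)] that(2)] ip_rk[OF that]
    by (rule jordan_von_neumann(4)[where E = E]) (use that in auto)
qed

text \<open>Completing the square: translating the test functional by \<open>w\<close> corresponds
  to adding the representer of \<open>w\<close> to the function. As the translation is invertible,
  the supremum changes exactly by the stated constant.\<close>

lemma section_comb_aux:
  assumes f: "f \<in> E" and w: "w \<in> functionals X"
  shows "(\<lambda>x. f x + section_comb X K w x) \<in> E"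
    and "N (\<lambda>x. f x + section_comb X K w x) = N f + 2 * ev w f + qf K w w"
proof -
  let ?h = "\<lambda>x. f x + section_comb X K w x"
  have *: "2 * ev v ?h - qf K v v =
      2 * ev (v @ scale_list (-1) w) f - qf K (v @ scale_list (-1) w) (v @ scale_list (-1) w)
      + 2 * ev w f + qf K w w" if "v \<in> functionals X" for v
    using that by (simp add: ev_add ev_section_comb algebra_simps qf_sym[OF psd w that])
  have le: "2 * ev v ?h - qf K v v \<le> N f + 2 * ev w f + qf K w w" if "v \<in> functionals X" for v
    using sqnorm_upper[OF f, of "v @ scale_list (-1) w"] *[OF that] that w by simp
  show h: "?h \<in> E"
    by (rule elemsI[OF _ le]) (auto simp: elems_outside f section_comb_def restr_def)
  have "N f \<le> N ?h - 2 * ev w f - qf K w w"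
  proof (rule sqnorm_least)
    fix v assume v: "v \<in> functionals X"
    then show "2 * ev v f - qf K v v \<le> N ?h - 2 * ev w f - qf K w w"
      using sqnorm_upper[OF h, of "v @ w"] *[of "v @ w"] w
      by (simp add: algebra_simps)
  qed
  then show "N ?h = N f + 2 * ev w f + qf K w w"
    using sqnorm_least[OF le] by simp
qed

lemma section_comb_elems: "w \<in> functionals X \<Longrightarrow> section_comb X K w \<in> E"
  using section_comb_aux(1)[OF zero_elems] by simp

lemma ip_section_comb:
  assumes f: "f \<in> E" and w: "w \<in> functionals X"
  shows "ip (rk X K) f (section_comb X K w) = ev w f"
proof -
  have "(\<lambda>x. f x - section_comb X K w x) = (\<lambda>x. f x + section_comb X K (scale_list (-1) w) x)"
    by (simp add: section_comb_simps)
  then have "N (\<lambda>x. f x - section_comb X K w x) = N f - 2 * ev w f + qf K w w"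
    using section_comb_aux(2)[OF f, of "scale_list (-1) w"] w by simp
  then show ?thesis
    using section_comb_aux(2)[OF f w] by (simp add: ip_rk f section_comb_elems w)
qed

lemma sqnorm_section_comb: "w \<in> functionals X \<Longrightarrow> N (section_comb X K w) = qf K w w"
  using section_comb_aux(2)[OF zero_elems] by (simp add: sqnorm_zero)

text \<open>The squared distance is the gap that \<open>w\<close> leaves in the supremum defining
  \<open>N f\<close>, so that nearly optimal functionals give good approximations.\<close>

lemma sqnorm_diff_section_comb:
  assumes f: "f \<in> E" and w: "w \<in> functionals X"
  shows "N (\<lambda>x. f x - section_comb X K w x) = N f - (2 * ev w f - qf K w w)"
  using section_comb_aux(2)[OF f, of "scale_list (-1) w"] w by (simp add: section_comb_simps)

text \<open>Cauchy-Schwarz, by optimising over the multiples of \<open>v\<close>. If the form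
  vanishes at \<open>v\<close>, a linear function of the factor is bounded, so \<open>ev v f\<close>
  is 0.\<close>

lemma ev_square_le:
  assumes f: "f \<in> E" and v: "v \<in> functionals X"
  shows "(ev v f)\<^sup>2 \<le> N f * qf K v v"
proof -
  have *: "2 * t * ev v f - t\<^sup>2 * qf K v v \<le> N f" for t
    using sqnorm_upper[OF f, of "scale_list t v"] v by (simp add: power2_eq_square)
  show ?thesis
  proof (cases "qf K v v = 0")
    case True
    have "ev v f = 0"
    proof (rule ccontr)
      assume "ev v f \<noteq> 0"
      then show False using *[of "(N f + 1) / ev v f"] True sqnorm_nonneg[OF f] by simp
    qed
    then show ?thesis using True by simp
  next
    case False
    then have "qf K v v > 0" using qf_nonneg[OF v] by simp
    then show ?thesis using *[of "ev v f / qf K v v"]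
      by (simp add: field_simps power2_eq_square)
  qed
qed

lemma pointwise_square_le: "f \<in> E \<Longrightarrow> x \<in> X \<Longrightarrow> (f x)\<^sup>2 \<le> N f * K x x"
  using ev_square_le[of f "[(1, x)]"] by (simp add: qf_single)

lemma sqnorm_eq_0: "f \<in> E \<Longrightarrow> N f = 0 \<Longrightarrow> f = (\<lambda>x. 0)"
  using pointwise_square_le[of f] elems_outside[of f] by fastforce

lemma inner_fun_space_rk: "inner_fun_space X (rk X K)"
  unfolding inner_fun_space_def
proof (intro conjI ballI allI impI)
  show "ip (rk X K) (\<lambda>x. f x + g x) h = ip (rk X K) f h + ip (rk X K) g h"
    if "f \<in> elems (rk X K)" "g \<in> elems (rk X K)" "h \<in> elems (rk X K)" for f g h
    using that by (simp add: ip_rk_add)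
  show "ip (rk X K) (\<lambda>x. c * f x) h = c * ip (rk X K) f h"
    if "f \<in> elems (rk X K)" "h \<in> elems (rk X K)" for c f h
    using that by (simp add: ip_rk_scale)
  show "ip (rk X K) f g = ip (rk X K) g f" if "f \<in> elems (rk X K)" "g \<in> elems (rk X K)" for f g
    using that by (simp add: ip_rk_sym)
  show "0 < ip (rk X K) f f" if "f \<in> elems (rk X K)" "f \<noteq> (\<lambda>x. 0)" for f
    using that sqnorm_eq_0[of f] sqnorm_nonneg[of f] by (force simp: ip_rk_self)
qed (auto simp: elems_outside zero_elems add_elems scale_elems rk_def)

lemma fnorm_rk: "f \<in> E \<Longrightarrow> fnorm (rk X K) f = sqrt (N f)"
  by (simp add: fnorm_def ip_rk_self)

end

section \<open>Hilbert function spaces\<close>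

locale inner_space =
  fixes X :: "'a set" and V :: "'a fun_space"
  assumes inner: "inner_fun_space X V"
begin

lemma outside: "f \<in> elems V \<Longrightarrow> x \<notin> X \<Longrightarrow> f x = 0"
  and zero_mem: "(\<lambda>x. 0) \<in> elems V"
  and add_mem: "f \<in> elems V \<Longrightarrow> g \<in> elems V \<Longrightarrow> (\<lambda>x. f x + g x) \<in> elems V"
  and scale_mem: "f \<in> elems V \<Longrightarrow> (\<lambda>x. c * f x) \<in> elems V"
  and ip_outside: "f \<notin> elems V \<or> g \<notin> elems V \<Longrightarrow> ip V f g = 0"
  and ip_sym: "f \<in> elems V \<Longrightarrow> g \<in> elems V \<Longrightarrow> ip V f g = ip V g f"
  and ip_add: "f \<in> elems V \<Longrightarrow> g \<in> elems V \<Longrightarrow> h \<in> elems V \<Longrightarrow>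
    ip V (\<lambda>x. f x + g x) h = ip V f h + ip V g h"
  and ip_scale: "f \<in> elems V \<Longrightarrow> h \<in> elems V \<Longrightarrow> ip V (\<lambda>x. c * f x) h = c * ip V f h"
  and ip_pos: "f \<in> elems V \<Longrightarrow> f \<noteq> (\<lambda>x. 0) \<Longrightarrow> ip V f f > 0"
  using inner unfolding inner_fun_space_def by blast+

lemma diff_mem: "f \<in> elems V \<Longrightarrow> g \<in> elems V \<Longrightarrow> (\<lambda>x. f x - g x) \<in> elems V"
  using add_mem[OF _ scale_mem[of g "-1"]] by simp

lemma ip_diff: "f \<in> elems V \<Longrightarrow> g \<in> elems V \<Longrightarrow> h \<in> elems V \<Longrightarrow>
    ip V (\<lambda>x. f x - g x) h = ip V f h - ip V g h"
  using ip_add[OF _ scale_mem[of g "-1"], of f h] ip_scale[of g h "-1"] by simp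

lemma ip_add_right: "f \<in> elems V \<Longrightarrow> g \<in> elems V \<Longrightarrow> h \<in> elems V \<Longrightarrow>
    ip V h (\<lambda>x. f x + g x) = ip V h f + ip V h g"
  using ip_add[of f g h] ip_sym add_mem by metis

lemma ip_diff_right: "f \<in> elems V \<Longrightarrow> g \<in> elems V \<Longrightarrow> h \<in> elems V \<Longrightarrow>
    ip V h (\<lambda>x. f x - g x) = ip V h f - ip V h g"
  using ip_diff[of f g h] ip_sym diff_mem by metis

lemma ip_scale_right: "f \<in> elems V \<Longrightarrow> h \<in> elems V \<Longrightarrow> ip V h (\<lambda>x. c * f x) = c * ip V h f"
  using ip_scale[of f h c] ip_sym scale_mem by metis

lemma ip_zero: "ip V (\<lambda>x. 0) (\<lambda>x. 0) = 0"
  using ip_scale[OF zero_mem zero_mem, of 0] by simp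

lemma ip_nonneg: "ip V f f \<ge> 0"
  using ip_pos[of f] ip_zero ip_outside[of f f] by (cases "f \<in> elems V"; cases "f = (\<lambda>x. 0)") auto

lemma sum_mem: "finite I \<Longrightarrow> (\<And>i. i \<in> I \<Longrightarrow> f i \<in> elems V) \<Longrightarrow> (\<lambda>x. \<Sum>i\<in>I. f i x) \<in> elems V"
  by (induction I rule: finite_induct) (auto simp: zero_mem intro!: add_mem)

lemma ip_sum:
  assumes "finite I" "\<And>i. i \<in> I \<Longrightarrow> f i \<in> elems V" "h \<in> elems V"
  shows "ip V (\<lambda>x. \<Sum>i\<in>I. f i x) h = (\<Sum>i\<in>I. ip V (f i) h)"
  using assms(1,2)
proof (induction I rule: finite_induct)
  case empty
  then show ?case using ip_scale[OF zero_mem assms(3), of 0] by simp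
next
  case (insert i I)
  then show ?case by (simp add: ip_add sum_mem assms(3))
qed

lemma fnorm_nonneg: "fnorm V f \<ge> 0"
  by (simp add: fnorm_def ip_nonneg)

lemma fnorm_sq: "(fnorm V f)\<^sup>2 = ip V f f"
  by (simp add: fnorm_def ip_nonneg)

lemma ip_self_add: "f \<in> elems V \<Longrightarrow> g \<in> elems V \<Longrightarrow>
    ip V (\<lambda>x. f x + g x) (\<lambda>x. f x + g x) = ip V f f + 2 * ip V f g + ip V g g"
  by (simp add: ip_add ip_add_right add_mem ip_sym[of g f])

lemma ip_self_diff: "f \<in> elems V \<Longrightarrow> g \<in> elems V \<Longrightarrow>
    ip V (\<lambda>x. f x - g x) (\<lambda>x. f x - g x) = ip V f f - 2 * ip V f g + ip V g g"
  by (simp add: ip_diff ip_diff_right diff_mem ip_sym[of g f])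

lemma ip_polar: "f \<in> elems V \<Longrightarrow> g \<in> elems V \<Longrightarrow> ip V f g =
    (ip V (\<lambda>x. f x + g x) (\<lambda>x. f x + g x) - ip V (\<lambda>x. f x - g x) (\<lambda>x. f x - g x)) / 4"
  by (simp add: ip_self_add ip_self_diff)

lemma ip_self_eq_0: "f \<in> elems V \<Longrightarrow> ip V f f = 0 \<Longrightarrow> f = (\<lambda>x. 0)"
  using ip_pos[of f] by fastforce

lemma cauchy_schwarz:
  assumes f: "f \<in> elems V" and g: "g \<in> elems V"
  shows "(ip V f g)\<^sup>2 \<le> ip V f f * ip V g g"
proof (cases "g = (\<lambda>x. 0)")
  case True
  have "ip V (\<lambda>x. 0 * f x) f = 0 * ip V f f" by (rule ip_scale[OF f f])
  then have "ip V f g = 0" using True ip_sym[OF f g] by simp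
  then show ?thesis by (simp add: ip_nonneg)
next
  case False
  then have p: "ip V g g > 0" by (rule ip_pos[OF g])
  define t where "t = ip V f g / ip V g g"
  have "0 \<le> ip V (\<lambda>x. f x - t * g x) (\<lambda>x. f x - t * g x)" by (rule ip_nonneg)
  also have "\<dots> = ip V f f - 2 * (t * ip V f g) + t * (t * ip V g g)"
    by (simp add: ip_self_diff f g scale_mem ip_scale ip_scale_right)
  finally show ?thesis using p by (simp add: t_def field_simps power2_eq_square)
qed

lemma abs_ip_le: "f \<in> elems V \<Longrightarrow> g \<in> elems V \<Longrightarrow> \<bar>ip V f g\<bar> \<le> fnorm V f * fnorm V g"
  using cauchy_schwarz[of f g] by (simp add: fnorm_def real_le_rsqrt flip: real_sqrt_mult)

lemma fnorm_triangle:
  assumes f: "f \<in> elems V" and g: "g \<in> elems V"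
  shows "fnorm V (\<lambda>x. f x + g x) \<le> fnorm V f + fnorm V g"
proof -
  have "(fnorm V (\<lambda>x. f x + g x))\<^sup>2 \<le> (fnorm V f + fnorm V g)\<^sup>2"
    using abs_ip_le[OF f g] by (simp add: fnorm_sq ip_self_add f g power2_sum)
  then show ?thesis using fnorm_nonneg power2_le_imp_le by (metis add_nonneg_nonneg)
qed

lemma fnorm_eq_0: "f \<in> elems V \<Longrightarrow> fnorm V f = 0 \<Longrightarrow> f = (\<lambda>x. 0)"
  using ip_self_eq_0 by (simp add: fnorm_def)

lemma fnorm_scale: "f \<in> elems V \<Longrightarrow> fnorm V (\<lambda>x. c * f x) = \<bar>c\<bar> * fnorm V f"
  by (simp add: fnorm_def ip_scale ip_scale_right scale_mem real_sqrt_mult flip: mult.assoc)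

lemma fnorm_minus: "fnorm V (\<lambda>x. f x - g x) = fnorm V (\<lambda>x. g x - f x)"
proof (cases "(\<lambda>x. f x - g x) \<in> elems V")
  case True
  then show ?thesis using fnorm_scale[OF True, of "-1"] by simp
next
  case False
  then have "(\<lambda>x. g x - f x) \<notin> elems V" using scale_mem[of "\<lambda>x. g x - f x" "-1"] by auto
  then show ?thesis using False by (simp add: fnorm_def ip_outside)
qed

lemma fnorm_tendsto:
  assumes \<sigma>: "\<And>n. \<sigma> n \<in> elems V" and f: "f \<in> elems V"
    and lim: "(\<lambda>n. fnorm V (\<lambda>x. \<sigma> n x - f x)) \<longlonglongrightarrow> 0"
  shows "(\<lambda>n. fnorm V (\<sigma> n)) \<longlonglongrightarrow> fnorm V f"
proof -
  have "norm (fnorm V (\<sigma> n) - fnorm V f) \<le> fnorm V (\<lambda>x. \<sigma> n x - f x)" for n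
  proof -
    have "fnorm V (\<lambda>x. (\<sigma> n x - f x) + f x) \<le> fnorm V (\<lambda>x. \<sigma> n x - f x) + fnorm V f"
      by (rule fnorm_triangle[OF diff_mem[OF \<sigma> f] f])
    moreover have "fnorm V (\<lambda>x. (f x - \<sigma> n x) + \<sigma> n x) \<le> fnorm V (\<lambda>x. f x - \<sigma> n x) + fnorm V (\<sigma> n)"
      by (rule fnorm_triangle[OF diff_mem[OF f \<sigma>] \<sigma>])
    ultimately show ?thesis using fnorm_minus[of f "\<sigma> n"] by (simp add: abs_le_iff)
  qed
  then have "(\<lambda>n. fnorm V (\<sigma> n) - fnorm V f) \<longlonglongrightarrow> 0"
    by (intro Lim_null_comparison[OF _ lim] always_eventually) simp
  then show ?thesis by (simp add: LIM_zero_iff)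
qed

lemma convergent_cauchy:
  assumes \<sigma>: "\<And>n. \<sigma> n \<in> elems V" and f: "f \<in> elems V"
    and lim: "(\<lambda>n. fnorm V (\<lambda>x. \<sigma> n x - f x)) \<longlonglongrightarrow> 0" and e: "e > 0"
  shows "\<exists>M. \<forall>m\<ge>M. \<forall>n\<ge>M. fnorm V (\<lambda>x. \<sigma> m x - \<sigma> n x) < e"
proof -
  obtain M where M: "\<And>n. n \<ge> M \<Longrightarrow> norm (fnorm V (\<lambda>x. \<sigma> n x - f x) - 0) < e / 2"
    using LIMSEQ_D[OF lim, of "e / 2"] e by auto
  have "fnorm V (\<lambda>x. \<sigma> m x - \<sigma> n x) < e" if "m \<ge> M" "n \<ge> M" for m n
  proof -
    have "fnorm V (\<lambda>x. (\<sigma> m x - f x) + (f x - \<sigma> n x)) \<le>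
        fnorm V (\<lambda>x. \<sigma> m x - f x) + fnorm V (\<lambda>x. f x - \<sigma> n x)"
      by (intro fnorm_triangle diff_mem \<sigma> f)
    also have "\<dots> < e / 2 + e / 2"
      using M[OF that(1)] M[OF that(2)] fnorm_minus[of f "\<sigma> n"] by (intro add_strict_mono) auto
    finally show ?thesis by simp
  qed
  then show ?thesis by blast
qed

lemma metric: "Metric_space (elems V) (\<lambda>f g. fnorm V (\<lambda>x. f x - g x))"
proof
  show "fnorm V (\<lambda>x. f x - g x) = fnorm V (\<lambda>x. g x - f x)" for f g
    by (rule fnorm_minus)
  show "(fnorm V (\<lambda>x. f x - g x) = 0) = (f = g)" if "f \<in> elems V" "g \<in> elems V" for f g
  proof
    assume "fnorm V (\<lambda>x. f x - g x) = 0"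
    then have "(\<lambda>x. f x - g x) = (\<lambda>x. 0)" by (rule fnorm_eq_0[OF diff_mem[OF that]])
    then show "f = g" by (metis diff_eq_diff_eq diff_self ext)
  qed (simp add: fnorm_def ip_zero)
  show "fnorm V (\<lambda>x. f x - h x) \<le> fnorm V (\<lambda>x. f x - g x) + fnorm V (\<lambda>x. g x - h x)"
    if "f \<in> elems V" "g \<in> elems V" "h \<in> elems V" for f g h
    using fnorm_triangle[OF diff_mem[OF that(1,2)] diff_mem[OF that(2,3)]] by simp
qed (simp add: fnorm_nonneg)

lemma mcomplete_iff: "Metric_space.mcomplete (elems V) (\<lambda>f g. fnorm V (\<lambda>x. f x - g x)) \<longleftrightarrow>
    (\<forall>\<sigma>. (\<forall>n. \<sigma> n \<in> elems V) \<longrightarrow>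
      (\<forall>e>0. \<exists>M. \<forall>m\<ge>M. \<forall>n\<ge>M. fnorm V (\<lambda>x. \<sigma> m x - \<sigma> n x) < e) \<longrightarrow>
      (\<exists>f\<in>elems V. (\<lambda>n. fnorm V (\<lambda>x. \<sigma> n x - f x)) \<longlonglongrightarrow> 0))"
proof -
  interpret Metric_space "elems V" "\<lambda>f g. fnorm V (\<lambda>x. f x - g x)" by (rule metric)
  have "MCauchy \<sigma> \<longleftrightarrow> (\<forall>n. \<sigma> n \<in> elems V) \<and>
      (\<forall>e>0. \<exists>M. \<forall>m\<ge>M. \<forall>n\<ge>M. fnorm V (\<lambda>x. \<sigma> m x - \<sigma> n x) < e)" for \<sigma>
  proof -
    have r: "(\<forall>n n'. N \<le> n \<longrightarrow> N \<le> n' \<longrightarrow> P n n') = (\<forall>m\<ge>N. \<forall>n\<ge>N. P m n)"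
      for N :: nat and P by blast
    show ?thesis unfolding MCauchy_def r by (simp add: image_subset_iff)
  qed
  moreover have "limitin mtopology \<sigma> f sequentially \<longleftrightarrow>
      f \<in> elems V \<and> (\<lambda>n. fnorm V (\<lambda>x. \<sigma> n x - f x)) \<longlonglongrightarrow> 0" if "\<forall>n. \<sigma> n \<in> elems V" for \<sigma> f
    unfolding limitin_metric_dist_null using that by simp
  ultimately show ?thesis unfolding mcomplete_def by blast
qed

end

section \<open>Completeness by Cauchy sequences, and the Riesz representation of point
  evaluations\<close>

lemma hilbert_fun_spaceI:
  assumes "inner_fun_space X V"
    and "\<And>\<sigma>. (\<And>n. \<sigma> n \<in> elems V) \<Longrightarrow>
      (\<And>e. e > 0 \<Longrightarrow> \<exists>M. \<forall>m\<ge>M. \<forall>n\<ge>M. fnorm V (\<lambda>x. \<sigma> m x - \<sigma> n x) < e) \<Longrightarrow>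
      \<exists>f\<in>elems V. (\<lambda>n. fnorm V (\<lambda>x. \<sigma> n x - f x)) \<longlonglongrightarrow> 0"
  shows "hilbert_fun_space X V"
proof -
  interpret inner_space X V by unfold_locales (rule assms(1))
  show ?thesis
    unfolding hilbert_fun_space_def mcomplete_iff
  proof (intro conjI allI impI)
    show "inner_fun_space X V" by (rule assms(1))
  next
    fix \<sigma> :: "nat \<Rightarrow> 'a \<Rightarrow> real"
    assume "\<forall>n. \<sigma> n \<in> elems V" "\<forall>e>0. \<exists>M. \<forall>m\<ge>M. \<forall>n\<ge>M. fnorm V (\<lambda>x. \<sigma> m x - \<sigma> n x) < e"
    then show "\<exists>f\<in>elems V. (\<lambda>n. fnorm V (\<lambda>x. \<sigma> n x - f x)) \<longlonglongrightarrow> 0"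
      by (intro assms(2)) simp_all
  qed
qed

lemma hilbert_fun_space_complete:
  assumes "hilbert_fun_space X V" "\<And>n. \<sigma> n \<in> elems V"
    and "\<And>e. e > 0 \<Longrightarrow> \<exists>M. \<forall>m\<ge>M. \<forall>n\<ge>M. fnorm V (\<lambda>x. \<sigma> m x - \<sigma> n x) < e"
  obtains f where "f \<in> elems V" "(\<lambda>n. fnorm V (\<lambda>x. \<sigma> n x - f x)) \<longlonglongrightarrow> 0"
proof -
  interpret inner_space X V by unfold_locales (use assms(1) in \<open>simp add: hilbert_fun_space_def\<close>)
  have "(\<forall>n. \<sigma> n \<in> elems V) \<longrightarrow>
      (\<forall>e>0. \<exists>M. \<forall>m\<ge>M. \<forall>n\<ge>M. fnorm V (\<lambda>x. \<sigma> m x - \<sigma> n x) < e) \<longrightarrow>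
      (\<exists>f\<in>elems V. (\<lambda>n. fnorm V (\<lambda>x. \<sigma> n x - f x)) \<longlonglongrightarrow> 0)"
    using assms(1) unfolding hilbert_fun_space_def mcomplete_iff by blast
  then have "\<exists>f\<in>elems V. (\<lambda>n. fnorm V (\<lambda>x. \<sigma> n x - f x)) \<longlonglongrightarrow> 0"
    using assms(2,3) by simp
  then show ?thesis using that by blast
qed

text \<open>Riesz representation: a maximising sequence of \<open>2 * f y - (fnorm V f)\<^sup>2\<close> converges to the
  representer of the evaluation at \<open>y\<close>.\<close>

lemma hilbert_fun_space_has_kernel:
  assumes V: "hilbert_fun_space X V"
    and bd: "\<And>x. x \<in> X \<Longrightarrow> \<exists>C. \<forall>f\<in>elems V. \<bar>f x\<bar> \<le> C * fnorm V f"
  obtains K where "is_rkhs X K V"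
proof -
  interpret inner_space X V by unfold_locales (use V in \<open>simp add: hilbert_fun_space_def\<close>)
  have "\<exists>k\<in>elems V. \<forall>f\<in>elems V. ip V f k = f y" if y: "y \<in> X" for y
  proof -
    obtain C where C: "\<And>f. f \<in> elems V \<Longrightarrow> \<bar>f y\<bar> \<le> C * fnorm V f" using bd[OF y] by blast
    define \<Phi> where "\<Phi> f = 2 * f y - ip V f f" for f
    \<comment> \<open>Completing the square in the norm of \<open>f\<close>.\<close>
    have ub: "\<Phi> f \<le> C\<^sup>2" if f: "f \<in> elems V" for f
    proof -
      have "\<Phi> f \<le> 2 * (C * fnorm V f) - (fnorm V f)\<^sup>2" using C[OF f] by (simp add: \<Phi>_def fnorm_sq)
      also have "\<dots> \<le> C\<^sup>2" using zero_le_power2[of "C - fnorm V f"] by (simp add: power2_diff)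
      finally show ?thesis .
    qed
    define M where "M = (SUP f\<in>elems V. \<Phi> f)"
    have bdd: "bdd_above (\<Phi> ` elems V)" using ub by (auto simp: bdd_above_def)
    have upM: "\<Phi> f \<le> M" if "f \<in> elems V" for f unfolding M_def using that bdd by (rule cSUP_upper)
    have "\<exists>f\<in>elems V. \<Phi> f > M - 1 / real (Suc n)" for n
    proof -
      have "M - 1 / real (Suc n) < M" by simp
      then show ?thesis unfolding M_def using less_cSUP_iff[OF _ bdd] zero_mem by blast
    qed
    then obtain \<sigma> where \<sigma>: "\<And>n. \<sigma> n \<in> elems V" "\<And>n. \<Phi> (\<sigma> n) > M - 1 / real (Suc n)" by metis
    \<comment> \<open>At the midpoint of \<open>f\<close> and \<open>g\<close> the value of
      \<open>\<Phi>\<close> is at most \<open>M\<close>; by the parallelogram law, near-maximisers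
      are therefore close to each other.\<close>
    have close: "ip V (\<lambda>x. f x - g x) (\<lambda>x. f x - g x) \<le> 4 * M - 2 * \<Phi> f - 2 * \<Phi> g"
      if f: "f \<in> elems V" and g: "g \<in> elems V" for f g
    proof -
      have "\<Phi> (\<lambda>x. (1/2) * (f x + g x)) \<le> M" by (intro upM scale_mem add_mem f g)
      moreover have "ip V (\<lambda>x. (1/2) * (f x + g x)) (\<lambda>x. (1/2) * (f x + g x)) =
          ip V (\<lambda>x. f x + g x) (\<lambda>x. f x + g x) / 4"
        using ip_scale[OF add_mem[OF f g] scale_mem[OF add_mem[OF f g]], of "1/2" "1/2"]
          ip_scale_right[OF add_mem[OF f g] add_mem[OF f g], of "1/2"] by simp
      ultimately have "4 * (f y + g y) - ip V (\<lambda>x. f x + g x) (\<lambda>x. f x + g x) \<le> 4 * M"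
        unfolding \<Phi>_def by (auto dest: mult_left_mono[of _ _ "4 :: real"] simp: field_simps)
      then show ?thesis by (simp add: \<Phi>_def ip_self_add ip_self_diff f g)
    qed
    have cauchy: "\<exists>M. \<forall>m\<ge>M. \<forall>n\<ge>M. fnorm V (\<lambda>x. \<sigma> m x - \<sigma> n x) < e" if e: "e > 0" for e
    proof -
      obtain L where L: "4 / e\<^sup>2 < real L" using reals_Archimedean2 by blast
      have "fnorm V (\<lambda>x. \<sigma> m x - \<sigma> n x) < e" if "m \<ge> L" "n \<ge> L" for m n
      proof -
        have "ip V (\<lambda>x. \<sigma> m x - \<sigma> n x) (\<lambda>x. \<sigma> m x - \<sigma> n x) < 2 / real (Suc m) + 2 / real (Suc n)"
          using close[OF \<sigma>(1)[of m] \<sigma>(1)[of n]] \<sigma>(2)[of m] \<sigma>(2)[of n] by simp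
        also have "\<dots> \<le> 2 / real (Suc L) + 2 / real (Suc L)"
          using that by (intro add_mono divide_left_mono) auto
        also have "\<dots> = 4 / real (Suc L)" by simp
        also have "\<dots> < e\<^sup>2" using L e by (simp add: field_simps add_strict_increasing)
        finally show ?thesis using e by (metis fnorm_sq less_eq_real_def not_le power_mono fnorm_nonneg power_less_imp_less_base)
      qed
      then show ?thesis by blast
    qed
    from hilbert_fun_space_complete[OF V \<sigma>(1) cauchy] obtain k
      where k: "k \<in> elems V" "(\<lambda>n. fnorm V (\<lambda>x. \<sigma> n x - k x)) \<longlonglongrightarrow> 0" .
    have "ip V h k = h y" if h: "h \<in> elems V" for h
    proof -
      have "(\<lambda>n. ip V (\<lambda>x. \<sigma> n x - k x) h) \<longlonglongrightarrow> 0"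
      proof (rule Lim_null_comparison)
        show "(\<lambda>n. fnorm V (\<lambda>x. \<sigma> n x - k x) * fnorm V h) \<longlonglongrightarrow> 0" using tendsto_mult_left_zero[OF k(2)] .
      qed (auto intro!: always_eventually abs_ip_le diff_mem \<sigma> k h)
      then have lim: "(\<lambda>n. ip V (\<sigma> n) h) \<longlonglongrightarrow> ip V k h"
        by (simp add: ip_diff \<sigma> k h LIM_zero_iff)
      \<comment> \<open>Moving from \<open>\<sigma> n\<close> by \<open>t * h\<close> raises
        \<open>\<Phi>\<close> by at most \<open>1 / real (Suc n)\<close>. In the limit this is the
        first-order condition for a maximum at \<open>k\<close>.\<close>
      have *: "2 * t * (h y - ip V k h) \<le> t\<^sup>2 * ip V h h" for t
      proof (rule LIMSEQ_le)
        show "(\<lambda>n. 2 * t * (h y - ip V (\<sigma> n) h)) \<longlonglongrightarrow> 2 * t * (h y - ip V k h)"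
          by (intro tendsto_intros lim)
        have "(\<lambda>n. 1 / real (Suc n)) \<longlonglongrightarrow> 0"
          using LIMSEQ_inverse_real_of_nat by (simp add: inverse_eq_divide)
        from tendsto_add[OF this tendsto_const[of "t\<^sup>2 * ip V h h"]]
        show "(\<lambda>n. 1 / real (Suc n) + t\<^sup>2 * ip V h h) \<longlonglongrightarrow> t\<^sup>2 * ip V h h" by simp
        have "2 * t * (h y - ip V (\<sigma> n) h) \<le> 1 / real (Suc n) + t\<^sup>2 * ip V h h" for n
        proof -
          have "\<Phi> (\<lambda>x. \<sigma> n x + t * h x) \<le> M" by (intro upM scale_mem add_mem \<sigma> h)
          moreover have "\<Phi> (\<lambda>x. \<sigma> n x + t * h x) = \<Phi> (\<sigma> n) + 2 * t * (h y - ip V (\<sigma> n) h) - t\<^sup>2 * ip V h h"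
            by (simp add: \<Phi>_def ip_self_add \<sigma> h scale_mem ip_scale ip_scale_right algebra_simps power2_eq_square)
          ultimately show ?thesis using \<sigma>(2)[of n] by linarith
        qed
        then show "\<exists>N. \<forall>n\<ge>N. 2 * t * (h y - ip V (\<sigma> n) h) \<le> 1 / real (Suc n) + t\<^sup>2 * ip V h h" by blast
      qed
      \<comment> \<open>With \<open>q\<close> the squared norm of \<open>h\<close>, the inequality
        at \<open>t = b\<close> reads \<open>2 * b * b * (q + 1) \<le> b * b * q\<close> and forces
        \<open>b = 0\<close>. The added 1 avoids a division by 0.\<close>
      define b where "b = (h y - ip V k h) / (ip V h h + 1)"
      have q: "ip V h h \<ge> 0" by (rule ip_nonneg)
      then have eq: "h y - ip V k h = b * (ip V h h + 1)" by (simp add: b_def)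
      have "2 * b * (b * (ip V h h + 1)) \<le> b\<^sup>2 * ip V h h" using *[of b] unfolding eq .
      then have "b\<^sup>2 * (ip V h h + 2) \<le> 0" by (simp add: algebra_simps power2_eq_square)
      moreover have "b\<^sup>2 * (ip V h h + 2) > 0" if "b \<noteq> 0"
        using q that by (intro mult_pos_pos) auto
      ultimately have "h y - ip V k h = 0" using eq by fastforce
      then show ?thesis using ip_sym[OF h k(1)] by simp
    qed
    then show ?thesis using k(1) by blast
  qed
  then obtain k where k: "\<And>y. y \<in> X \<Longrightarrow> k y \<in> elems V"
      "\<And>y f. y \<in> X \<Longrightarrow> f \<in> elems V \<Longrightarrow> ip V f (k y) = f y" by metis
  have "kernel_section X (\<lambda>x y. k y x) y = k y" if "y \<in> X" for y
    using outside[OF k(1)[OF that]] by (auto simp: kernel_section_def)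
  then have "is_rkhs X (\<lambda>x y. k y x) V"
    using V k by (auto simp: is_rkhs_def)
  then show ?thesis by (rule that)
qed

section \<open>Completeness of the constructed space and density of the kernel sections\<close>

context psd_kernel
begin

sublocale space: inner_space X "rk X K"
  by unfold_locales (rule inner_fun_space_rk)

lemma pointwise_le: "f \<in> E \<Longrightarrow> x \<in> X \<Longrightarrow> \<bar>f x\<bar> \<le> sqrt (K x x) * fnorm (rk X K) f"
  using pointwise_square_le[of f x]
  by (simp add: fnorm_rk mult.commute real_le_rsqrt flip: real_sqrt_mult)

text \<open>A Cauchy sequence converges pointwise, and each test functional sees finitely many
  points only. The bounds on the differences thus survive the limit for every functional, and with
  them the bound on the supremum.\<close>

lemma hilbert_fun_space_rk: "hilbert_fun_space X (rk X K)"
proof (rule hilbert_fun_spaceI[OF inner_fun_space_rk])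
  fix \<sigma> :: "nat \<Rightarrow> 'a \<Rightarrow> real"
  assume \<sigma>: "\<And>n. \<sigma> n \<in> elems (rk X K)"
    and cauchy: "\<And>e. e > 0 \<Longrightarrow> \<exists>M. \<forall>m\<ge>M. \<forall>n\<ge>M. fnorm (rk X K) (\<lambda>x. \<sigma> m x - \<sigma> n x) < e"
  have "\<exists>l. (\<lambda>n. \<sigma> n x) \<longlonglongrightarrow> l" if x: "x \<in> X" for x
  proof -
    have "Cauchy (\<lambda>n. \<sigma> n x)"
    proof (rule CauchyI)
      fix e :: real assume e: "e > 0"
      \<comment> \<open>\<open>pointwise_le\<close> bounds values by \<open>sqrt (K x x)\<close>
        times the norm; the added 1 covers \<open>K x x = 0\<close>.\<close>
      have "e / (sqrt (K x x) + 1) > 0" using e qf_nonneg[of "[(1,x)]"] x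
        by (simp add: qf_single add_nonneg_pos)
      from cauchy[OF this] obtain M where M: "\<And>m n. m \<ge> M \<Longrightarrow> n \<ge> M \<Longrightarrow>
          fnorm (rk X K) (\<lambda>x. \<sigma> m x - \<sigma> n x) < e / (sqrt (K x x) + 1)" by blast
      have "norm (\<sigma> m x - \<sigma> n x) < e" if "m \<ge> M" "n \<ge> M" for m n
      proof -
        have s: "sqrt (K x x) \<ge> 0" using qf_nonneg[of "[(1,x)]"] x by (simp add: qf_single)
        have "\<bar>\<sigma> m x - \<sigma> n x\<bar> \<le> sqrt (K x x) * fnorm (rk X K) (\<lambda>x. \<sigma> m x - \<sigma> n x)"
          using pointwise_le[OF diff_elems[of "\<sigma> m" "\<sigma> n"] x] \<sigma> by simp
        also have "\<dots> \<le> sqrt (K x x) * (e / (sqrt (K x x) + 1))"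
          using M[OF that] s by (intro mult_left_mono) auto
        also have "\<dots> < e"
        proof -
          have "a * (e / (a + 1)) < e" if "a \<ge> 0" for a using that e by (simp add: field_simps)
          then show ?thesis using s by blast
        qed
        finally show ?thesis by simp
      qed
      then show "\<exists>M. \<forall>m\<ge>M. \<forall>n\<ge>M. norm (\<sigma> m x - \<sigma> n x) < e" by blast
    qed
    then show ?thesis by (simp add: Cauchy_convergent_iff convergent_def)
  qed
  then obtain l where l: "\<And>x. x \<in> X \<Longrightarrow> (\<lambda>n. \<sigma> n x) \<longlonglongrightarrow> l x" by metis
  define f where "f = restr X l"
  have bound: "2 * ev v (\<lambda>x. \<sigma> n x - f x) - qf K v v \<le> e\<^sup>2"
    if e: "e > 0" and n: "\<forall>m\<ge>M. fnorm (rk X K) (\<lambda>x. \<sigma> n x - \<sigma> m x) < e" and v: "v \<in> functionals X"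
    for e M n v
  proof (rule tendsto_upperbound)
    show "(\<lambda>m. 2 * ev v (\<lambda>x. \<sigma> n x - \<sigma> m x) - qf K v v) \<longlonglongrightarrow> 2 * ev v (\<lambda>x. \<sigma> n x - f x) - qf K v v"
      by (intro tendsto_intros ev_tendsto[OF v]) (auto simp: f_def restr_def l)
    have "2 * ev v (\<lambda>x. \<sigma> n x - \<sigma> m x) - qf K v v \<le> e\<^sup>2" if "m \<ge> M" for m
    proof -
      have d: "(\<lambda>x. \<sigma> n x - \<sigma> m x) \<in> E" using diff_elems[of "\<sigma> n" "\<sigma> m"] \<sigma> by simp
      have "2 * ev v (\<lambda>x. \<sigma> n x - \<sigma> m x) - qf K v v \<le> N (\<lambda>x. \<sigma> n x - \<sigma> m x)"
        by (rule sqnorm_upper[OF d v])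
      also have "\<dots> = (fnorm (rk X K) (\<lambda>x. \<sigma> n x - \<sigma> m x))\<^sup>2"
        using d sqnorm_nonneg[OF d] by (simp add: fnorm_rk)
      also have "\<dots> \<le> e\<^sup>2" using n that space.fnorm_nonneg by (intro power_mono) (auto simp: less_imp_le)
      finally show ?thesis .
    qed
    then show "\<forall>\<^sub>F m in sequentially. 2 * ev v (\<lambda>x. \<sigma> n x - \<sigma> m x) - qf K v v \<le> e\<^sup>2"
      by (auto simp: eventually_sequentially)
  qed auto
  have mem: "(\<lambda>x. \<sigma> n x - f x) \<in> E" "N (\<lambda>x. \<sigma> n x - f x) \<le> e\<^sup>2"
    if e: "e > 0" and n: "\<forall>m\<ge>M. fnorm (rk X K) (\<lambda>x. \<sigma> n x - \<sigma> m x) < e" for e M n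
    using elemsI[OF _ bound[OF e n]] sqnorm_least[OF bound[OF e n]] elems_outside[of "\<sigma> n"] \<sigma>
    by (auto simp: f_def restr_def)
  obtain M where M: "\<forall>m\<ge>M. \<forall>n\<ge>M. fnorm (rk X K) (\<lambda>x. \<sigma> m x - \<sigma> n x) < 1"
    using cauchy[of 1] by auto
  then have f1: "(\<lambda>x. \<sigma> M x - f x) \<in> E" using mem(1)[of 1 M M] by simp
  have f: "f \<in> E" using diff_elems[OF _ f1, of "\<sigma> M"] \<sigma> by simp
  have "(\<lambda>n. fnorm (rk X K) (\<lambda>x. \<sigma> n x - f x)) \<longlonglongrightarrow> 0"
  proof (rule LIMSEQ_I)
    fix r :: real assume r: "r > 0"
    then obtain M where M: "\<forall>m\<ge>M. \<forall>n\<ge>M. fnorm (rk X K) (\<lambda>x. \<sigma> m x - \<sigma> n x) < r / 2"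
      using cauchy[of "r/2"] by auto
    have "norm (fnorm (rk X K) (\<lambda>x. \<sigma> n x - f x) - 0) < r" if n: "n \<ge> M" for n
    proof -
      have "N (\<lambda>x. \<sigma> n x - f x) \<le> (r/2)\<^sup>2" using mem(2)[of "r/2" M n] r M n by simp
      then have "sqrt (N (\<lambda>x. \<sigma> n x - f x)) \<le> r / 2"
        using r by (intro real_le_lsqrt) auto
      then have "fnorm (rk X K) (\<lambda>x. \<sigma> n x - f x) \<le> r / 2"
        using mem(1)[of "r/2" M n] r M n by (simp add: fnorm_rk)
      then show ?thesis using space.fnorm_nonneg[of "\<lambda>x. \<sigma> n x - f x"] r by simp
    qed
    then show "\<exists>M. \<forall>n\<ge>M. norm (fnorm (rk X K) (\<lambda>x. \<sigma> n x - f x) - 0) < r" by blast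
  qed
  then show "\<exists>f\<in>elems (rk X K). (\<lambda>n. fnorm (rk X K) (\<lambda>x. \<sigma> n x - f x)) \<longlonglongrightarrow> 0" using f by auto
qed

lemma is_rkhs_rk: "is_rkhs X K (rk X K)"
  unfolding is_rkhs_def
proof (intro conjI ballI hilbert_fun_space_rk)
  fix y assume y: "y \<in> X"
  then have v: "[(1, y)] \<in> functionals X" by simp
  show "kernel_section X K y \<in> elems (rk X K)"
    using section_comb_elems[OF v] by (simp add: section_comb_single)
  show "ip (rk X K) f (kernel_section X K y) = f y" if "f \<in> elems (rk X K)" for f
    using ip_section_comb[OF _ v, of f] that by (simp add: section_comb_single)
qed

text \<open>The functionals come within \<open>1 / real (Suc n)\<close> of the supremum, which by
  \<open>sqnorm_diff_section_comb\<close> bounds the squared distance.\<close>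

lemma approx:
  assumes f: "f \<in> E"
  obtains v where "\<And>n. v n \<in> functionals X"
    "(\<lambda>n. fnorm (rk X K) (\<lambda>x. section_comb X K (v n) x - f x)) \<longlonglongrightarrow> 0"
proof -
  have "\<exists>v\<in>functionals X. 2 * ev v f - qf K v v > N f - 1 / real (Suc n)" for n
  proof (rule ccontr)
    assume "\<not> ?thesis"
    then have "N f \<le> N f - 1 / real (Suc n)" by (intro sqnorm_least) force
    then show False by simp
  qed
  then obtain v where v: "\<And>n. v n \<in> functionals X"
      "\<And>n. 2 * ev (v n) f - qf K (v n) (v n) > N f - 1 / real (Suc n)"
    by metis
  have vN: "N (\<lambda>x. f x - section_comb X K (v n) x) \<le> 1 / real (Suc n)" for n
    using v(2)[of n] unfolding sqnorm_diff_section_comb[OF f v(1)] by linarith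
  have "(\<lambda>n. fnorm (rk X K) (\<lambda>x. f x - section_comb X K (v n) x)) \<longlonglongrightarrow> 0"
  proof (rule Lim_null_comparison)
    have "(\<lambda>n. 1 / real (Suc n)) \<longlonglongrightarrow> 0"
      using LIMSEQ_inverse_real_of_nat by (simp add: inverse_eq_divide)
    from tendsto_real_sqrt[OF this] show "(\<lambda>n. sqrt (1 / real (Suc n))) \<longlonglongrightarrow> 0" by simp
    have "fnorm (rk X K) (\<lambda>x. f x - section_comb X K (v n) x) \<le> sqrt (1 / real (Suc n))" for n
      unfolding fnorm_rk[OF diff_elems[OF f section_comb_elems[OF v(1)]]] real_sqrt_le_iff
      by (rule vN)
    then show "\<forall>\<^sub>F n in sequentially. norm (fnorm (rk X K) (\<lambda>x. f x - section_comb X K (v n) x))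
        \<le> sqrt (1 / real (Suc n))"
      using space.fnorm_nonneg by (intro always_eventually allI) (simp only: real_norm_def abs_of_nonneg)
  qed
  then have "(\<lambda>n. fnorm (rk X K) (\<lambda>x. section_comb X K (v n) x - f x)) \<longlonglongrightarrow> 0"
    unfolding space.fnorm_minus[of f] .
  with v(1) show ?thesis by (rule that)
qed

end


subsection \<open>Uniqueness\<close>

lemma is_rkhs_section_comb:
  assumes V: "is_rkhs X K V" and v: "v \<in> functionals X"
  shows "section_comb X K v \<in> elems V" and "f \<in> elems V \<Longrightarrow> ip V f (section_comb X K v) = ev v f"
proof -
  interpret inner_space X V
    by unfold_locales (use V in \<open>simp add: is_rkhs_def hilbert_fun_space_def\<close>)
  have sec: "kernel_section X K y \<in> elems V" "f \<in> elems V \<Longrightarrow> ip V f (kernel_section X K y) = f y"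
    if "y \<in> X" for y f
    using V that by (auto simp: is_rkhs_def)
  have comb_Cons: "section_comb X K ((c, y) # v) =
      (\<lambda>x. c * kernel_section X K y x + section_comb X K v x)" for c y v
    by (auto simp: section_comb_def restr_def kernel_section_def)
  have "section_comb X K v \<in> elems V \<and> (\<forall>f\<in>elems V. ip V f (section_comb X K v) = ev v f)"
    using v
  proof (induction v)
    case Nil
    have "ip V (\<lambda>x. 0 * f x) f = 0" if "f \<in> elems V" for f using ip_scale[OF that that, of 0] by simp
    then show ?case using zero_mem ip_sym[OF zero_mem] by (auto simp: section_comb_def restr_def)
  next
    case (Cons p v)
    then show ?case
      by (cases p) (auto simp: comb_Cons sec ip_add_right ip_scale_right scale_mem intro!: add_mem)
  qed
  then show "section_comb X K v \<in> elems V" "f \<in> elems V \<Longrightarrow> ip V f (section_comb X K v) = ev v f"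
    by auto
qed

lemma is_rkhs_psd:
  assumes V: "is_rkhs X K V"
  shows "psd X K"
proof -
  interpret inner_space X V
    by unfold_locales (use V in \<open>simp add: is_rkhs_def hilbert_fun_space_def\<close>)
  have q: "qf K w v = ip V (section_comb X K v) (section_comb X K w)"
    if "v \<in> functionals X" "w \<in> functionals X" for v w
    using that by (simp add: is_rkhs_section_comb[OF V] ev_section_comb)
  have "K x y = K y x" if "x \<in> X" "y \<in> X" for x y
  proof -
    have "qf K [(1,x)] [(1,y)] = qf K [(1,y)] [(1,x)]"
      using that ip_sym by (simp add: q is_rkhs_section_comb(1)[OF V])
    then show ?thesis by (simp add: qf_single)
  qed
  then show ?thesis by (auto simp: psd_def q ip_nonneg)
qed

text \<open>Polarisation on the elements; elsewhere both inner products have the default value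
  0.\<close>

lemma fun_space_eqI:
  assumes V: "inner_fun_space X V" and W: "inner_fun_space X W"
    and el: "elems V = elems W"
    and nrm: "\<And>f. f \<in> elems V \<Longrightarrow> ip V f f = ip W f f"
  shows "V = W"
proof -
  interpret V: inner_space X V by unfold_locales (rule V)
  interpret W: inner_space X W by unfold_locales (rule W)
  have "ip V f g = ip W f g" for f g
  proof (cases "f \<in> elems V \<and> g \<in> elems V")
    case True
    then show ?thesis
      using V.ip_polar[of f g] W.ip_polar[of f g] nrm[OF V.add_mem[of f g]] nrm[OF V.diff_mem[of f g]] el
      by simp
  next
    case False
    then show ?thesis using V.ip_outside[of f g] W.ip_outside[of f g] el by auto
  qed
  then show ?thesis using el by (cases V; cases W) (auto simp: fun_eq_iff)
qed

lemma is_rkhs_tendsto: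
  assumes V: "is_rkhs X K V" and \<sigma>: "\<And>n. \<sigma> n \<in> elems V" and g: "g \<in> elems V"
    and lim: "(\<lambda>n. fnorm V (\<lambda>x. \<sigma> n x - g x)) \<longlonglongrightarrow> 0" and x: "x \<in> X"
  shows "(\<lambda>n. \<sigma> n x) \<longlonglongrightarrow> g x"
proof -
  interpret V: inner_space X V
    by unfold_locales (use V in \<open>simp add: is_rkhs_def hilbert_fun_space_def\<close>)
  have "\<bar>\<sigma> n x - g x\<bar> \<le> fnorm V (\<lambda>x. \<sigma> n x - g x) * fnorm V (kernel_section X K x)" for n
  proof -
    have "ip V (\<lambda>x. \<sigma> n x - g x) (kernel_section X K x) = \<sigma> n x - g x"
      "kernel_section X K x \<in> elems V"
      using V V.diff_mem[OF \<sigma> g, of n] x by (auto simp: is_rkhs_def)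
    then show ?thesis using V.abs_ip_le[OF V.diff_mem[OF \<sigma> g], of "kernel_section X K x" n] by simp
  qed
  then have "(\<lambda>n. \<sigma> n x - g x) \<longlonglongrightarrow> 0"
    by (intro Lim_null_comparison[OF _ tendsto_mult_left_zero[OF lim,
          where c = "fnorm V (kernel_section X K x)"]] always_eventually) simp
  then show ?thesis by (simp add: LIM_zero_iff)
qed

text \<open>Combinations of sections have the same norm in both spaces and are dense in
  \<open>rk X K\<close>. An approximating sequence is Cauchy in \<open>V\<close> too, and as
  convergence in either norm is pointwise, the limits agree. The inclusion of \<open>V\<close>
  follows by expanding the squared norm of \<open>f\<close> minus a combination of sections.\<close>

lemma is_rkhs_unique:
  assumes V: "is_rkhs X K V"
  shows "V = rk X K"
proof -
  interpret V: inner_space X V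
    by unfold_locales (use V in \<open>simp add: is_rkhs_def hilbert_fun_space_def\<close>)
  interpret psd_kernel X K by unfold_locales (rule is_rkhs_psd[OF V])
  note comb = is_rkhs_section_comb[OF V]
  have ipcomb: "ip V (section_comb X K v) (section_comb X K v) = qf K v v" if "v \<in> functionals X" for v
  proof -
    have "ip V (section_comb X K v) (section_comb X K v) = ev v (section_comb X K v)"
      by (rule comb(2)[OF that comb(1)[OF that]])
    also have "\<dots> = qf K v v" by (rule ev_section_comb) (rule that)
    finally show ?thesis .
  qed
  have sub: "f \<in> E" if f: "f \<in> elems V" for f
  proof (rule elemsI)
    show "f x = 0" if "x \<notin> X" for x using V.outside f that by blast
    show "2 * ev v f - qf K v v \<le> ip V f f" if v: "v \<in> functionals X" for v
    proof -
      have "0 \<le> ip V (\<lambda>x. f x - section_comb X K v x) (\<lambda>x. f x - section_comb X K v x)"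
        by (rule V.ip_nonneg)
      also have "\<dots> = ip V f f - 2 * ev v f + qf K v v"
        by (simp add: V.ip_self_diff f comb(1) comb(2)[OF v f] v ipcomb)
      finally show ?thesis by simp
    qed
  qed
  have main: "f \<in> elems V \<and> ip V f f = N f" if f: "f \<in> E" for f
  proof -
    obtain v where v: "\<And>n. v n \<in> functionals X"
      and vlim: "(\<lambda>n. fnorm (rk X K) (\<lambda>x. section_comb X K (v n) x - f x)) \<longlonglongrightarrow> 0"
      using approx[OF f] by blast
    define \<sigma> where "\<sigma> n = section_comb X K (v n)" for n
    have lim: "(\<lambda>n. fnorm (rk X K) (\<lambda>x. \<sigma> n x - f x)) \<longlonglongrightarrow> 0" using vlim by (simp only: \<sigma>_def)
    have \<sigma>E: "\<sigma> n \<in> E" and \<sigma>V: "\<sigma> n \<in> elems V" for n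
      using section_comb_elems[OF v] comb(1)[OF v] by (auto simp: \<sigma>_def)
    have same: "fnorm V (\<sigma> n) = fnorm (rk X K) (\<sigma> n)" for n
      using v by (simp add: fnorm_def \<sigma>_def ipcomb ip_rk_self[OF section_comb_elems] sqnorm_section_comb)
    have same': "fnorm V (\<lambda>x. \<sigma> m x - \<sigma> n x) = fnorm (rk X K) (\<lambda>x. \<sigma> m x - \<sigma> n x)" for m n
    proof -
      have "(\<lambda>x. \<sigma> m x - \<sigma> n x) = section_comb X K (v m @ scale_list (-1) (v n))"
        by (simp add: \<sigma>_def section_comb_simps)
      moreover have "v m @ scale_list (-1) (v n) \<in> functionals X" using v by simp
      ultimately show ?thesis
        by (simp add: fnorm_def ipcomb ip_rk_self[OF section_comb_elems] sqnorm_section_comb)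
    qed
    have cauchy: "\<exists>M. \<forall>m\<ge>M. \<forall>n\<ge>M. fnorm V (\<lambda>x. \<sigma> m x - \<sigma> n x) < e" if e: "e > 0" for e
      unfolding same' by (rule space.convergent_cauchy[OF _ _ lim e]) (simp_all add: \<sigma>E f)
    have hV: "hilbert_fun_space X V" using V by (simp add: is_rkhs_def)
    obtain g where g: "g \<in> elems V" "(\<lambda>n. fnorm V (\<lambda>x. \<sigma> n x - g x)) \<longlonglongrightarrow> 0"
      using hilbert_fun_space_complete[OF hV \<sigma>V cauchy] by blast
    have "f x = g x" for x
    proof (cases "x \<in> X")
      case x: True
      have "(\<lambda>n. \<sigma> n x) \<longlonglongrightarrow> g x" by (rule is_rkhs_tendsto[OF V \<sigma>V g x])
      moreover have "(\<lambda>n. \<sigma> n x) \<longlonglongrightarrow> f x"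
        by (rule is_rkhs_tendsto[OF is_rkhs_rk _ _ lim x]) (simp_all add: \<sigma>E f)
      ultimately show ?thesis by (rule LIMSEQ_unique[symmetric])
    next
      case False
      then show ?thesis using elems_outside[OF f] V.outside[OF g(1)] by simp
    qed
    then have fg: "f = g" by blast
    have "(\<lambda>n. fnorm V (\<sigma> n)) \<longlonglongrightarrow> fnorm V f"
      using V.fnorm_tendsto[OF \<sigma>V g] fg by simp
    moreover have "(\<lambda>n. fnorm V (\<sigma> n)) \<longlonglongrightarrow> fnorm (rk X K) f"
      unfolding same by (rule space.fnorm_tendsto[OF _ _ lim]) (simp_all add: \<sigma>E f)
    ultimately have "fnorm V f = fnorm (rk X K) f" by (rule LIMSEQ_unique)
    then have "ip V f f = N f"
      using V.fnorm_sq[of f] space.fnorm_sq[of f] ip_rk_self[OF f] by simp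
    then show ?thesis using g fg by simp
  qed
  show ?thesis
  proof (rule fun_space_eqI)
    show "elems V = elems (rk X K)" using sub main by auto
    show "ip V f f = ip (rk X K) f f" if "f \<in> elems V" for f
      using main[OF sub[OF that]] by (simp add: ip_rk_self[OF sub[OF that]])
  qed (rule V.inner inner_fun_space_rk)+
qed

lemma rkhs_eq: "is_rkhs X K V \<Longrightarrow> rkhs X K = V"
  unfolding rkhs_def using is_rkhs_unique by blast

lemma rkhs_eq_rk: "psd X K \<Longrightarrow> rkhs X K = rk X K"
  by (intro rkhs_eq psd_kernel.is_rkhs_rk psd_kernel.intro)

lemma kernel_section_cong:
  "(\<And>x y. x \<in> X \<Longrightarrow> y \<in> X \<Longrightarrow> K x y = L x y) \<Longrightarrow> y \<in> X \<Longrightarrow> kernel_section X K y = kernel_section X L y"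
  by (auto simp: kernel_section_def)

lemma is_rkhs_cong:
  assumes "\<And>x y. x \<in> X \<Longrightarrow> y \<in> X \<Longrightarrow> K x y = L x y"
  shows "is_rkhs X K V \<longleftrightarrow> is_rkhs X L V"
  unfolding is_rkhs_def using kernel_section_cong[of X K L] assms by auto

lemma rkhs_cong:
  "(\<And>x y. x \<in> X \<Longrightarrow> y \<in> X \<Longrightarrow> K x y = L x y) \<Longrightarrow> rkhs X K = rkhs X L"
proof -
  assume "\<And>x y. x \<in> X \<Longrightarrow> y \<in> X \<Longrightarrow> K x y = L x y"
  then have "is_rkhs X K = is_rkhs X L" by (intro ext is_rkhs_cong)
  then show ?thesis by (simp add: rkhs_def)
qed

text \<open>The difference \<open>d\<close> of two sections at \<open>y\<close> that both reproduce
  has squared norm \<open>d y - d y = 0\<close>. The equation is confined to \<open>X\<close>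
  because the definite description fixes the value 0 elsewhere.\<close>

lemma reproducing_kernel_eq:
  assumes V: "is_rkhs X K V" and x: "x \<in> X" and y: "y \<in> X"
  shows "reproducing_kernel X V x y = K x y"
proof -
  interpret V: inner_space X V
    by unfold_locales (use V in \<open>simp add: is_rkhs_def hilbert_fun_space_def\<close>)
  let ?K = "\<lambda>x y. if x \<in> X \<and> y \<in> X then K x y else 0"
  have "reproducing_kernel X V = ?K"
    unfolding reproducing_kernel_def
  proof (rule the_equality)
    show "is_rkhs X ?K V \<and> (\<forall>x y. x \<notin> X \<or> y \<notin> X \<longrightarrow> ?K x y = 0)"
      using V is_rkhs_cong[of X ?K K V] by simp
    fix L assume L: "is_rkhs X L V \<and> (\<forall>x y. x \<notin> X \<or> y \<notin> X \<longrightarrow> L x y = 0)"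
    have "L x y = K x y" if x: "x \<in> X" and y: "y \<in> X" for x y
    proof -
      let ?d = "\<lambda>x. kernel_section X L y x - kernel_section X K y x"
      have m: "kernel_section X L y \<in> elems V" "kernel_section X K y \<in> elems V"
        using V L y by (auto simp: is_rkhs_def)
      have d: "?d \<in> elems V" by (rule V.diff_mem[OF m])
      have "ip V ?d (kernel_section X L y) = ?d y" "ip V ?d (kernel_section X K y) = ?d y"
        using V L y d unfolding is_rkhs_def by blast+
      then have "ip V ?d ?d = 0" by (simp add: V.ip_diff_right[OF m d])
      then have "?d = (\<lambda>x. 0)" by (rule V.ip_self_eq_0[OF d])
      from fun_cong[OF this, of x] show ?thesis using x by (simp add: kernel_section_def)
    qed
    then show "L = ?K" using L by (auto simp: fun_eq_iff)
  qed
  then show ?thesis using x y by simp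
qed

subsection \<open>Closed subspaces\<close>

lemma subspace_where_simps:
  "elems (subspace_where V P) = {f \<in> elems V. P f}"
  "f \<in> elems V \<Longrightarrow> P f \<Longrightarrow> g \<in> elems V \<Longrightarrow> P g \<Longrightarrow> ip (subspace_where V P) f g = ip V f g"
  "f \<in> elems V \<Longrightarrow> P f \<Longrightarrow> fnorm (subspace_where V P) f = fnorm V f"
  by (simp_all add: subspace_where_def fnorm_def)

text \<open>The common kernel of bounded linear functionals is closed. The hypotheses are restricted
  to the elements of \<open>V\<close>, since derivatives at a point are linear only where they
  exist.\<close>

lemma hilbert_subspace_where:
  assumes V: "hilbert_fun_space X V"
    and P: "\<And>f. f \<in> elems V \<Longrightarrow> P f \<longleftrightarrow> (\<forall>L\<in>F. L f = 0)"
    and add: "\<And>L f g. L \<in> F \<Longrightarrow> f \<in> elems V \<Longrightarrow> g \<in> elems V \<Longrightarrow> L (\<lambda>x. f x + g x) = L f + L g"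
    and scale: "\<And>L f c. L \<in> F \<Longrightarrow> f \<in> elems V \<Longrightarrow> L (\<lambda>x. c * f x) = c * L f"
    and bd: "\<And>L. L \<in> F \<Longrightarrow> \<exists>C. \<forall>f\<in>elems V. \<bar>L f\<bar> \<le> C * fnorm V f"
  shows "hilbert_fun_space X (subspace_where V P)"
proof (rule hilbert_fun_spaceI)
  let ?S = "subspace_where V P"
  interpret inner_space X V
    by unfold_locales (use V in \<open>simp add: hilbert_fun_space_def\<close>)
  have P0: "P (\<lambda>x. 0)" using scale[OF _ zero_mem, of _ 0] by (simp add: P zero_mem)
  have Padd: "P (\<lambda>x. f x + g x)" if "f \<in> elems V" "P f" "g \<in> elems V" "P g" for f g
    using that by (auto simp: P add_mem add)
  have Pscale: "P (\<lambda>x. c * f x)" if "f \<in> elems V" "P f" for f c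
    using that by (auto simp: P scale_mem scale)
  have Pdiff: "P (\<lambda>x. f x - g x)" if "f \<in> elems V" "P f" "g \<in> elems V" "P g" for f g
    using Padd[OF that(1,2) scale_mem[OF that(3), of "-1"] Pscale[OF that(3,4), of "-1"]] by simp
  show "inner_fun_space X ?S"
    unfolding inner_fun_space_def
    by (auto simp: subspace_where_simps outside zero_mem P0 add_mem Padd scale_mem Pscale
        ip_add ip_scale ip_pos intro: ip_sym) (auto simp: subspace_where_def)
  fix \<sigma> :: "nat \<Rightarrow> 'a \<Rightarrow> real" assume \<sigma>: "\<And>n. \<sigma> n \<in> elems ?S"
    and c: "\<And>e. e > 0 \<Longrightarrow> \<exists>M. \<forall>m\<ge>M. \<forall>n\<ge>M. fnorm ?S (\<lambda>x. \<sigma> m x - \<sigma> n x) < e"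
  have \<sigma>V: "\<sigma> n \<in> elems V" and \<sigma>P: "P (\<sigma> n)" for n using \<sigma>[of n] by (auto simp: subspace_where_simps)
  have "fnorm ?S (\<lambda>x. \<sigma> m x - \<sigma> n x) = fnorm V (\<lambda>x. \<sigma> m x - \<sigma> n x)" for m n
    by (simp add: subspace_where_simps diff_mem \<sigma>V Pdiff \<sigma>P)
  then have "\<exists>M. \<forall>m\<ge>M. \<forall>n\<ge>M. fnorm V (\<lambda>x. \<sigma> m x - \<sigma> n x) < e" if "e > 0" for e
    using c[OF that] by simp
  from hilbert_fun_space_complete[OF V \<sigma>V this]
  obtain f where f: "f \<in> elems V" "(\<lambda>n. fnorm V (\<lambda>x. \<sigma> n x - f x)) \<longlonglongrightarrow> 0" .
  have "L f = 0" if L: "L \<in> F" for L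
  proof -
    obtain C where C: "\<And>f. f \<in> elems V \<Longrightarrow> \<bar>L f\<bar> \<le> C * fnorm V f" using bd[OF L] by blast
    \<comment> \<open>\<open>L\<close> vanishes on the sequence, so the left side is constant in
      \<open>n\<close>; boundedness makes it tend to 0.\<close>
    have "L (\<lambda>x. \<sigma> n x - f x) = - L f" for n
      using add[OF L \<sigma>V scale_mem[OF f(1), of "-1"], of n] scale[OF L f(1), of "-1"] \<sigma>P[of n] L
      by (simp add: P \<sigma>V)
    then have "(\<lambda>n. - L f) \<longlonglongrightarrow> 0"
      using C[OF diff_mem[OF \<sigma>V f(1)]]
      by (intro Lim_null_comparison[OF _ tendsto_mult_right_zero[OF f(2), of C]]) simp
    then show ?thesis by (simp add: LIMSEQ_const_iff)
  qed
  then have Pf: "P f" using f(1) P by simp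
  have "(\<lambda>n. fnorm ?S (\<lambda>x. \<sigma> n x - f x)) \<longlonglongrightarrow> 0"
    using f by (simp add: subspace_where_simps diff_mem \<sigma>V Pdiff \<sigma>P Pf)
  then show "\<exists>f\<in>elems ?S. (\<lambda>n. fnorm ?S (\<lambda>x. \<sigma> n x - f x)) \<longlonglongrightarrow> 0"
    using f(1) Pf by (auto simp: subspace_where_simps)
qed

text \<open>The new section at \<open>y\<close> is the orthogonal projection of the old one, whose
  inner product with \<open>e i\<close> is \<open>e i y\<close>.\<close>

lemma is_rkhs_orthogonal_complement:
  assumes V: "is_rkhs X K V" and I: "finite I"
    and e: "\<And>i. i \<in> I \<Longrightarrow> e i \<in> elems V"
    and orth: "\<And>i j. i \<in> I \<Longrightarrow> j \<in> I \<Longrightarrow> ip V (e i) (e j) = (if i = j then 1 else 0)"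
    and P: "\<And>f. f \<in> elems V \<Longrightarrow> P f \<longleftrightarrow> (\<forall>i\<in>I. ip V f (e i) = 0)"
  shows "is_rkhs X (\<lambda>x y. K x y - (\<Sum>i\<in>I. e i x * e i y)) (subspace_where V P)"
proof -
  let ?K = "\<lambda>x y. K x y - (\<Sum>i\<in>I. e i x * e i y)"
  have hV: "hilbert_fun_space X V" using V by (simp add: is_rkhs_def)
  interpret inner_space X V
    by unfold_locales (use hV in \<open>simp add: hilbert_fun_space_def\<close>)
  have h: "hilbert_fun_space X (subspace_where V P)"
  proof (rule hilbert_subspace_where[OF hV, where F = "(\<lambda>i f. ip V f (e i)) ` I"])
    show "\<exists>C. \<forall>f\<in>elems V. \<bar>L f\<bar> \<le> C * fnorm V f" if "L \<in> (\<lambda>i f. ip V f (e i)) ` I" for L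
    proof -
      from that obtain i where i: "i \<in> I" "L = (\<lambda>f. ip V f (e i))" by (elim imageE)
      show ?thesis
        using abs_ip_le[OF _ e[OF i(1)]] by (intro exI[of _ "fnorm V (e i)"]) (simp add: i(2) mult.commute)
    qed
  qed (auto simp: P ip_add e ip_scale)
  have sec: "kernel_section X ?K y = (\<lambda>x. kernel_section X K y x - (\<Sum>i\<in>I. e i y * e i x))"
    if "y \<in> X" for y
    using outside[OF e] by (auto simp: kernel_section_def mult.commute)
  have mem: "(\<lambda>x. \<Sum>i\<in>I. e i y * e i x) \<in> elems V" for y
    by (intro sum_mem I scale_mem e)
  have Ky: "kernel_section X K y \<in> elems V" "\<And>f. f \<in> elems V \<Longrightarrow> ip V f (kernel_section X K y) = f y"
    if "y \<in> X" for y using V that by (auto simp: is_rkhs_def)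
  have ips: "ip V (\<lambda>x. \<Sum>i\<in>I. e i y * e i x) f = (\<Sum>i\<in>I. e i y * ip V (e i) f)" if "f \<in> elems V" for f y
    using that by (simp add: ip_sum I scale_mem e ip_scale)
  have Psec: "P (kernel_section X ?K y)" if y: "y \<in> X" for y
  proof -
    have "ip V (kernel_section X ?K y) (e j) = 0" if j: "j \<in> I" for j
    proof -
      have "ip V (kernel_section X ?K y) (e j) = e j y - (\<Sum>i\<in>I. e i y * (if i = j then 1 else 0))"
        using Ky[OF y] j ip_sym[OF Ky(1)[OF y] e[OF j]]
        by (simp add: sec[OF y] ip_diff mem e ips orth cong: sum.cong)
      also have "\<dots> = 0" using I j by (simp add: if_distrib[of "\<lambda>z. _ * z"] cong: if_cong)
      finally show ?thesis .
    qed
    then show ?thesis using y by (simp add: P sec diff_mem Ky mem)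
  qed
  show ?thesis
    unfolding is_rkhs_def
  proof (intro conjI ballI h)
    fix y assume y: "y \<in> X"
    show 1: "kernel_section X ?K y \<in> elems (subspace_where V P)"
      using y Psec[OF y] by (simp add: subspace_where_simps sec diff_mem Ky mem)
    fix f assume f: "f \<in> elems (subspace_where V P)"
    then have fV: "f \<in> elems V" "P f" by (auto simp: subspace_where_simps)
    have "ip (subspace_where V P) f (kernel_section X ?K y) = ip V f (kernel_section X ?K y)"
      using f 1 by (intro subspace_where_simps(2)) (auto simp: subspace_where_simps(1))
    also have "\<dots> = f y - ip V f (\<lambda>x. \<Sum>i\<in>I. e i y * e i x)"
      using y fV by (simp add: sec ip_diff_right Ky mem)
    also have "ip V f (\<lambda>x. \<Sum>i\<in>I. e i y * e i x) = (\<Sum>i\<in>I. e i y * ip V (e i) f)"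
      using ips[OF fV(1)] ip_sym[OF fV(1) mem] by simp
    also have "\<dots> = 0" using fV P[OF fV(1)] by (intro sum.neutral) (auto simp: ip_sym[OF e fV(1)])
    finally show "ip (subspace_where V P) f (kernel_section X ?K y) = f y" by simp
  qed
qed

section \<open>Comparison of kernels\<close>

definition dominated :: "'a set \<Rightarrow> ('a \<Rightarrow> 'a \<Rightarrow> real) \<Rightarrow> ('a \<Rightarrow> 'a \<Rightarrow> real) \<Rightarrow> bool" where
  "dominated X K L \<longleftrightarrow> (\<exists>c. \<forall>v\<in>functionals X. qf K v v \<le> c * qf L v v)"

lemma psd_nonneg: "psd X K \<Longrightarrow> v \<in> functionals X \<Longrightarrow> qf K v v \<ge> 0"
  by (simp add: psd_def)

lemma dominatedI: "(\<And>v. v \<in> functionals X \<Longrightarrow> qf K v v \<le> c * qf L v v) \<Longrightarrow> dominated X K L"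
  by (auto simp: dominated_def)

text \<open>When \<open>L\<close> is positive semidefinite the constant may be enlarged. A constant
  of at least 1 allows division and has increasing powers, as the passage to \<open>s\<close>
  variables requires.\<close>

lemma dominatedE:
  assumes "dominated X K L" "psd X L"
  obtains c where "c \<ge> 1" "\<forall>v\<in>functionals X. qf K v v \<le> c * qf L v v"
proof -
  obtain c where c: "\<And>v. v \<in> functionals X \<Longrightarrow> qf K v v \<le> c * qf L v v"
    using assms(1) by (auto simp: dominated_def)
  have "qf K v v \<le> max c 1 * qf L v v" if "v \<in> functionals X" for v
    using c[OF that] mult_right_mono[of c "max c 1" "qf L v v"] psd_nonneg[OF assms(2) that] by simp
  then show ?thesis using that[of "max c 1"] by simp
qed

lemma dominated_refl: "dominated X K K"
  by (rule dominatedI[of _ _ 1]) simp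

lemma dominated_trans:
  assumes "dominated X K L" "dominated X L M" "psd X L"
  shows "dominated X K M"
proof -
  obtain c where c: "c \<ge> 1" "\<forall>v\<in>functionals X. qf K v v \<le> c * qf L v v"
    by (rule dominatedE[OF assms(1,3)])
  obtain d where d: "\<And>v. v \<in> functionals X \<Longrightarrow> qf L v v \<le> d * qf M v v"
    using assms(2) by (auto simp: dominated_def)
  show ?thesis
  proof (rule dominatedI[of _ _ "c * d"])
    show "qf K v v \<le> c * d * qf M v v" if "v \<in> functionals X" for v
      using order_trans[OF bspec[OF c(2) that] mult_left_mono[OF d[OF that], of c]] c(1)
      by (simp add: mult.assoc)
  qed
qed

lemma dominated_cong:
  assumes "\<And>x y. x \<in> X \<Longrightarrow> y \<in> X \<Longrightarrow> K x y = K' x y" "\<And>x y. x \<in> X \<Longrightarrow> y \<in> X \<Longrightarrow> L x y = L' x y"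
  shows "dominated X K L \<longleftrightarrow> dominated X K' L'"
proof -
  have "qf K v v = qf K' v v" "qf L v v = qf L' v v" if "v \<in> functionals X" for v
    by (rule qf_cong[OF that that], simp add: assms)+
  then show ?thesis by (simp add: dominated_def)
qed

lemma dominated_add:
  assumes "dominated X K M" "dominated X L M"
  shows "dominated X (\<lambda>x y. K x y + L x y) M"
proof -
  obtain c d where "\<And>v. v \<in> functionals X \<Longrightarrow> qf K v v \<le> c * qf M v v"
      "\<And>v. v \<in> functionals X \<Longrightarrow> qf L v v \<le> d * qf M v v"
    using assms by (auto simp: dominated_def)
  then show ?thesis
    by (intro dominatedI[of _ _ "c + d"]) (simp add: qf_add distrib_right add_mono)
qed

lemma dominated_zero: "dominated X (\<lambda>x y. 0) M"
  by (rule dominatedI[of _ _ 0]) (simp add: qf_def)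

lemma dominated_sum:
  assumes "finite I" "\<And>i. i \<in> I \<Longrightarrow> dominated X (K i) M"
  shows "dominated X (\<lambda>x y. \<Sum>i\<in>I. K i x y) M"
  using assms
  by (induction I rule: finite_induct) (auto simp: dominated_zero intro!: dominated_add)

lemma dominated_cmult:
  assumes "dominated X K M" "a \<ge> 0"
  shows "dominated X (\<lambda>x y. a * K x y) M"
proof -
  obtain c where c: "\<And>v. v \<in> functionals X \<Longrightarrow> qf K v v \<le> c * qf M v v"
    using assms by (auto simp: dominated_def)
  show ?thesis
    using mult_left_mono[OF c assms(2)]
    by (intro dominatedI[of _ _ "a * c"]) (simp add: qf_cmult mult.assoc)
qed

lemma dominated_cmult_right:
  assumes "dominated X K M" "a > 0"
  shows "dominated X K (\<lambda>x y. a * M x y)"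
proof -
  obtain c where "\<And>v. v \<in> functionals X \<Longrightarrow> qf K v v \<le> c * qf M v v"
    using assms by (auto simp: dominated_def)
  then show ?thesis
    using assms(2) by (intro dominatedI[of _ _ "c / a"]) (simp add: qf_cmult)
qed

lemma dominated_add_right1:
  assumes "dominated X K L" "psd X L" "psd X M"
  shows "dominated X K (\<lambda>x y. L x y + M x y)"
proof -
  obtain c where c: "c \<ge> 1" "\<forall>v\<in>functionals X. qf K v v \<le> c * qf L v v"
    by (rule dominatedE[OF assms(1,2)])
  have "qf K v v \<le> c * (qf L v v + qf M v v)" if "v \<in> functionals X" for v
    using bspec[OF c(2) that] psd_nonneg[OF assms(3) that] c(1) by (simp add: distrib_left add_increasing2)
  then show ?thesis by (intro dominatedI[of _ _ c]) (simp add: qf_add)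
qed

lemma dominated_add_right2:
  "dominated X K M \<Longrightarrow> psd X L \<Longrightarrow> psd X M \<Longrightarrow> dominated X K (\<lambda>x y. L x y + M x y)"
  using dominated_add_right1[of X K M L] by (simp add: add.commute)

section \<open>Closure properties of positive semidefinite kernels, and embeddings from
  domination\<close>

lemma psd_add: "psd X K \<Longrightarrow> psd X L \<Longrightarrow> psd X (\<lambda>x y. K x y + L x y)"
  by (auto simp: psd_def qf_add)

lemma psd_cmult: "psd X K \<Longrightarrow> c \<ge> 0 \<Longrightarrow> psd X (\<lambda>x y. c * K x y)"
  by (auto simp: psd_def qf_cmult)

lemma psd_rank_one: "psd X (\<lambda>x y. f x * f y)"
  by (auto simp: psd_def qf_prod mult.commute)

lemma psd_const: "c \<ge> 0 \<Longrightarrow> psd X (\<lambda>x y. c)"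
  using psd_cmult[OF psd_rank_one[of X "\<lambda>_. 1"], of c] by simp

lemma psd_sum: "finite I \<Longrightarrow> (\<And>i. i \<in> I \<Longrightarrow> psd X (K i)) \<Longrightarrow> psd X (\<lambda>x y. \<Sum>i\<in>I. K i x y)"
  by (induction I rule: finite_induct) (auto simp: psd_const intro!: psd_add)

lemma psd_mono: "psd X K \<Longrightarrow> Y \<subseteq> X \<Longrightarrow> psd Y K"
  by (auto simp: psd_def functionals_def subset_iff)

lemma psd_diffI:
  "psd X K \<Longrightarrow> psd X L \<Longrightarrow> (\<And>v. v \<in> functionals X \<Longrightarrow> qf K v v \<le> qf L v v) \<Longrightarrow> psd X (\<lambda>x y. L x y - K x y)"
  by (auto simp: psd_def qf_diff)

text \<open>Since the form of \<open>L\<close> is at least that of \<open>K\<close> divided by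
  \<open>c\<close>, testing \<open>f\<close> with \<open>v\<close> for \<open>L\<close> is bounded
  by \<open>c\<close> times testing with \<open>v\<close> divided by \<open>c\<close> for
  \<open>K\<close>.\<close>

lemma rk_elems_dominated:
  assumes K: "psd X K" and L: "psd X L" and c: "c > 0"
    and le: "\<forall>v\<in>functionals X. qf K v v \<le> c * qf L v v" and f: "f \<in> rk_elems X K"
  shows "f \<in> rk_elems X L" and "sqnorm X L f \<le> c * sqnorm X K f"
proof -
  interpret K: psd_kernel X K by unfold_locales (rule K)
  interpret L: psd_kernel X L by unfold_locales (rule L)
  have *: "2 * ev v f - qf L v v \<le> c * sqnorm X K f" if v: "v \<in> functionals X" for v
  proof -
    have "2 * ev v f - qf L v v \<le> 2 * ev v f - qf K v v / c"
      using bspec[OF le v] c by (simp add: field_simps)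
    also have "\<dots> = c * (2 * ev (scale_list (1/c) v) f - qf K (scale_list (1/c) v) (scale_list (1/c) v))"
      using c by (simp add: field_simps)
    also have "\<dots> \<le> c * sqnorm X K f"
      using c v by (intro mult_left_mono K.sqnorm_upper f) auto
    finally show ?thesis .
  qed
  show "f \<in> rk_elems X L" by (rule L.elemsI[OF _ *]) (rule K.elems_outside[OF f])
  show "sqnorm X L f \<le> c * sqnorm X K f" by (rule L.sqnorm_least[OF *])
qed

lemma dominated_elems:
  assumes "psd X K" "psd X L" "dominated X K L" "f \<in> rk_elems X K"
  shows "f \<in> rk_elems X L"
proof -
  obtain c where "c \<ge> 1" "\<forall>v\<in>functionals X. qf K v v \<le> c * qf L v v"
    by (rule dominatedE[OF assms(3,2)])
  then show ?thesis using rk_elems_dominated(1)[OF assms(1,2) _ _ assms(4), of c] by simp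
qed

lemma embeds_rk:
  assumes K: "psd X K" and L: "psd X L" and d: "dominated X K L"
  shows "rk X K \<hookrightarrow> rk X L"
proof -
  interpret K: psd_kernel X K by unfold_locales (rule K)
  interpret L: psd_kernel X L by unfold_locales (rule L)
  obtain c where c: "c \<ge> 1" "\<forall>v\<in>functionals X. qf K v v \<le> c * qf L v v"
    by (rule dominatedE[OF d L])
  then have "c > 0" by simp
  note el = rk_elems_dominated[OF K L this c(2)]
  have "fnorm (rk X L) f \<le> sqrt c * fnorm (rk X K) f" if f: "f \<in> rk_elems X K" for f
    using el[OF f] f by (simp add: K.fnorm_rk L.fnorm_rk flip: real_sqrt_mult)
  then show ?thesis
    unfolding embeds_def using el(1) c(1) by (auto intro!: exI[of _ "sqrt c"])
qed

text \<open>This is \<open>ev_square_le\<close>, with the squared norm of \<open>f\<close> as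
  constant. It converts membership of a function into an inequality of kernels.\<close>

lemma dominated_rank_one:
  assumes "psd X K" "f \<in> rk_elems X K"
  shows "dominated X (\<lambda>x y. f x * f y) K"
proof -
  interpret K: psd_kernel X K by unfold_locales (rule assms)
  show ?thesis
    using K.ev_square_le[OF assms(2)]
    by (intro dominatedI[of _ _ "sqnorm X K f"]) (simp add: qf_prod power2_eq_square)
qed

lemma mult_le_sum_squares: "x * y \<le> x\<^sup>2 + y\<^sup>2" for x y :: real
  using sum_squares_bound[of x y] zero_le_power2[of x] zero_le_power2[of y] by linarith

text \<open>The kernel is not symmetric, but domination only involves its quadratic form, a product
  of two numbers that is bounded by the sum of their squares. The scalar \<open>a\<close> of either
  sign is absorbed into \<open>f\<close>.\<close>

lemma dominated_rank_two:
  assumes K: "psd X K" and f: "f \<in> rk_elems X K" and g: "g \<in> rk_elems X K"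
  shows "dominated X (\<lambda>x y. a * (f x * g y)) K"
proof -
  interpret K: psd_kernel X K by unfold_locales (rule K)
  let ?c = "sqnorm X K (\<lambda>x. a * f x) + sqnorm X K g"
  have "qf (\<lambda>x y. a * (f x * g y)) v v \<le> ?c * qf K v v" if v: "v \<in> functionals X" for v
  proof -
    have "qf (\<lambda>x y. a * (f x * g y)) v v = (a * ev v f) * ev v g" by (simp add: qf_cmult qf_prod)
    also have "\<dots> \<le> (a * ev v f)\<^sup>2 + (ev v g)\<^sup>2"
      by (rule mult_le_sum_squares)
    also have "\<dots> \<le> ?c * qf K v v"
      using K.ev_square_le[OF K.scale_elems[OF f, of a] v] K.ev_square_le[OF g v]
      by (simp add: ev_cmult distrib_right)
    finally show ?thesis .
  qed
  then show ?thesis by (rule dominatedI)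
qed

subsection \<open>Products of kernels\<close>

text \<open>A Cholesky factorisation, eliminating one point at a time.\<close>

lemma psd_finite_gram:
  assumes "finite F" "psd F K"
  shows "\<exists>gs :: ('a \<Rightarrow> real) list. \<forall>x\<in>F. \<forall>y\<in>F. K x y = (\<Sum>g\<leftarrow>gs. g x * g y)"
  using assms
proof (induction F arbitrary: K rule: finite_induct)
  case empty
  then show ?case by simp
next
  case (insert z F)
  interpret psd_kernel "insert z F" K by unfold_locales (rule insert.prems)
  define a where "a = K z z"
  \<comment> \<open>The Schur complement of the entry at \<open>z\<close>.\<close>
  define K' where "K' x y = K x y - (1 / a) * (K x z * K y z)" for x y
  have a: "a \<ge> 0" using qf_nonneg[of "[(1, z)]"] by (simp add: qf_single a_def)
  have exp: "qf K ((t, z) # v) ((t, z) # v) = qf K v v + 2 * t * ev v (\<lambda>x. K x z) + t\<^sup>2 * a"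
    if v: "v \<in> functionals (insert z F)" for v t
  proof -
    have "qf K v [(t, z)] = qf K [(t, z)] v" by (rule qf_sym[OF psd]) (use v in auto)
    moreover have "qf K v [(t, z)] = t * ev v (\<lambda>x. K x z)" by (simp add: qf_def ev_cmult)
    moreover have "qf K ([(t, z)] @ v) ([(t, z)] @ v) =
        qf K [(t,z)] [(t,z)] + qf K [(t,z)] v + (qf K v [(t,z)] + qf K v v)"
      by (simp only: qf_simps)
    ultimately show ?thesis by (simp add: a_def qf_single power2_eq_square)
  qed
  have qK': "qf K' v v = qf K v v - (ev v (\<lambda>x. K x z))\<^sup>2 / a" for v
  proof -
    have "qf K' v v = qf (\<lambda>x y. K x y - (1 / a) * (K x z * K y z)) v v" by (simp only: K'_def[abs_def])
    also have "\<dots> = qf K v v - (ev v (\<lambda>x. K x z))\<^sup>2 / a"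
      by (simp only: qf_diff qf_cmult qf_prod power2_eq_square) simp
    finally show ?thesis .
  qed
  show ?case
  proof (cases "a = 0")
    case True
    have zero: "K x z = 0" if x: "x \<in> insert z F" for x
    proof (rule ccontr)
      assume ne: "K x z \<noteq> 0"
      \<comment> \<open>With this weight at \<open>z\<close> the form at
        \<open>[(t, z), (1, x)]\<close> would be -1.\<close>
      define t where "t = - (K x x + 1) / (2 * K x z)"
      have "0 \<le> K x x + 2 * t * K x z"
        using qf_nonneg[of "[(t, z), (1, x)]"] exp[of "[(1, x)]" t] x True by (simp add: qf_single)
      then show False using ne by (simp add: t_def field_simps)
    qed
    obtain gs where gs: "\<forall>x\<in>F. \<forall>y\<in>F. K x y = (\<Sum>g\<leftarrow>gs. g x * g y)"
      using insert.IH[of K] psd_mono[OF insert.prems] by auto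
    \<comment> \<open>The functions obtained for \<open>F\<close> are arbitrary at \<open>z\<close>;
      there they must vanish, as \<open>K x z\<close> does.\<close>
    let ?gs = "map (\<lambda>g x. if x = z then 0 else g x) gs"
    have "K x y = (\<Sum>g\<leftarrow>?gs. g x * g y)" if "x \<in> insert z F" "y \<in> insert z F" for x y
      using that gs zero[OF that(1)] zero[OF that(2)] K_sym[of z y]
      by (cases "x = z"; cases "y = z") (auto simp: o_def sum_list_0)
    then show ?thesis by blast
  next
    case False
    with a have a0: "a > 0" by simp
    have "psd (insert z F) K'"
      unfolding psd_def
    proof (intro conjI ballI)
      show "K' x y = K' y x" if "x \<in> insert z F" "y \<in> insert z F" for x y
        using K_sym[OF that] by (simp add: K'_def mult.commute)
      fix v assume v: "v \<in> functionals (insert z F)"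
      \<comment> \<open>The coefficient at \<open>z\<close> that minimises the form in
        \<open>exp\<close>; the minimum is the form of \<open>K'\<close>.\<close>
      let ?t = "- ev v (\<lambda>x. K x z) / a"
      have "0 \<le> qf K ((?t, z) # v) ((?t, z) # v)" by (rule qf_nonneg) (use v in simp)
      also have "\<dots> = qf K v v - (ev v (\<lambda>x. K x z))\<^sup>2 / a"
        using a0 by (simp add: exp[OF v] field_simps power2_eq_square)
      also have "\<dots> = qf K' v v" by (rule qK'[symmetric])
      finally show "qf K' v v \<ge> 0" .
    qed
    then obtain gs where gs: "\<forall>x\<in>F. \<forall>y\<in>F. K' x y = (\<Sum>g\<leftarrow>gs. g x * g y)"
      using insert.IH[of K'] psd_mono by (meson subset_insertI)
    let ?gs = "(\<lambda>x. K x z / sqrt a) # map (\<lambda>g x. if x = z then 0 else g x) gs"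
    have "K x y = (\<Sum>g\<leftarrow>?gs. g x * g y)" if xy: "x \<in> insert z F" "y \<in> insert z F" for x y
    proof -
      have "K x z / sqrt a * (K y z / sqrt a) = 1 / a * (K x z * K y z)" using a0 by simp
      moreover have "K' x y = (\<Sum>g\<leftarrow>map (\<lambda>g x. if x = z then 0 else g x) gs. g x * g y)"
        using xy gs a0 K_sym[of z y]
        by (cases "x = z"; cases "y = z") (auto simp: K'_def a_def[symmetric] o_def sum_list_0)
      moreover have "(\<Sum>g\<leftarrow>?gs. g x * g y) = K x z / sqrt a * (K y z / sqrt a) +
          (\<Sum>g\<leftarrow>map (\<lambda>g x. if x = z then 0 else g x) gs. g x * g y)"
        by (simp only: list.map sum_list.Cons)
      moreover have "k = s'" if "p = q" "k - q = r" "s' = p + r" for k p q r s' :: real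
        using that by simp
      ultimately show ?thesis unfolding K'_def by blast
    qed
    then show ?thesis by blast
  qed
qed

lemma qf_mult_rank_one:
  "qf (\<lambda>x y. g x * g y * K x y) v v = qf K (map (\<lambda>(c, x). (c * g x, x)) v) (map (\<lambda>(c, x). (c * g x, x)) v)"
proof -
  have "ev (map (\<lambda>(c, x). (c * g x, x)) v) f = ev v (\<lambda>x. g x * f x)" for f v
    by (induction v) auto
  then show ?thesis by (simp add: qf_def mult.assoc ev_cmult)
qed

text \<open>Schur's product theorem. Only the finitely many points of \<open>v\<close> matter, where
  \<open>A\<close> is a sum of rank-one kernels; each of these is absorbed into the coefficients of
  \<open>v\<close>.\<close>

lemma psd_mult:
  assumes A: "psd X A" and B: "psd X B"
  shows "psd X (\<lambda>x y. A x y * B x y)"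
  unfolding psd_def
proof (intro conjI ballI)
  show "A x y * B x y = A y x * B y x" if "x \<in> X" "y \<in> X" for x y
    using A B that by (simp add: psd_def)
  fix v assume v: "v \<in> functionals X"
  let ?F = "snd ` set v"
  have F: "?F \<subseteq> X" "v \<in> functionals ?F" using v by (auto simp: functionals_def)
  obtain gs where gs: "\<forall>x\<in>?F. \<forall>y\<in>?F. A x y = (\<Sum>g\<leftarrow>gs. g x * g y)"
    using psd_finite_gram[of ?F A] psd_mono[OF A F(1)] by auto
  have "qf (\<lambda>x y. A x y * B x y) v v = qf (\<lambda>x y. (\<Sum>g\<leftarrow>gs. g x * g y) * B x y) v v"
  proof (intro qf_cong[OF F(2) F(2)])
    fix x y assume "x \<in> ?F" "y \<in> ?F"
    then have "A x y = (\<Sum>g\<leftarrow>gs. g x * g y)" using gs by blast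
    then show "A x y * B x y = (\<Sum>g\<leftarrow>gs. g x * g y) * B x y" by simp
  qed
  also have "\<dots> = (\<Sum>g\<leftarrow>gs. qf (\<lambda>x y. g x * g y * B x y) v v)"
    by (induction gs) (simp_all add: distrib_right qf_add, simp add: qf_def)
  also have "\<dots> \<ge> 0"
  proof (rule sum_list_nonneg)
    fix r assume "r \<in> set (map (\<lambda>g. qf (\<lambda>x y. g x * g y * B x y) v v) gs)"
    then obtain g where r: "r = qf (\<lambda>x y. g x * g y * B x y) v v" by auto
    have "map (\<lambda>(c, x). (c * g x, x)) v \<in> functionals X" using v by (force simp: functionals_def)
    then show "0 \<le> r" unfolding r qf_mult_rank_one by (rule psd_nonneg[OF B])
  qed
  finally show "0 \<le> qf (\<lambda>x y. A x y * B x y) v v" .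
qed

lemma psd_prod: "finite I \<Longrightarrow> (\<And>i. i \<in> I \<Longrightarrow> psd X (K i)) \<Longrightarrow> psd X (\<lambda>x y. \<Prod>i\<in>I. K i x y)"
  by (induction I rule: finite_induct) (auto simp: psd_const intro!: psd_mult)

text \<open>Induction by the telescoping identity
  \<open>c * b * q - a * p = (c * b - a) * q + a * (q - p)\<close>, in which \<open>q\<close> is the
  scaled product of the previous \<open>B i\<close> and \<open>p\<close> that of the
  \<open>A i\<close>.\<close>

lemma psd_prod_diff:
  assumes "finite I" and c: "c \<ge> 0"
    and A: "\<And>i. i \<in> I \<Longrightarrow> psd X (A i)" and B: "\<And>i. i \<in> I \<Longrightarrow> psd X (B i)"
    and AB: "\<And>i. i \<in> I \<Longrightarrow> psd X (\<lambda>x y. c * B i x y - A i x y)"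
  shows "psd X (\<lambda>x y. c ^ card I * (\<Prod>i\<in>I. B i x y) - (\<Prod>i\<in>I. A i x y))"
  using assms(1) A B AB
proof (induction I rule: finite_induct)
  case empty
  then show ?case by (simp add: psd_const)
next
  case (insert i I)
  have "psd X (\<lambda>x y. (c * B i x y - A i x y) * (c ^ card I * (\<Prod>i\<in>I. B i x y)) +
      A i x y * (c ^ card I * (\<Prod>i\<in>I. B i x y) - (\<Prod>i\<in>I. A i x y)))"
    using insert c by (intro psd_add psd_mult psd_cmult psd_prod) auto
  then show ?case using insert.hyps by (simp add: algebra_simps)
qed

lemma psd_pullback:
  assumes K: "psd X K" and h: "\<And>x. x \<in> Y \<Longrightarrow> h x \<in> X"
  shows "psd Y (\<lambda>x y. K (h x) (h y))"
  unfolding psd_def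
proof (intro conjI ballI)
  show "K (h x) (h y) = K (h y) (h x)" if "x \<in> Y" "y \<in> Y" for x y
    using K h that by (simp add: psd_def)
  fix v assume v: "v \<in> functionals Y"
  have e: "ev (map (\<lambda>(c, x). (c, h x)) v) f = ev v (\<lambda>x. f (h x))" for f and v :: "(real \<times> 'b) list"
    by (induction v) auto
  have "map (\<lambda>(c, x). (c, h x)) v \<in> functionals X" using v h by (force simp: functionals_def)
  from psd_nonneg[OF K this] show "0 \<le> qf (\<lambda>x y. K (h x) (h y)) v v" by (simp add: qf_def e)
qed

section \<open>Weighted spaces\<close>

lemma weighted_kernel_psd:
  assumes \<gamma>: "\<And>u. u \<subseteq> {1..s} \<Longrightarrow> \<gamma> u \<ge> 0" and K: "psd {0..1} (\<lambda>x y. -1 + K x y)"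
  shows "psd (unit_cube s) (weighted_kernel s \<gamma> K)"
  unfolding weighted_kernel_def
proof (rule psd_add[OF psd_const psd_sum])
  show "finite {u. u \<noteq> {} \<and> u \<subseteq> {1..s}}" by (rule finite_subset[of _ "Pow {1..s}"]) auto
  fix u assume u: "u \<in> {u. u \<noteq> {} \<and> u \<subseteq> {1..s}}"
  have "psd (unit_cube s) (\<lambda>x y. -1 + K (x j) (y j))" if "j \<in> u" for j
    using that u by (intro psd_pullback[OF K, where h = "\<lambda>x. x j"]) (auto simp: unit_cube_def PiE_iff)
  moreover have "finite u" "\<gamma> u \<ge> 0" using u \<gamma> by (auto intro: finite_subset)
  ultimately show "psd (unit_cube s) (\<lambda>x y. \<gamma> u * (\<Prod>j\<in>u. -1 + K (x j) (y j)))"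
    by (intro psd_cmult psd_prod)
qed simp

text \<open>A product over \<open>u\<close> costs the factor \<open>c ^ card u\<close>. As
  \<open>c\<close> is at least 1, the factor \<open>c ^ s\<close> serves all \<open>u\<close> and
  the constant term at once, so the weights do not enter the constant.\<close>

lemma weighted_embeds:
  assumes \<gamma>: "\<And>u. u \<subseteq> {1..s} \<Longrightarrow> \<gamma> u \<ge> 0"
    and K: "psd {0..1} (\<lambda>x y. -1 + K x y)" and L: "psd {0..1} (\<lambda>x y. -1 + L x y)"
    and KL: "dominated {0..1} (\<lambda>x y. -1 + K x y) (\<lambda>x y. -1 + L x y)"
  shows "H s \<gamma> K \<hookrightarrow> H s \<gamma> L"
proof -
  obtain c where c: "c \<ge> 1" "\<forall>v\<in>functionals {0..1}.
      qf (\<lambda>x y. -1 + K x y) v v \<le> c * qf (\<lambda>x y. -1 + L x y) v v"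
    by (rule dominatedE[OF KL L])
  have d: "psd {0..1} (\<lambda>x y. c * (-1 + L x y) - (-1 + K x y))"
    using c by (intro psd_diffI psd_cmult K L) (auto simp: qf_cmult)
  note wK = weighted_kernel_psd[OF \<gamma> K] and wL = weighted_kernel_psd[OF \<gamma> L]
  let ?U = "{u. u \<noteq> {} \<and> u \<subseteq> {1..s}}"
  have fin: "finite ?U" by (rule finite_subset[of _ "Pow {1..s}"]) auto
  have mem: "x j \<in> {0..1}" if "x \<in> unit_cube s" "j \<in> {1..s}" for x j
    using that by (auto simp: unit_cube_def PiE_iff)
  have P: "psd (unit_cube s) (\<lambda>x y. c ^ s * (\<Prod>j\<in>u. -1 + L (x j) (y j)) - (\<Prod>j\<in>u. -1 + K (x j) (y j)))"
    if u: "u \<in> ?U" for u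
  proof -
    have f: "finite u" using u by (auto intro: finite_subset)
    have "card u \<le> s" using card_mono[of "{1..s}" u] u by simp
    then have "c ^ s - c ^ card u \<ge> 0" using c(1) by (simp add: power_increasing)
    moreover have pj: "psd (unit_cube s) (\<lambda>x y. -1 + K (x j) (y j))" "psd (unit_cube s) (\<lambda>x y. -1 + L (x j) (y j))"
        "psd (unit_cube s) (\<lambda>x y. c * (-1 + L (x j) (y j)) - (-1 + K (x j) (y j)))" if "j \<in> u" for j
    proof -
      have "x j \<in> {0..1}" if "x \<in> unit_cube s" for x using mem[OF that] u \<open>j \<in> u\<close> by blast
      then show "psd (unit_cube s) (\<lambda>x y. -1 + K (x j) (y j))" "psd (unit_cube s) (\<lambda>x y. -1 + L (x j) (y j))"
        "psd (unit_cube s) (\<lambda>x y. c * (-1 + L (x j) (y j)) - (-1 + K (x j) (y j)))"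
        using psd_pullback[OF K, of "unit_cube s" "\<lambda>x. x j"] psd_pullback[OF L, of "unit_cube s" "\<lambda>x. x j"]
          psd_pullback[OF d, of "unit_cube s" "\<lambda>x. x j"] by auto
    qed
    ultimately have "psd (unit_cube s) (\<lambda>x y. (c ^ s - c ^ card u) * (\<Prod>j\<in>u. -1 + L (x j) (y j)) +
        (c ^ card u * (\<Prod>j\<in>u. -1 + L (x j) (y j)) - (\<Prod>j\<in>u. -1 + K (x j) (y j))))"
      using f c(1) by (intro psd_add[OF psd_cmult[OF psd_prod] psd_prod_diff]) auto
    then show ?thesis by (simp add: algebra_simps)
  qed
  have "psd (unit_cube s) (\<lambda>x y. (c ^ s - 1) + (\<Sum>u\<in>?U. \<gamma> u *
      (c ^ s * (\<Prod>j\<in>u. -1 + L (x j) (y j)) - (\<Prod>j\<in>u. -1 + K (x j) (y j)))))"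
    using c(1) \<gamma> fin P by (intro psd_add psd_const psd_sum psd_cmult) (auto simp: one_le_power)
  moreover have "(c ^ s - 1) + (\<Sum>u\<in>?U. \<gamma> u *
      (c ^ s * (\<Prod>j\<in>u. -1 + L (x j) (y j)) - (\<Prod>j\<in>u. -1 + K (x j) (y j)))) =
      c ^ s * weighted_kernel s \<gamma> L x y - weighted_kernel s \<gamma> K x y" for x y
    by (simp add: weighted_kernel_def algebra_simps sum_subtractf sum_distrib_left)
  ultimately have "psd (unit_cube s) (\<lambda>x y. c ^ s * weighted_kernel s \<gamma> L x y - weighted_kernel s \<gamma> K x y)"
    by simp
  then have "qf (weighted_kernel s \<gamma> K) v v \<le> c ^ s * qf (weighted_kernel s \<gamma> L) v v"
    if "v \<in> functionals (unit_cube s)" for v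
    using psd_nonneg[OF _ that] by (fastforce simp: qf_diff qf_cmult)
  then have "dominated (unit_cube s) (weighted_kernel s \<gamma> K) (weighted_kernel s \<gamma> L)"
    by (rule dominatedI)
  then show ?thesis
    unfolding H_def using wK wL by (simp add: rkhs_eq_rk embeds_rk)
qed

text \<open>The source of the equalities in the theorem: kernels that agree on the unit square give
  the same space with the same inner product.\<close>

lemma weighted_space_cong:
  assumes "\<And>x y. x \<in> {0..1} \<Longrightarrow> y \<in> {0..1} \<Longrightarrow> K x y = L x y"
  shows "H s \<gamma> K = H s \<gamma> L"
proof -
  have "x j \<in> {0..1}" if "x \<in> unit_cube s" "j \<in> {1..s}" for x j
    using that by (auto simp: unit_cube_def PiE_iff)
  then show ?thesis
    unfolding H_def weighted_kernel_def
    by (intro rkhs_cong arg_cong2[of _ _ _ _ "(+)"] sum.cong prod.cong refl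
        arg_cong2[of _ _ _ _ times] assms) blast+
qed

section \<open>Kernels given by a sequence of features\<close>

text \<open>A feature map into the square-summable sequences, as the case \<open>x = y\<close>
  shows.\<close>

definition features :: "'a set \<Rightarrow> ('a \<Rightarrow> 'a \<Rightarrow> real) \<Rightarrow> (nat \<Rightarrow> 'a \<Rightarrow> real) \<Rightarrow> bool" where
  "features X K \<phi> \<longleftrightarrow> (\<forall>x\<in>X. \<forall>y\<in>X. (\<lambda>i. \<phi> i x * \<phi> i y) sums K x y)"

lemma features_qf:
  assumes "features X K \<phi>" "v \<in> functionals X" "w \<in> functionals X"
  shows "(\<lambda>i. ev v (\<phi> i) * ev w (\<phi> i)) sums qf K v w"
proof -
  have "(\<lambda>i. \<phi> i x * ev w (\<phi> i)) sums ev w (K x)" if "x \<in> X" for x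
    using ev_sums[OF assms(3), of "\<lambda>i y. \<phi> i x * \<phi> i y" "K x"] assms(1) that
    by (simp add: features_def ev_cmult)
  from ev_sums[OF assms(2), of "\<lambda>i x. \<phi> i x * ev w (\<phi> i)", OF this]
  show ?thesis by (simp add: ev_multc qf_def)
qed

lemma features_psd:
  assumes "features X K \<phi>"
  shows "psd X K"
  unfolding psd_def
proof (intro conjI ballI)
  fix x y assume xy: "x \<in> X" "y \<in> X"
  have "(\<lambda>i. \<phi> i x * \<phi> i y) sums K x y" "(\<lambda>i. \<phi> i x * \<phi> i y) sums K y x"
    using assms xy by (auto simp: features_def mult.commute)
  then show "K x y = K y x" by (rule sums_unique2)
next
  show "0 \<le> qf K v v" if "v \<in> functionals X" for v
    by (rule sums_le[OF _ sums_zero features_qf[OF assms that that]]) simp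
qed

lemma square_summable_mult:
  fixes a b :: "nat \<Rightarrow> real"
  assumes "summable (\<lambda>i. (a i)\<^sup>2)" "summable (\<lambda>i. (b i)\<^sup>2)"
  shows "summable (\<lambda>i. \<bar>a i * b i\<bar>)"
proof (rule summable_comparison_test)
  show "summable (\<lambda>i. (a i)\<^sup>2 + (b i)\<^sup>2)" by (intro summable_add assms)
  have "\<bar>a i * b i\<bar> \<le> (a i)\<^sup>2 + (b i)\<^sup>2" for i
    using mult_le_sum_squares[of "\<bar>a i\<bar>" "\<bar>b i\<bar>"] by (simp add: abs_mult)
  then show "\<exists>N. \<forall>n\<ge>N. norm \<bar>a n * b n\<bar> \<le> (a n)\<^sup>2 + (b n)\<^sup>2" by simp
qed

lemma features_series_summable:
  assumes "features X K \<phi>" "summable (\<lambda>i. (a i)\<^sup>2)" "x \<in> X"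
  shows "summable (\<lambda>i. a i * \<phi> i x)"
proof -
  have "summable (\<lambda>i. (\<phi> i x)\<^sup>2)"
    using assms(1,3) by (auto simp: features_def power2_eq_square sums_iff)
  from square_summable_mult[OF assms(2) this] show ?thesis by (rule summable_rabs_cancel)
qed

text \<open>Completing the square in each term: the quantity under the supremum is a series whose
  terms are at most the squares of the coefficients.\<close>

lemma features_series:
  assumes \<phi>: "features X K \<phi>" and a: "summable (\<lambda>i. (a i)\<^sup>2)"
  shows "restr X (\<lambda>x. \<Sum>i. a i * \<phi> i x) \<in> rk_elems X K"
    and "sqnorm X K (restr X (\<lambda>x. \<Sum>i. a i * \<phi> i x)) \<le> (\<Sum>i. (a i)\<^sup>2)"
proof -
  let ?f = "restr X (\<lambda>x. \<Sum>i. a i * \<phi> i x)"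
  interpret psd_kernel X K by unfold_locales (rule features_psd[OF \<phi>])
  have *: "2 * ev v ?f - qf K v v \<le> (\<Sum>i. (a i)\<^sup>2)" if v: "v \<in> functionals X" for v
  proof -
    have "(\<lambda>i. ev v (\<lambda>x. a i * \<phi> i x)) sums ev v (\<lambda>x. \<Sum>i. a i * \<phi> i x)"
      by (rule ev_sums[OF v]) (simp add: features_series_summable[OF \<phi> a] summable_sums)
    then have 1: "(\<lambda>i. a i * ev v (\<phi> i)) sums ev v ?f" using v by (simp add: ev_cmult)
    have "(\<lambda>i. 2 * (a i * ev v (\<phi> i)) - ev v (\<phi> i) * ev v (\<phi> i)) sums (2 * ev v ?f - qf K v v)"
      by (intro sums_diff sums_mult 1 features_qf[OF \<phi> v v])
    then show ?thesis
    proof (rule sums_le[OF _ _ summable_sums[OF a], rotated])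
      show "2 * (a i * ev v (\<phi> i)) - ev v (\<phi> i) * ev v (\<phi> i) \<le> (a i)\<^sup>2" for i
        using zero_le_power2[of "a i - ev v (\<phi> i)"] by (simp add: power2_eq_square algebra_simps)
    qed
  qed
  show "?f \<in> rk_elems X K" by (rule elemsI[OF _ *]) (simp add: restr_def)
  show "sqnorm X K ?f \<le> (\<Sum>i. (a i)\<^sup>2)" by (rule sqnorm_least[OF *])
qed

text \<open>The square-summable sequences are treated as the kernel space of the identity matrix, so
  that their completeness is an instance of \<open>hilbert_fun_space_rk\<close>.\<close>

abbreviation l2_kernel :: "nat \<Rightarrow> nat \<Rightarrow> real" where
  "l2_kernel \<equiv> \<lambda>i j. if i = j then 1 else 0"

lemma features_l2: "features UNIV l2_kernel l2_kernel"
proof -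
  have "(\<lambda>i. (if i = x then 1 else 0) * (if i = y then 1 else (0::real))) sums (if x = y then 1 else 0)" for x y :: nat
    using sums_single[of x "\<lambda>i. if i = y then 1 else (0::real)"] by (simp add: if_distrib[of "\<lambda>z. z * _"] cong: if_cong)
  then show ?thesis by (simp add: features_def)
qed

lemma l2_series: "(\<Sum>i. a i * l2_kernel i j) = a j"
proof -
  have "(\<lambda>i. a i * l2_kernel i j) = (\<lambda>i. if i = j then a i else 0)" by auto
  then show ?thesis using sums_single[of j a] by (simp add: sums_iff)
qed

lemma l2_mem:
  assumes "summable (\<lambda>i. (a i)\<^sup>2)"
  shows "a \<in> rk_elems UNIV l2_kernel" "sqnorm UNIV l2_kernel a \<le> (\<Sum>i. (a i)\<^sup>2)"
  using features_series[OF features_l2 assms] by (simp_all add: l2_series restr_def)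

text \<open>Testing \<open>a\<close> with the functional formed by its own first \<open>n\<close>
  entries bounds the partial sums of the squares.\<close>

lemma l2_summable:
  assumes "a \<in> rk_elems UNIV l2_kernel"
  shows "summable (\<lambda>i. (a i)\<^sup>2)" "(\<Sum>i. (a i)\<^sup>2) \<le> sqnorm UNIV l2_kernel a"
proof -
  interpret psd_kernel UNIV l2_kernel by unfold_locales (rule features_psd[OF features_l2])
  have le: "(\<Sum>i<n. (a i)\<^sup>2) \<le> sqnorm UNIV l2_kernel a" for n
  proof -
    let ?v = "map (\<lambda>i. (a i, i)) [0..<n]"
    have ev: "ev ?v f = (\<Sum>i<n. a i * f i)" for f
      by (simp add: ev_def o_def interv_sum_list_conv_sum_set_nat atLeast0LessThan)
    have "qf l2_kernel ?v ?v = (\<Sum>i<n. (a i)\<^sup>2)"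
      by (simp add: qf_def ev power2_eq_square if_distrib[of "\<lambda>z. _ * z"] cong: if_cong)
    then show ?thesis
      using sqnorm_upper[OF assms, of ?v] by (simp add: ev functionals_def power2_eq_square)
  qed
  then show "summable (\<lambda>i. (a i)\<^sup>2)" by (intro summableI_nonneg_bounded) auto
  then show "(\<Sum>i. (a i)\<^sup>2) \<le> sqnorm UNIV l2_kernel a" using le by (intro suminf_le_const)
qed

text \<open>Converse of \<open>features_series\<close>. A combination of sections has the values of
  its functional at the features as coefficients, and both have the same norm; hence the
  coefficients along an approximating sequence converge. Features may be dependent; the bound says
  that the expansion found is a shortest one.\<close>

lemma features_expansion:
  assumes \<phi>: "features X K \<phi>" and f: "f \<in> rk_elems X K"
  obtains a where "summable (\<lambda>i. (a i)\<^sup>2)" "(\<Sum>i. (a i)\<^sup>2) \<le> sqnorm X K f"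
    "f = restr X (\<lambda>x. \<Sum>i. a i * \<phi> i x)"
proof -
  interpret psd_kernel X K by unfold_locales (rule features_psd[OF \<phi>])
  interpret l2: psd_kernel UNIV l2_kernel by unfold_locales (rule features_psd[OF features_l2])
  let ?l = "rk UNIV l2_kernel"
  obtain v where v: "\<And>n. v n \<in> functionals X"
    and vlim: "(\<lambda>n. fnorm (rk X K) (\<lambda>x. section_comb X K (v n) x - f x)) \<longlonglongrightarrow> 0"
    using approx[OF f] by blast
  define A where "A n i = ev (v n) (\<phi> i)" for n i
  have sm: "summable (\<lambda>i. (ev w (\<phi> i))\<^sup>2)" "(\<Sum>i. (ev w (\<phi> i))\<^sup>2) = qf K w w" if "w \<in> functionals X" for w
    using features_qf[OF \<phi> that that] by (auto simp: power2_eq_square sums_iff)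
  have mem: "(\<lambda>i. ev w (\<phi> i)) \<in> rk_elems UNIV l2_kernel"
    and nrm: "fnorm ?l (\<lambda>i. ev w (\<phi> i)) = fnorm (rk X K) (section_comb X K w)" if w: "w \<in> functionals X" for w
  proof -
    show m: "(\<lambda>i. ev w (\<phi> i)) \<in> rk_elems UNIV l2_kernel" by (rule l2_mem(1)[OF sm(1)[OF w]])
    have "sqnorm UNIV l2_kernel (\<lambda>i. ev w (\<phi> i)) = qf K w w"
      using l2_mem(2)[OF sm(1)[OF w]] l2_summable(2)[OF m] by (simp add: sm(2)[OF w])
    then show "fnorm ?l (\<lambda>i. ev w (\<phi> i)) = fnorm (rk X K) (section_comb X K w)"
      using m w by (simp add: l2.fnorm_rk fnorm_rk section_comb_elems sqnorm_section_comb)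
  qed
  define \<sigma> where "\<sigma> n = section_comb X K (v n)" for n
  have \<sigma>E: "\<sigma> n \<in> elems (rk X K)" for n using section_comb_elems[OF v] by (simp add: \<sigma>_def)
  have f': "f \<in> elems (rk X K)" using f by simp
  have AE: "A n \<in> elems ?l" for n using mem[OF v] by (simp add: A_def[abs_def])
  have diffA: "fnorm ?l (\<lambda>i. A m i - A n i) = fnorm (rk X K) (\<lambda>x. \<sigma> m x - \<sigma> n x)" for m n
    using nrm[of "v m @ scale_list (-1) (v n)"] v by (simp add: A_def \<sigma>_def section_comb_simps)
  have normA: "fnorm ?l (A n) = fnorm (rk X K) (\<sigma> n)" for n
    using nrm[OF v] by (simp add: A_def[abs_def] \<sigma>_def)
  have lim: "(\<lambda>n. fnorm (rk X K) (\<lambda>x. \<sigma> n x - f x)) \<longlonglongrightarrow> 0" using vlim by (simp only: \<sigma>_def)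
  have "\<exists>M. \<forall>m\<ge>M. \<forall>n\<ge>M. fnorm ?l (\<lambda>x. A m x - A n x) < e" if "e > 0" for e
    unfolding diffA by (rule space.convergent_cauchy[OF \<sigma>E f' lim that])
  from hilbert_fun_space_complete[OF l2.hilbert_fun_space_rk AE this]
  obtain a where a: "a \<in> elems ?l" "(\<lambda>n. fnorm ?l (\<lambda>i. A n i - a i)) \<longlonglongrightarrow> 0" .
  then have aE: "a \<in> rk_elems UNIV l2_kernel" by simp
  note asm = l2_summable(1)[OF aE]
  have "(\<lambda>n. fnorm ?l (A n)) \<longlonglongrightarrow> fnorm ?l a" by (rule l2.space.fnorm_tendsto[OF AE a])
  moreover have "(\<lambda>n. fnorm ?l (A n)) \<longlonglongrightarrow> fnorm (rk X K) f"
    unfolding normA by (rule space.fnorm_tendsto[OF \<sigma>E f' lim])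
  ultimately have "fnorm ?l a = fnorm (rk X K) f" by (rule LIMSEQ_unique)
  then have "sqnorm UNIV l2_kernel a = sqnorm X K f" by (simp add: l2.fnorm_rk[OF aE] fnorm_rk[OF f])
  then have le: "(\<Sum>i. (a i)\<^sup>2) \<le> sqnorm X K f" using l2_summable(2)[OF aE] by simp
  define g where "g = restr X (\<lambda>x. \<Sum>i. a i * \<phi> i x)"
  have g: "g \<in> E" unfolding g_def by (rule features_series(1)[OF \<phi> asm])
  have le2: "fnorm (rk X K) (\<lambda>x. \<sigma> n x - g x) \<le> fnorm ?l (\<lambda>i. A n i - a i)" for n
  proof -
    have dE: "(\<lambda>i. A n i - a i) \<in> rk_elems UNIV l2_kernel"
      using l2.diff_elems[OF _ aE, of "A n"] AE by simp
    note dsm = l2_summable[OF dE]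
    have sx: "(\<lambda>i. A n i * \<phi> i x) sums \<sigma> n x" if x: "x \<in> X" for x
    proof -
      have "[(1, x)] \<in> functionals X" using x by simp
      from features_qf[OF \<phi> v[of n] this] have "(\<lambda>i. A n i * \<phi> i x) sums qf K (v n) [(1, x)]"
        by (simp add: A_def)
      also have "qf K (v n) [(1, x)] = qf K [(1, x)] (v n)" by (rule qf_sym[OF psd]) (use v x in auto)
      also have "\<dots> = \<sigma> n x" using x by (simp add: qf_def \<sigma>_def section_comb_def restr_def)
      finally show ?thesis .
    qed
    have "(\<lambda>x. \<sigma> n x - g x) = restr X (\<lambda>x. \<Sum>i. (A n i - a i) * \<phi> i x)"
    proof
      fix x
      show "\<sigma> n x - g x = restr X (\<lambda>x. \<Sum>i. (A n i - a i) * \<phi> i x) x"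
      proof (cases "x \<in> X")
        case True
        have "(\<lambda>i. (A n i - a i) * \<phi> i x) sums (\<sigma> n x - (\<Sum>i. a i * \<phi> i x))"
          using sums_diff[OF sx[OF True] summable_sums[OF features_series_summable[OF \<phi> asm True]]]
          by (simp add: left_diff_distrib)
        then show ?thesis using True by (simp add: g_def restr_def sums_iff)
      qed (simp add: g_def restr_def \<sigma>_def section_comb_def)
    qed
    with features_series[OF \<phi> dsm(1)] dsm(2)
    have "(\<lambda>x. \<sigma> n x - g x) \<in> E \<and> N (\<lambda>x. \<sigma> n x - g x) \<le> sqnorm UNIV l2_kernel (\<lambda>i. A n i - a i)"
      by simp
    then show ?thesis using dE by (simp add: fnorm_rk l2.fnorm_rk)
  qed
  have limg: "(\<lambda>n. fnorm (rk X K) (\<lambda>x. \<sigma> n x - g x)) \<longlonglongrightarrow> 0"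
    using le2 space.fnorm_nonneg by (intro Lim_null_comparison[OF _ a(2)] always_eventually) simp
  have "f x = g x" if x: "x \<in> X" for x
  proof (rule LIMSEQ_unique)
    show "(\<lambda>n. \<sigma> n x) \<longlonglongrightarrow> f x" by (rule is_rkhs_tendsto[OF is_rkhs_rk \<sigma>E f' lim x])
    show "(\<lambda>n. \<sigma> n x) \<longlonglongrightarrow> g x" by (rule is_rkhs_tendsto[OF is_rkhs_rk \<sigma>E _ limg x]) (simp add: g)
  qed
  then have "f x = g x" for x using elems_outside[OF f, of x] elems_outside[OF g, of x] by (cases "x \<in> X") auto
  then have "f = g" by (rule ext)
  then show ?thesis by (intro that[OF asm le]) (simp add: g_def)
qed


section \<open>Splitting off the constants\<close>

text \<open>When the functional \<open>J\<close> is represented by the function 1 in both spaces, subtracting 1 from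
  the kernel restricts the space to the kernel of \<open>J\<close>, so that only functions with \<open>J g = 0\<close> matter.\<close>

lemma qf_minus_one:
  "qf (\<lambda>x y. -1 + K x y) v v = qf K v v - (ev v (\<lambda>_. 1))\<^sup>2"
proof -
  have "qf (\<lambda>x y. -1 + K x y) v v = qf (\<lambda>x y. K x y - 1 * 1) v v" by simp
  then show ?thesis by (simp only: qf_diff qf_prod power2_eq_square)
qed

lemma psd_minus_one:
  assumes K: "psd X K" and one: "restr X (\<lambda>_. 1) \<in> rk_elems X K" and n: "sqnorm X K (restr X (\<lambda>_. 1)) \<le> 1"
  shows "psd X (\<lambda>x y. -1 + K x y)"
proof -
  interpret psd_kernel X K by unfold_locales (rule K)
  have "0 \<le> qf (\<lambda>x y. -1 + K x y) v v" if v: "v \<in> functionals X" for v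
    unfolding qf_minus_one using ev_square_le[OF one v] mult_right_mono[OF n qf_nonneg[OF v]] v by simp
  then show ?thesis using K_sym by (simp add: psd_def)
qed

text \<open>In the two spaces \<open>p\<close> and \<open>q\<close> represent the functional taking
  \<open>f\<close> to \<open>ev v f - m * J f\<close>, and the forms of \<open>K - 1\<close> and
  \<open>L - 1\<close> at \<open>v\<close> are their squared norms \<open>a\<close> and
  \<open>b\<close>. By \<open>J p = 0\<close> the function \<open>p\<close> also belongs to the
  space of \<open>L\<close>, where its inner product with \<open>q\<close> is \<open>a\<close>.
  Cauchy-Schwarz then gives \<open>a * a \<le> c * a * b\<close>.\<close>

lemma dominated_minus_one:
  assumes K: "psd X K" and L: "psd X L"
    and oneK: "restr X (\<lambda>_. 1) \<in> rk_elems X K" and oneL: "restr X (\<lambda>_. 1) \<in> rk_elems X L"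
    and JK: "\<And>f. f \<in> rk_elems X K \<Longrightarrow> ip (rk X K) f (restr X (\<lambda>_. 1)) = J f"
    and JL: "\<And>f. f \<in> rk_elems X L \<Longrightarrow> ip (rk X L) f (restr X (\<lambda>_. 1)) = J f"
    and J1: "J (restr X (\<lambda>_. 1)) = 1"
    and sub: "\<And>f. f \<in> rk_elems X K \<Longrightarrow> J f = 0 \<Longrightarrow> f \<in> rk_elems X L"
    and c: "\<And>f. f \<in> rk_elems X K \<Longrightarrow> J f = 0 \<Longrightarrow> sqnorm X L f \<le> c * sqnorm X K f"
  shows "dominated X (\<lambda>x y. -1 + K x y) (\<lambda>x y. -1 + L x y)"
proof (rule dominatedI)
  interpret K: psd_kernel X K by unfold_locales (rule K)
  interpret L: psd_kernel X L by unfold_locales (rule L)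
  let ?one = "restr X (\<lambda>_. 1)"
  fix v assume v: "v \<in> functionals X"
  define m where "m = ev v (\<lambda>_. 1)"
  define p where "p = (\<lambda>x. section_comb X K v x - m * ?one x)"
  define q where "q = (\<lambda>x. section_comb X L v x - m * ?one x)"
  have evm: "ev v ?one = m" using v by (simp add: m_def)
  have pE: "p \<in> rk_elems X K"
    unfolding p_def by (intro K.diff_elems K.scale_elems K.section_comb_elems v oneK)
  have qE: "q \<in> rk_elems X L"
    unfolding q_def by (intro L.diff_elems L.scale_elems L.section_comb_elems v oneL)
  have ipK: "ip (rk X K) f p = ev v f - m * J f" if "f \<in> rk_elems X K" for f
    unfolding p_def using that v oneK
    by (simp add: K.space.ip_diff_right K.space.ip_scale_right K.scale_elems K.section_comb_elems
        K.ip_section_comb JK)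
  have ipL: "ip (rk X L) f q = ev v f - m * J f" if "f \<in> rk_elems X L" for f
    unfolding q_def using that v oneL
    by (simp add: L.space.ip_diff_right L.space.ip_scale_right L.scale_elems L.section_comb_elems
        L.ip_section_comb JL)
  have Jp: "J p = 0"
    using JK[OF pE] K.space.ip_sym[of p ?one] pE oneK ipK[OF oneK] J1 evm by simp
  have Jq: "J q = 0"
    using JL[OF qE] L.space.ip_sym[of q ?one] qE oneL ipL[OF oneL] J1 evm by simp
  have evp: "ev v p = qf (\<lambda>x y. -1 + K x y) v v"
    unfolding p_def qf_minus_one using v
    by (simp add: ev_diff ev_cmult ev_section_comb evm m_def[symmetric] power2_eq_square)
  have evq: "ev v q = qf (\<lambda>x y. -1 + L x y) v v"
    unfolding q_def qf_minus_one using v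
    by (simp add: ev_diff ev_cmult ev_section_comb evm m_def[symmetric] power2_eq_square)
  define a where "a = qf (\<lambda>x y. -1 + K x y) v v"
  define b where "b = qf (\<lambda>x y. -1 + L x y) v v"
  have a: "a = sqnorm X K p" using ipK[OF pE] Jp by (simp add: K.ip_rk_self[OF pE] evp a_def)
  have b: "b = sqnorm X L q" using ipL[OF qE] Jq by (simp add: L.ip_rk_self[OF qE] evq b_def)
  have pL: "p \<in> rk_elems X L" by (rule sub[OF pE Jp])
  have "a = ip (rk X L) p q" using ipL[OF pL] Jp evp by (simp add: a_def)
  then have "a\<^sup>2 \<le> sqnorm X L p * b"
    using L.space.cauchy_schwarz[of p q] pL qE by (simp add: L.ip_rk_self b)
  also have "\<dots> \<le> (c * a) * b"
    using c[OF pE Jp] L.sqnorm_nonneg[OF qE] by (intro mult_right_mono) (simp_all add: a b)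
  finally have ab: "a * a \<le> a * (c * b)" by (simp add: power2_eq_square mult_ac)
  have a0: "a \<ge> 0" using K.sqnorm_nonneg[OF pE] by (simp add: a)
  have b0: "b \<ge> 0" using L.sqnorm_nonneg[OF qE] by (simp add: b)
  have "a \<le> max c 0 * b"
  proof (cases "a = 0")
    case True
    then show ?thesis using b0 by simp
  next
    case False
    then have "a \<le> c * b" using ab a0 by simp
    also have "\<dots> \<le> max c 0 * b" using b0 by (intro mult_right_mono) auto
    finally show ?thesis .
  qed
  then show "qf (\<lambda>x y. -1 + K x y) v v \<le> max c 0 * qf (\<lambda>x y. -1 + L x y) v v"
    by (simp add: a_def b_def)
qed

text \<open>The norm of \<open>J\<close> is at most 1 and attained at \<open>e\<close>. Perturbing
  \<open>e\<close> within the set where \<open>J\<close> is 1 cannot decrease its norm, so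
  \<open>e\<close> is orthogonal to the kernel of \<open>J\<close>. This determines inner products
  with \<open>e\<close> without computing any norm in full.\<close>

lemma represented_by_unit:
  assumes K: "psd X K" and e: "e \<in> rk_elems X K" and n: "sqnorm X K e \<le> 1"
    and add: "\<And>f g. f \<in> rk_elems X K \<Longrightarrow> g \<in> rk_elems X K \<Longrightarrow> J (\<lambda>x. f x + g x) = J f + J g"
    and scale: "\<And>c f. f \<in> rk_elems X K \<Longrightarrow> J (\<lambda>x. c * f x) = c * J f"
    and bd: "\<And>f. f \<in> rk_elems X K \<Longrightarrow> (J f)\<^sup>2 \<le> sqnorm X K f"
    and Je: "J e = 1" and f: "f \<in> rk_elems X K"
  shows "ip (rk X K) f e = J f"
proof -
  interpret psd_kernel X K by unfold_locales (rule K)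
  have ee: "ip (rk X K) e e = 1" using bd[OF e] n Je by (simp add: ip_rk_self[OF e])
  define g where "g = (\<lambda>x. f x - J f * e x)"
  have gE: "g \<in> E" unfolding g_def by (intro diff_elems scale_elems f e)
  have Jg: "J g = 0"
    using add[OF f scale_elems[OF e], of "- J f"] scale[OF e, of "- J f"] Je by (simp add: g_def)
  define b where "b = ip (rk X K) e g"
  have *: "0 \<le> 2 * (t * b) + t\<^sup>2 * N g" for t
  proof -
    have m: "(\<lambda>x. e x + t * g x) \<in> E" by (intro add_elems scale_elems e gE)
    have "J (\<lambda>x. e x + t * g x) = 1" using add[OF e scale_elems[OF gE]] scale[OF gE] Jg Je by simp
    then have "1 \<le> ip (rk X K) (\<lambda>x. e x + t * g x) (\<lambda>x. e x + t * g x)"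
      using bd[OF m] by (simp add: ip_rk_self[OF m])
    also have "\<dots> = 1 + 2 * (t * b) + t\<^sup>2 * N g"
      using e gE by (simp add: space.ip_self_add scale_elems space.ip_scale space.ip_scale_right ee
          ip_rk_self b_def power2_eq_square)
    finally show ?thesis by simp
  qed
  have "b = 0"
  proof -
    have Ng: "N g \<ge> 0" by (rule sqnorm_nonneg[OF gE])
    define u where "u = b / (N g + 1)"
    have bu: "b = u * (N g + 1)" using Ng by (simp add: u_def)
    have "0 \<le> 2 * (- u * b) + (- u)\<^sup>2 * N g" by (rule *)
    then have "u\<^sup>2 * (N g + 2) \<le> 0" unfolding bu by (simp add: algebra_simps power2_eq_square)
    moreover have "u\<^sup>2 * (N g + 2) > 0" if "u \<noteq> 0" using Ng that by (intro mult_pos_pos) auto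
    ultimately have "u = 0" by fastforce
    then show ?thesis using bu by simp
  qed
  moreover have "ip (rk X K) g e = ip (rk X K) f e - J f"
    unfolding g_def using f e by (simp add: space.ip_diff space.ip_scale scale_elems ee)
  ultimately show ?thesis using space.ip_sym[of e g] e gE by (simp add: b_def)
qed

section \<open>Bernoulli polynomials and their Fourier series\<close>

definition bern :: "nat \<Rightarrow> real \<Rightarrow> real" where
  "bern n x = bernoulli_poly n x / fact n"

lemma bernoulli_number_sum: "(\<Sum>k\<le>n. real ((n + 1) choose k) * bernoulli_number k) = (if n = 0 then 1 else 0)"
proof (cases n)
  case (Suc m)
  have "real (m + 2) * bernoulli_number (Suc m) = - (\<Sum>k\<le>m. real ((m + 2) choose k) * bernoulli_number k)"
    by simp
  then show ?thesis by (simp add: Suc del: bernoulli_number.simps binomial_Suc_Suc)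
qed simp

lemma bern_altdef: "bern n x = (\<Sum>k\<le>n. bernoulli_number k / fact k * (x ^ (n - k) / fact (n - k)))"
  unfolding bern_def bernoulli_poly_def sum_divide_distrib
  by (rule sum.cong[OF refl]) (simp add: binomial_fact)

lemma bern_0 [simp]: "bern 0 x = 1"
  by (simp add: bern_altdef)

lemma bern_1: "bern (Suc 0) x = x - 1 / 2"
  by (simp add: bern_altdef)

lemma bern_2: "bern 2 x = x\<^sup>2 / 2 - x / 2 + 1 / 12"
  by (simp add: bern_altdef eval_nat_numeral field_simps)

lemma monomial_deriv:
  "((\<lambda>x. x ^ Suc n / fact (Suc n)) has_real_derivative x ^ n / fact n) (at x within S)"
proof -
  have "((\<lambda>x. x ^ Suc n) has_real_derivative real (Suc n) * x ^ n) (at x within S)"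
    using DERIV_pow[of "Suc n" x S] by simp
  from DERIV_cdivide[OF this, of "fact (Suc n)"] show ?thesis
    by (simp del: of_nat_Suc power_Suc)
qed

lemma bern_deriv: "(bern (Suc n) has_real_derivative bern n x) (at x within S)"
proof -
  have "((\<lambda>x. \<Sum>k\<le>Suc n. bernoulli_number k / fact k * (x ^ (Suc n - k) / fact (Suc n - k)))
      has_real_derivative (\<Sum>k\<le>Suc n. if k \<le> n then bernoulli_number k / fact k * (x ^ (n - k) / fact (n - k)) else 0))
      (at x within S)"
  proof (rule DERIV_sum)
    fix k assume "k \<in> {..Suc n}"
    show "((\<lambda>x. bernoulli_number k / fact k * (x ^ (Suc n - k) / fact (Suc n - k))) has_real_derivative
        (if k \<le> n then bernoulli_number k / fact k * (x ^ (n - k) / fact (n - k)) else 0)) (at x within S)"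
    proof (cases "k \<le> n")
      case True
      then have "Suc n - k = Suc (n - k)" by simp
      then show ?thesis using DERIV_cmult[OF monomial_deriv[of "n - k" x S], of "bernoulli_number k / fact k"] True
        by (simp del: fact_Suc power_Suc)
    next
      case False
      then have "k = Suc n" using \<open>k \<in> _\<close> by simp
      then show ?thesis by simp
    qed
  qed
  then show ?thesis by (simp add: bern_altdef[abs_def])
qed

lemma bern_at_0: "bern n 0 = bernoulli_number n / fact n"
proof -
  have "bern n 0 = (\<Sum>k\<le>n. if k = n then bernoulli_number n / fact n else 0)"
    unfolding bern_altdef by (rule sum.cong) (auto simp: power_0_left)
  then show ?thesis by simp
qed

text \<open>The recursion for the Bernoulli numbers. It makes boundary differences of derivatives
  dual to the polynomials.\<close>

lemma bern_jump: "n \<ge> 1 \<Longrightarrow> bern n 1 - bern n 0 = (if n = 1 then 1 else 0)"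
proof -
  assume "n \<ge> 1"
  then obtain m where n: "n = Suc m" by (cases n) auto
  have "bern n 1 = (\<Sum>k\<le>n. real (n choose k) * bernoulli_number k) / fact n"
    by (simp add: bern_def bernoulli_poly_def)
  also have "\<dots> = ((if m = 0 then 1 else 0) + bernoulli_number n) / fact n"
    using bernoulli_number_sum[of m] by (simp add: n del: bernoulli_number.simps binomial_Suc_Suc)
  finally show ?thesis by (simp add: bern_at_0 n add_divide_distrib)
qed

text \<open>Taylor's formula, since each derivative is the polynomial of next lower degree.\<close>

lemma bern_add: "bern n (x + h) = (\<Sum>j\<le>n. bern (n - j) x * (h ^ j / fact j))"
proof (induction n arbitrary: h)
  case (Suc n)
  define d where "d h = bern (Suc n) (x + h) - (\<Sum>j\<le>Suc n. bern (Suc n - j) x * (h ^ j / fact j))" for h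
  have "(d has_real_derivative 0) (at h)" for h
  proof -
    have 1: "((\<lambda>h. bern (Suc n) (x + h)) has_real_derivative bern n (x + h)) (at h)"
      using DERIV_shift[of "bern (Suc n)" "bern n (x + h)" h x] bern_deriv[of n "h + x" UNIV]
      by (simp add: add.commute)
    have 2: "((\<lambda>h. \<Sum>j\<le>n. bern (n - j) x * (h ^ Suc j / fact (Suc j))) has_real_derivative
        (\<Sum>j\<le>n. bern (n - j) x * (h ^ j / fact j))) (at h)"
      by (rule DERIV_sum) (rule DERIV_cmult[OF monomial_deriv])
    have "d = (\<lambda>h. bern (Suc n) (x + h) - (bern (Suc n) x + (\<Sum>j\<le>n. bern (n - j) x * (h ^ Suc j / fact (Suc j)))))"
      unfolding d_def sum.atMost_Suc_shift by (simp del: fact_Suc power_Suc)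
    then show ?thesis
      using DERIV_diff[OF 1 DERIV_add[OF DERIV_const[of "bern (Suc n) x"] 2]] by (simp add: Suc)
  qed
  then have "d h = d 0" by (intro DERIV_isconst_all) auto
  moreover have "(\<Sum>j\<le>Suc n. bern (Suc n - j) x * (0 ^ j / fact j)) = bern (Suc n) x"
    by (simp add: sum.atMost_Suc_shift)
  ultimately show ?case by (simp add: d_def)
qed simp

text \<open>The phase treats even and odd \<open>n\<close> alike and turns differentiation into
  lowering \<open>n\<close> by 1.\<close>

definition fourier_term :: "nat \<Rightarrow> nat \<Rightarrow> real \<Rightarrow> real" where
  "fourier_term n i x = - 2 * cos (2 * pi * real (Suc i) * x - real n * pi / 2) / (2 * pi * real (Suc i)) ^ n"

lemma summable_inverse_power:
  assumes "n \<ge> 2"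
  shows "summable (\<lambda>i. 1 / (a * real (Suc i)) ^ n)"
proof -
  have "summable (\<lambda>i. inverse (real i ^ n))" using inverse_power_summable[OF assms, where ?'a = real] by simp
  then have "summable (\<lambda>i. inverse (real (Suc i) ^ n))" by (subst summable_Suc_iff)
  from summable_mult[OF this, of "1 / a ^ n"] show ?thesis
    by (simp add: power_mult_distrib inverse_eq_divide)
qed

lemma fourier_term_bound: "norm (fourier_term n i x) \<le> 2 * (1 / (2 * pi * real (Suc i)) ^ n)"
proof -
  have "\<bar>2 * cos (2 * pi * real (Suc i) * x - real n * pi / 2)\<bar> \<le> 2" by (simp add: abs_mult)
  then have "\<bar>2 * cos (2 * pi * real (Suc i) * x - real n * pi / 2)\<bar> / (2 * pi * real (Suc i)) ^ n
      \<le> 2 / (2 * pi * real (Suc i)) ^ n"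
    by (intro divide_right_mono) auto
  then show ?thesis by (simp add: fourier_term_def)
qed

lemma fourier_term_summable: "n \<ge> 2 \<Longrightarrow> summable (\<lambda>i. fourier_term n i x)"
  by (rule summable_comparison_test'[of "\<lambda>i. 2 * (1 / (2 * pi * real (Suc i)) ^ n)" 0])
    (intro summable_mult summable_inverse_power, assumption, rule fourier_term_bound)

lemma cos_phase_deriv:
  assumes "w \<noteq> 0"
  shows "((\<lambda>x. cos (w * x - t - real (Suc n) * pi / 2) / w ^ Suc n) has_real_derivative
    cos (w * x - t - real n * pi / 2) / w ^ n) (at x within S)"
proof -
  have "- sin (w * x - t - real (Suc n) * pi / 2) = cos (w * x - t - real n * pi / 2)"
  proof -
    have "w * x - t - real (Suc n) * pi / 2 = - (pi / 2 - (w * x - t - real n * pi / 2))"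
      by (simp add: field_simps)
    then have "- sin (w * x - t - real (Suc n) * pi / 2) = - sin (- (pi / 2 - (w * x - t - real n * pi / 2)))"
      by (rule arg_cong)
    also have "\<dots> = cos (w * x - t - real n * pi / 2)" by (simp add: sin_diff)
    finally show ?thesis .
  qed
  then show ?thesis using assms
    by (auto intro!: derivative_eq_intros simp: field_simps simp del: of_nat_Suc)
qed

lemma fourier_term_deriv: "(fourier_term (Suc n) i has_real_derivative fourier_term n i x) (at x within S)"
proof -
  have "fourier_term m i = (\<lambda>x. -2 * (cos (2 * pi * real (Suc i) * x - real m * pi / 2) / (2 * pi * real (Suc i)) ^ m))" for m
    by (simp add: fourier_term_def fun_eq_iff)
  then show ?thesis using DERIV_cmult[OF cos_phase_deriv[of "2 * pi * real (Suc i)" 0 n x S], of "-2"] by simp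
qed

lemma series_has_real_derivative:
  fixes f f' :: "nat \<Rightarrow> real \<Rightarrow> real"
  assumes S: "convex S" and f: "\<And>i x. x \<in> S \<Longrightarrow> (f i has_real_derivative f' i x) (at x within S)"
    and M: "\<And>i x. x \<in> S \<Longrightarrow> \<bar>f' i x\<bar> \<le> M i" "summable M"
    and s: "x0 \<in> S" "summable (\<lambda>i. f i x0)" and x: "x \<in> S"
  shows "((\<lambda>x. \<Sum>i. f i x) has_real_derivative (\<Sum>i. f' i x)) (at x within S)"
proof -
  have "uniform_limit S (\<lambda>n x. \<Sum>i<n. f' i x) (\<lambda>x. \<Sum>i. f' i x) sequentially"
    by (rule Weierstrass_m_test[OF _ M(2)]) (use M in simp)
  from has_field_derivative_series[OF S f this s] obtain g where
    g: "\<And>x. x \<in> S \<Longrightarrow> (\<lambda>n. f n x) sums g x"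
      "\<And>x. x \<in> S \<Longrightarrow> (g has_real_derivative (\<Sum>i. f' i x)) (at x within S)" by blast
  show ?thesis
    by (rule has_field_derivative_transform_within[OF g(2)[OF x] zero_less_one x])
      (use g(1) in \<open>simp add: sums_iff\<close>)
qed

definition fourier_sum :: "nat \<Rightarrow> real \<Rightarrow> real" where
  "fourier_sum n x = (\<Sum>i. fourier_term n i x)"

lemma fourier_sum_deriv:
  assumes "n \<ge> 2"
  shows "(fourier_sum (Suc n) has_real_derivative fourier_sum n x) (at x within S)"
proof -
  have "(fourier_sum (Suc n) has_real_derivative fourier_sum n x) (at x within UNIV)"
    unfolding fourier_sum_def[abs_def]
  proof (rule series_has_real_derivative)
    show "\<bar>fourier_term n i x\<bar> \<le> 2 * (1 / (2 * pi * real (Suc i)) ^ n)" for i x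
      using fourier_term_bound by simp
    show "summable (\<lambda>i. 2 * (1 / (2 * pi * real (Suc i)) ^ n))"
      by (intro summable_mult summable_inverse_power assms)
    show "summable (\<lambda>i. fourier_term (Suc n) i 0)" using assms by (intro fourier_term_summable) simp
  qed (auto intro: fourier_term_deriv)
  then show ?thesis by (rule has_field_derivative_at_within)
qed

lemma fourier_sum_periodic: "fourier_sum n 1 = fourier_sum n 0"
proof -
  have "fourier_term n i 1 = fourier_term n i 0" for i
  proof -
    have "cos (2 * pi * real (Suc i) - real n * pi / 2) = cos (- (real n * pi / 2) + 2 * pi * of_int (int (Suc i)))"
      by (simp add: algebra_simps)
    also have "\<dots> = cos (- (real n * pi / 2))" unfolding cos_add cos_int_2pin sin_int_2pin by simp
    finally show ?thesis by (simp add: fourier_term_def)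
  qed
  then show ?thesis by (simp add: fourier_sum_def)
qed

lemma dirichlet_kernel: "sin (pi * x) * (1 + (\<Sum>k=1..n. 2 * cos (2 * pi * real k * x))) = sin (real (2 * n + 1) * pi * x)"
proof (induction n)
  case (Suc n)
  have "2 * sin (pi * x) * cos (2 * pi * real (Suc n) * x) =
      sin (pi * x + 2 * pi * real (Suc n) * x) + sin (pi * x - 2 * pi * real (Suc n) * x)"
    by (simp add: sin_add sin_diff)
  also have "pi * x + 2 * pi * real (Suc n) * x = real (2 * Suc n + 1) * pi * x" by (simp add: algebra_simps)
  also have "pi * x - 2 * pi * real (Suc n) * x = - (real (2 * n + 1) * pi * x)" by (simp add: algebra_simps)
  finally show ?case using Suc by (simp add: distrib_left mult.left_commute mult.commute[of 2])
qed simp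

text \<open>The Dirichlet kernel is integrated twice. The first integral \<open>D\<close> differs from the function \<open>A\<close>
  of order \<open>1/n\<close> by a function whose derivative is of order \<open>1/n\<close>.\<close>

lemma fourier_2_partial:
  fixes x :: real
  assumes d: "0 < d" "d < 1/2" and x: "x \<in> {d..1 - d}"
  defines "G \<equiv> \<lambda>n x. (\<Sum>k=1..n. 2 * cos (2 * pi * real k * x) / (2 * pi * real k)\<^sup>2) - bern 2 x"
  shows "\<bar>G n x - G n (1/2)\<bar> \<le> 2 / (real (2 * n + 1) * (sin (pi * d))\<^sup>2)"
proof -
  define N where "N = real (2 * n + 1)"
  define s where "s = sin (pi * d)"
  define B where "B = 1 / (N * s\<^sup>2)"
  have N: "N \<ge> 1" by (simp add: N_def)
  have s0: "s > 0" unfolding s_def using d by (intro sin_gt_zero) auto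
  have s1: "s \<le> 1" by (simp add: s_def)
  have B0: "B > 0" using N s0 by (simp add: B_def)
  have sin_mono: "sin (pi * a) \<le> sin (pi * b)" if "0 \<le> a" "a \<le> b" "b \<le> 1/2" for a b
  proof (rule sin_monotone_2pi_le)
    have "- (pi / 2) \<le> 0" "0 \<le> pi * a" using that(1) by simp_all
    then show "- (pi / 2) \<le> pi * a" by (rule order_trans)
    show "pi * b \<le> pi / 2" using mult_left_mono[OF that(3), of pi] by simp
  qed (use that in simp)
  have sin_ge: "sin (pi * t) \<ge> s" if t: "t \<in> {d..1 - d}" for t
  proof (cases "t \<le> 1/2")
    case True
    then show ?thesis unfolding s_def using t d by (intro sin_mono) auto
  next
    case False
    have "sin (pi * t) = sin (pi * (1 - t))" using sin_pi_minus[of "pi * t"] by (simp add: algebra_simps)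
    also have "\<dots> \<ge> s" unfolding s_def using t d False by (intro sin_mono) auto
    finally show ?thesis .
  qed
  define D where "D t = - (\<Sum>k=1..n. 2 * sin (2 * pi * real k * t) / (2 * pi * real k)) - (t - 1/2)" for t
  \<comment> \<open>The boundary term that appears when the derivative of \<open>D\<close> is
    integrated by parts.\<close>
  define A where "A t = cos (N * pi * t) / (N * pi * sin (pi * t))" for t
  have GD: "(G n has_real_derivative D t) (at t within T)" for t T
  proof -
    have "((\<lambda>t. \<Sum>k=1..n. 2 * cos (2 * pi * real k * t) / (2 * pi * real k)\<^sup>2) has_real_derivative
        (\<Sum>k=1..n. - (2 * sin (2 * pi * real k * t) / (2 * pi * real k)))) (at t within T)"
    proof (rule DERIV_sum)
      fix k assume "k \<in> {1..n}"
      then have "real k \<noteq> 0" by simp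
      then show "((\<lambda>t. 2 * cos (2 * pi * real k * t) / (2 * pi * real k)\<^sup>2) has_real_derivative
          - (2 * sin (2 * pi * real k * t) / (2 * pi * real k))) (at t within T)"
        by (auto intro!: derivative_eq_intros simp: field_simps power2_eq_square)
    qed
    from DERIV_diff[OF this] bern_deriv[of 1 t T] show ?thesis
      by (simp add: G_def[abs_def] D_def bern_1 sum_negf numeral_2_eq_2)
  qed
  have DD: "(D has_real_derivative - sin (N * pi * t) / sin (pi * t)) (at t within T)"
    if "sin (pi * t) \<noteq> 0" for t T
  proof -
    have "((\<lambda>t. \<Sum>k=1..n. 2 * sin (2 * pi * real k * t) / (2 * pi * real k)) has_real_derivative
        (\<Sum>k=1..n. 2 * cos (2 * pi * real k * t))) (at t within T)"
    proof (rule DERIV_sum)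
      fix k assume "k \<in> {1..n}"
      then have "real k \<noteq> 0" by simp
      then show "((\<lambda>t. 2 * sin (2 * pi * real k * t) / (2 * pi * real k)) has_real_derivative
          2 * cos (2 * pi * real k * t)) (at t within T)"
        by (auto intro!: derivative_eq_intros simp: field_simps)
    qed
    then have "(D has_real_derivative - (\<Sum>k=1..n. 2 * cos (2 * pi * real k * t)) - 1) (at t within T)"
      unfolding D_def[abs_def]
      using DERIV_diff[OF DERIV_minus DERIV_diff[OF DERIV_ident DERIV_const[of "1/2 :: real"]]] by simp
    also have "- (\<Sum>k=1..n. 2 * cos (2 * pi * real k * t)) - 1 = - sin (N * pi * t) / sin (pi * t)"
      using dirichlet_kernel[of t n] that by (simp add: N_def field_simps)
    finally show ?thesis .
  qed
  have AD: "(A has_real_derivative - sin (N * pi * t) / sin (pi * t)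
      - cos (N * pi * t) * cos (pi * t) / (N * (sin (pi * t))\<^sup>2)) (at t within T)"
    if "sin (pi * t) \<noteq> 0" for t T
    unfolding A_def[abs_def] using that N
    by (auto intro!: derivative_eq_intros simp: field_simps power2_eq_square)
  have D_le: "\<bar>D t\<bar> \<le> 2 * B" if t: "t \<in> {d..1 - d}" for t
  proof -
    have "norm ((D t - A t) - (D (1/2) - A (1/2))) \<le> B * norm (t - 1/2)"
    proof (rule field_differentiable_bound[of "{d..1-d}"])
      fix u assume u: "u \<in> {d..1-d}"
      have su: "sin (pi * u) \<ge> s" by (rule sin_ge[OF u])
      then have nz: "sin (pi * u) \<noteq> 0" using s0 by simp
      show "((\<lambda>t. D t - A t) has_field_derivative cos (N * pi * u) * cos (pi * u) / (N * (sin (pi * u))\<^sup>2))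
          (at u within {d..1-d})"
        using DERIV_diff[OF DD[OF nz] AD[OF nz]] by simp
      have "s\<^sup>2 \<le> (sin (pi * u))\<^sup>2" using su s0 by (intro power_mono) auto
      then have "N * s\<^sup>2 \<le> N * (sin (pi * u))\<^sup>2" using N by simp
      moreover have "\<bar>cos (N * pi * u) * cos (pi * u)\<bar> \<le> 1"
        unfolding abs_mult by (intro mult_le_one) auto
      ultimately have "\<bar>cos (N * pi * u) * cos (pi * u)\<bar> / (N * (sin (pi * u))\<^sup>2) \<le> 1 / (N * s\<^sup>2)"
        using N s0 by (intro frac_le) auto
      then show "norm (cos (N * pi * u) * cos (pi * u) / (N * (sin (pi * u))\<^sup>2)) \<le> B"
        using N by (simp add: B_def abs_mult)
    qed (use t d in auto)
    also have "\<bar>t - 1/2\<bar> \<le> 1/2" using t d unfolding abs_le_iff by auto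
    then have "B * norm (t - 1/2) \<le> B * (1/2)" using B0 by (intro mult_left_mono) auto
    finally have 1: "\<bar>(D t - A t) - (D (1/2) - A (1/2))\<bar> \<le> B / 2" by simp
    \<comment> \<open>Both functions vanish at the midpoint, \<open>D\<close> term by term and
      \<open>A\<close> because \<open>N\<close> is odd; this settles the constant of
      integration.\<close>
    have 2: "D (1/2) = 0"
    proof -
      have "sin (2 * pi * real k * (1/2)) = 0" for k by (simp add: mult.commute sin_npi)
      then show ?thesis by (simp add: D_def)
    qed
    have 3: "A (1/2) = 0"
    proof -
      have "N * pi * (1/2) = pi / 2 + real n * pi" by (simp add: N_def field_simps)
      then have "cos (N * pi * (1/2)) = cos (pi / 2 + real n * pi)" by (rule arg_cong)
      also have "\<dots> = 0" by (simp add: cos_add)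
      finally have "cos (N * pi * (1/2)) = 0" .
      then show ?thesis by (simp add: A_def)
    qed
    have "\<bar>A t\<bar> \<le> 1 / (N * s)"
    proof -
      have "\<bar>A t\<bar> = \<bar>cos (N * pi * t)\<bar> / (N * (pi * sin (pi * t)))"
        using sin_ge[OF t] s0 N by (simp add: A_def abs_mult)
      also have "\<dots> \<le> 1 / (N * s)"
      proof (rule frac_le)
        have "1 * s \<le> pi * sin (pi * t)" using sin_ge[OF t] s0 pi_ge_two by (intro mult_mono) auto
        then show "N * s \<le> N * (pi * sin (pi * t))" using N by simp
      qed (use N s0 in auto)
      finally show ?thesis .
    qed
    also have "\<dots> \<le> B" unfolding B_def using N s0 s1 mult_left_mono[OF s1, of s]
      by (intro divide_left_mono mult_left_mono) (auto simp: power2_eq_square)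
    finally have 4: "\<bar>A t\<bar> \<le> B" .
    have "B / 2 \<le> B" using B0 by simp
    then have "\<bar>D t - A t\<bar> \<le> B" using 1 2 3 by simp
    then show ?thesis using 4 by linarith
  qed
  have "norm (G n x - G n (1/2)) \<le> 2 * B * norm (x - 1/2)"
    by (rule field_differentiable_bound[of "{d..1-d}" _ D]) (use GD D_le x d in auto)
  also have "\<dots> \<le> 2 * B * 1" using x d B0 by (intro mult_left_mono) (auto simp: abs_le_iff)
  finally show ?thesis by (simp add: B_def N_def s_def)
qed

text \<open>Letting the number of terms grow in \<open>fourier_2_partial\<close> makes the
  difference constant on the open interval, and by continuity on the closed one. At 0 its value
  follows from the sum of the inverse squares.\<close>

lemma fourier_2:
  assumes "x \<in> {0..1}"
  shows "fourier_sum 2 x = bern 2 x"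
proof -
  define h where "h x = fourier_sum 2 x - bern 2 x" for x
  have ft: "fourier_term 2 i x = 2 * cos (2 * pi * real (Suc i) * x) / (2 * pi * real (Suc i))\<^sup>2" for i x
    by (simp add: fourier_term_def)
  have lim: "(\<lambda>n. (\<Sum>k=1..n. 2 * cos (2 * pi * real k * x) / (2 * pi * real k)\<^sup>2) - bern 2 x) \<longlonglongrightarrow> h x" for x
  proof -
    have "(\<lambda>n. \<Sum>i<n. fourier_term 2 i x) \<longlonglongrightarrow> fourier_sum 2 x"
      unfolding fourier_sum_def using fourier_term_summable[of 2 x] summable_LIMSEQ by auto
    moreover have "(\<Sum>i<n. fourier_term 2 i x) = (\<Sum>k=1..n. 2 * cos (2 * pi * real k * x) / (2 * pi * real k)\<^sup>2)" for n
      unfolding One_nat_def sum.atLeast1_atMost_eq by (simp add: ft)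
    ultimately show ?thesis unfolding h_def by (intro tendsto_diff) auto
  qed
  have eq: "h x = h (1/2)" if x: "x \<in> {0<..<1}" for x
  proof -
    \<comment> \<open>This puts \<open>x\<close> into \<open>{d..1 - d}\<close>; the bound 1/4
      ensures \<open>d < 1/2\<close>.\<close>
    define d where "d = min (min x (1 - x)) (1/4)"
    have d: "0 < d" "d < 1/2" "x \<in> {d..1 - d}" using x by (auto simp: d_def min_def)
    have s: "sin (pi * d) > 0" using d by (intro sin_gt_zero) auto
    have "(\<lambda>n. ((\<Sum>k=1..n. 2 * cos (2 * pi * real k * x) / (2 * pi * real k)\<^sup>2) - bern 2 x) -
        ((\<Sum>k=1..n. 2 * cos (2 * pi * real k * (1/2)) / (2 * pi * real k)\<^sup>2) - bern 2 (1/2))) \<longlonglongrightarrow> 0"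
    proof (rule Lim_null_comparison)
      show "\<forall>\<^sub>F n in sequentially. norm (((\<Sum>k=1..n. 2 * cos (2 * pi * real k * x) / (2 * pi * real k)\<^sup>2) - bern 2 x) -
        ((\<Sum>k=1..n. 2 * cos (2 * pi * real k * (1/2)) / (2 * pi * real k)\<^sup>2) - bern 2 (1/2))) \<le>
        2 / (real (2 * n + 1) * (sin (pi * d))\<^sup>2)"
        using fourier_2_partial[OF d] by (intro always_eventually) simp
      show "(\<lambda>n. 2 / (real (2 * n + 1) * (sin (pi * d))\<^sup>2)) \<longlonglongrightarrow> 0"
        using s by real_asymp
    qed
    moreover note tendsto_diff[OF lim[of x] lim[of "1/2"]]
    ultimately have "h x - h (1/2) = 0" using LIMSEQ_unique by blast
    then show ?thesis by simp
  qed
  have cont: "continuous_on {0..1} h"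
  proof -
    have "continuous_on {0..1} (fourier_sum 2)"
      unfolding fourier_sum_def[abs_def]
    proof (rule uniform_limit_theorem)
      show "uniform_limit {0..1} (\<lambda>n x. \<Sum>i<n. fourier_term 2 i x) (\<lambda>x. \<Sum>i. fourier_term 2 i x) sequentially"
        by (rule Weierstrass_m_test[OF fourier_term_bound]) (intro summable_mult summable_inverse_power, simp)
      show "\<forall>\<^sub>F n in sequentially. continuous_on {0..1} (\<lambda>x. \<Sum>i<n. fourier_term 2 i x)"
        unfolding fourier_term_def by (intro always_eventually allI continuous_intros) auto
    qed auto
    then show ?thesis unfolding h_def bern_2 by (intro continuous_intros) auto
  qed
  have all: "h x = h (1/2)" if "x \<in> {0..1}" for x
  proof (rule continuous_constant_on_closure[where S = "{0<..<1}" and f = h and a = "h (1/2)"])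
    show "continuous_on (closure {0<..<1}) h" using cont by simp
    show "h y = h (1/2)" if "y \<in> {0<..<1}" for y by (rule eq[OF that])
    show "x \<in> closure {0<..<1}" using that by simp
  qed
  have "h 0 = 0"
  proof -
    have "(\<lambda>i. 1 / (2 * pi\<^sup>2) * (1 / real ((i + 1)\<^sup>2))) sums (1 / (2 * pi\<^sup>2) * (pi\<^sup>2 / 6))"
      using sums_mult[OF inverse_squares_sums, of "1 / (2 * pi\<^sup>2)"] by (simp add: add.commute)
    moreover have "1 / (2 * pi\<^sup>2) * (1 / real ((i + 1)\<^sup>2)) = fourier_term 2 i 0" for i
      by (simp add: ft power_mult_distrib add.commute)
    ultimately show ?thesis by (simp add: h_def fourier_sum_def sums_iff bern_2)
  qed
  then show ?thesis using all[of 0] all[OF assms] by (simp add: h_def)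
qed

text \<open>Integration raises the degree but leaves a constant \<open>c\<close> open. One further
  integration turns it into the linear term \<open>c * x\<close>, and as the polynomial and the
  series of degree above 1 have equal values at 0 and 1, \<open>c\<close> is 0.\<close>

lemma fourier_bern:
  assumes "n \<ge> 2" "x \<in> {0..1}"
  shows "fourier_sum n x = bern n x"
proof -
  have "\<forall>x\<in>{0..1}. fourier_sum n x = bern n x"
    using assms(1)
  proof (induction n rule: dec_induct)
    case base
    then show ?case using fourier_2 by blast
  next
    case (step n)
    have "\<exists>c. \<forall>x\<in>{0..1}. bern (Suc n) x - fourier_sum (Suc n) x = c"
    proof (rule has_field_derivative_zero_constant)
      show "((\<lambda>x. bern (Suc n) x - fourier_sum (Suc n) x) has_field_derivative 0) (at x within {0..1})"
        if "x \<in> {0..1}" for x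
        using DERIV_diff[OF bern_deriv fourier_sum_deriv[OF step(1)], of n x "{0..1}"] step.IH that by simp
    qed simp
    then obtain c where "\<And>x. x \<in> {0..1} \<Longrightarrow> bern (Suc n) x - fourier_sum (Suc n) x = c" by blast
    then have c: "\<And>x. x \<in> {0..1} \<Longrightarrow> bern (Suc n) x = fourier_sum (Suc n) x + c"
      by (simp add: algebra_simps)
    have "\<exists>d. \<forall>x\<in>{0..1}. bern (Suc (Suc n)) x - fourier_sum (Suc (Suc n)) x - c * x = d"
    proof (rule has_field_derivative_zero_constant)
      show "((\<lambda>x. bern (Suc (Suc n)) x - fourier_sum (Suc (Suc n)) x - c * x) has_field_derivative 0) (at x within {0..1})"
        if "x \<in> {0..1}" for x
      proof -
        have "Suc n \<ge> 2" using step(1) by simp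
        from DERIV_diff[OF DERIV_diff[OF bern_deriv fourier_sum_deriv[OF this], of "Suc n" x "{0..1}"] DERIV_cmult_Id[of c]]
        show ?thesis using c[OF that] by simp
      qed
    qed simp
    then obtain d where d: "\<And>x. x \<in> {0..1} \<Longrightarrow> bern (Suc (Suc n)) x - fourier_sum (Suc (Suc n)) x - c * x = d" by blast
    have "c = 0" using d[of 0] d[of 1] bern_jump[of "Suc (Suc n)"] fourier_sum_periodic[of "Suc (Suc n)"] step(1) by simp
    then show ?case using c by simp
  qed
  then show ?thesis using assms(2) by blast
qed

section \<open>Spaces spanned by Bernoulli polynomials and trigonometric functions\<close>

lemma suminf_cauchy_schwarz:
  fixes a b :: "nat \<Rightarrow> real"
  assumes a: "summable (\<lambda>i. (a i)\<^sup>2)" and b: "summable (\<lambda>i. (b i)\<^sup>2)"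
  shows "(\<Sum>i. \<bar>a i * b i\<bar>)\<^sup>2 \<le> (\<Sum>i. (a i)\<^sup>2) * (\<Sum>i. (b i)\<^sup>2)"
proof (rule LIMSEQ_le)
  show "(\<lambda>n. (\<Sum>i<n. \<bar>a i * b i\<bar>)\<^sup>2) \<longlonglongrightarrow> (\<Sum>i. \<bar>a i * b i\<bar>)\<^sup>2"
    by (intro tendsto_power summable_LIMSEQ square_summable_mult a b)
  show "(\<lambda>n. (\<Sum>i<n. (a i)\<^sup>2) * (\<Sum>i<n. (b i)\<^sup>2)) \<longlonglongrightarrow> (\<Sum>i. (a i)\<^sup>2) * (\<Sum>i. (b i)\<^sup>2)"
    by (intro tendsto_mult summable_LIMSEQ a b)
  have "(\<Sum>i<n. \<bar>a i * b i\<bar>)\<^sup>2 \<le> (\<Sum>i<n. (a i)\<^sup>2) * (\<Sum>i<n. (b i)\<^sup>2)" for n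
    using Cauchy_Schwarz_ineq_sum[of "\<lambda>i. \<bar>a i\<bar>" "\<lambda>i. \<bar>b i\<bar>" "{..<n}"] by (simp add: abs_mult)
  then show "\<exists>N. \<forall>n\<ge>N. (\<Sum>i<n. \<bar>a i * b i\<bar>)\<^sup>2 \<le> (\<Sum>i<n. (a i)\<^sup>2) * (\<Sum>i<n. (b i)\<^sup>2)" by blast
qed

lemma bern_bounded: "\<exists>B. \<forall>n\<le>m. \<forall>x\<in>{0..1}. \<bar>bern n x\<bar> \<le> B"
proof (induction m)
  case 0
  then show ?case by (intro exI[of _ 1]) simp
next
  case (Suc m)
  then obtain B where B: "\<And>n x. n \<le> m \<Longrightarrow> x \<in> {0..1} \<Longrightarrow> \<bar>bern n x\<bar> \<le> B" by blast
  have "continuous_on {0..1} (bern (Suc m))"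
    by (rule DERIV_continuous_on[OF bern_deriv])
  then have "compact (bern (Suc m) ` {0..1})" by (intro compact_continuous_image) auto
  then obtain B' where "\<forall>y\<in>bern (Suc m) ` {0..1}. norm y \<le> B'"
    using compact_imp_bounded bounded_iff by metis
  then have "\<bar>bern n x\<bar> \<le> max B B'" if "n \<le> Suc m" "x \<in> {0..1}" for n x
    using that B[of n x] by (cases "n = Suc m") (auto simp: le_Suc_eq le_max_iff_disj)
  then show ?case by blast
qed

text \<open>The integral of the \<open>n\<close>-th derivative. It is represented by \<open>bern n\<close> in \<open>H_sob\<close>.\<close>

definition mean_deriv :: "nat \<Rightarrow> (real \<Rightarrow> real) \<Rightarrow> real" where
  "mean_deriv n f = (if n = 0 then integral {0..1} f else deriv01 (n - 1) f 1 - deriv01 (n - 1) f 0)"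

text \<open>A common frame for the full-period features, the half-period features and the shifted
  ones of \<open>bern_in_per\<close>, which differ in frequencies and phases only. The lower bound
  on the frequencies yields square summability.\<close>

locale bern_trig =
  fixes \<alpha> :: nat and \<omega> \<theta> :: "nat \<Rightarrow> real" and T :: "nat set"
  assumes \<alpha>: "\<alpha> \<ge> 1" and \<omega>: "\<And>j. \<omega> j \<ge> real (Suc j)" and T: "T \<subseteq> {..\<alpha>}"
begin

text \<open>\<open>n\<close> counts integrations: together, the phase \<open>real n * pi / 2\<close>
  and the power of the frequency make differentiation lower \<open>n\<close> by 1. The root accounts
  for the factor 2 in the cosine kernels.\<close>

definition tg :: "nat \<Rightarrow> nat \<Rightarrow> real \<Rightarrow> real" where
  "tg n j x = sqrt 2 * (cos (\<omega> j * x - \<theta> j - real n * pi / 2) / \<omega> j ^ n)"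

text \<open>\<open>dfeat 1\<close> is the sequence of features, \<open>dfeat 0\<close> their antiderivatives, and \<open>dfeat (Suc n)\<close>
  their derivatives of order \<open>n\<close>.\<close>

definition dfeat :: "nat \<Rightarrow> nat \<Rightarrow> real \<Rightarrow> real" where
  "dfeat m i x = (if i \<le> \<alpha> then (if i \<in> T \<and> m \<le> Suc i then bern (Suc i - m) x else 0)
     else tg (Suc \<alpha> - m) (i - Suc \<alpha>) x)"

definition ker :: "real \<Rightarrow> real \<Rightarrow> real" where
  "ker x y = (\<Sum>i. dfeat 1 i x * dfeat 1 i y)"

lemma dfeat_deriv:
  assumes "m \<le> \<alpha>"
  shows "(dfeat m i has_real_derivative dfeat (Suc m) i x) (at x within S)"
proof (cases "i \<le> \<alpha>")
  case True
  show ?thesis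
  proof (cases "i \<in> T \<and> m \<le> i")
    case True
    then have "Suc i - m = Suc (i - m)" by (simp add: Suc_diff_le)
    then show ?thesis using True \<open>i \<le> \<alpha>\<close> bern_deriv[of "i - m" x S]
      by (simp add: dfeat_def[abs_def])
  next
    case False
    \<comment> \<open>At \<open>m = Suc i\<close> the polynomial has been differentiated down to
      \<open>bern 0\<close>, the constant 1; from then on it is 0.\<close>
    then have "dfeat m i = (\<lambda>x. if i \<in> T \<and> m = Suc i then 1 else 0)" "dfeat (Suc m) i x = 0"
      using \<open>i \<le> \<alpha>\<close> by (auto simp: dfeat_def fun_eq_iff le_Suc_eq)
    then show ?thesis by simp
  qed
next
  case False
  have "\<omega> (i - Suc \<alpha>) \<noteq> 0" using \<omega>[of "i - Suc \<alpha>"] by auto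
  from DERIV_cmult[OF cos_phase_deriv[OF this, of "\<theta> (i - Suc \<alpha>)" "\<alpha> - m"], of "sqrt 2" x S]
  show ?thesis using False assms by (simp add: dfeat_def[abs_def] tg_def[abs_def] Suc_diff_le)
qed

lemma tg_bound:
  assumes "n \<ge> 1"
  shows "\<bar>tg n j x\<bar> \<le> sqrt 2 / real (Suc j)"
proof -
  have w: "\<omega> j \<ge> real (Suc j)" "\<omega> j \<ge> 1" using \<omega>[of j] by auto
  have "real (Suc j) \<le> \<omega> j ^ n" using w self_le_power[of "\<omega> j" n] assms by simp
  then have "\<bar>cos (\<omega> j * x - \<theta> j - real n * pi / 2)\<bar> / \<omega> j ^ n \<le> 1 / real (Suc j)"
    by (intro frac_le) auto
  from mult_left_mono[OF this, of "sqrt 2"] show ?thesis using w by (simp add: tg_def abs_mult)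
qed

text \<open>For \<open>m \<le> \<alpha>\<close> the exponent \<open>Suc \<alpha> - m\<close> is at
  least 1, so one square-summable sequence bounds all these features. With square-summable
  coefficients, the series of the derivatives of order below \<alpha> then converge
  uniformly.\<close>

lemma dfeat_bound:
  obtains M where "summable (\<lambda>i. (M i)\<^sup>2)"
    "\<And>m i x. m \<le> \<alpha> \<Longrightarrow> x \<in> {0..1} \<Longrightarrow> \<bar>dfeat m i x\<bar> \<le> M i"
proof -
  obtain B where B: "\<And>n x. n \<le> Suc \<alpha> \<Longrightarrow> x \<in> {0..1} \<Longrightarrow> \<bar>bern n x\<bar> \<le> B" using bern_bounded[of "Suc \<alpha>"] by blast
  define M where "M i = (if i \<le> \<alpha> then B else sqrt 2 / real (Suc (i - Suc \<alpha>)))" for i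
  have B0: "B \<ge> 0" using B[of 0 0] by simp
  have "summable (\<lambda>j. (M (j + Suc \<alpha>))\<^sup>2)"
    using summable_mult[OF summable_inverse_power[of 2 1], of 2] by (simp add: M_def power_divide)
  then have "summable (\<lambda>i. (M i)\<^sup>2)" by (rule summable_iff_shift[THEN iffD1])
  moreover have "\<bar>dfeat m i x\<bar> \<le> M i" if "m \<le> \<alpha>" "x \<in> {0..1}" for m i x
    using that B[of "Suc i - m" x] B0 tg_bound[of "Suc \<alpha> - m" "i - Suc \<alpha>" x] by (auto simp: dfeat_def M_def)
  ultimately show ?thesis by (rule that)
qed

lemma features_ker: "features {0..1} ker (dfeat 1)"
  unfolding features_def
proof (intro ballI)
  fix x y :: real assume xy: "x \<in> {0..1}" "y \<in> {0..1}"
  obtain M where M: "summable (\<lambda>i. (M i)\<^sup>2)" "\<And>m i x. m \<le> \<alpha> \<Longrightarrow> x \<in> {0..1} \<Longrightarrow> \<bar>dfeat m i x\<bar> \<le> M i"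
    using dfeat_bound by blast
  have "\<bar>dfeat 1 i x * dfeat 1 i y\<bar> \<le> (M i)\<^sup>2" for i
    using mult_mono[OF M(2)[OF \<alpha> xy(1), of i] M(2)[OF \<alpha> xy(2), of i]] M(2)[OF \<alpha> xy(1), of i]
    by (simp add: abs_mult power2_eq_square)
  then have "summable (\<lambda>i. dfeat 1 i x * dfeat 1 i y)"
    by (intro summable_comparison_test'[OF M(1)]) simp
  then show "(\<lambda>i. dfeat 1 i x * dfeat 1 i y) sums ker x y" unfolding ker_def by (rule summable_sums)
qed

lemma psd_ker: "psd {0..1} ker"
  by (rule features_psd[OF features_ker])

sublocale psd_kernel "{0..1}" ker
  by unfold_locales (rule psd_ker)

lemma ker_eq:
  assumes xy: "x \<in> {0..1}" "y \<in> {0..1}"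
  shows "summable (\<lambda>j. tg \<alpha> j x * tg \<alpha> j y)"
    and "ker x y = (\<Sum>\<tau>\<in>T. bern \<tau> x * bern \<tau> y) + (\<Sum>j. tg \<alpha> j x * tg \<alpha> j y)"
proof -
  have s: "(\<lambda>i. dfeat 1 i x * dfeat 1 i y) sums ker x y" using features_ker xy by (simp add: features_def)
  then have "summable (\<lambda>j. dfeat 1 (j + Suc \<alpha>) x * dfeat 1 (j + Suc \<alpha>) y)"
    using summable_iff_shift[of "\<lambda>i. dfeat 1 i x * dfeat 1 i y" "Suc \<alpha>"] by (simp add: sums_iff)
  moreover have t: "dfeat 1 (j + Suc \<alpha>) x = tg \<alpha> j x" for j x by (simp add: dfeat_def)
  ultimately show "summable (\<lambda>j. tg \<alpha> j x * tg \<alpha> j y)" by simp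
  have "ker x y = (\<Sum>j. dfeat 1 (j + Suc \<alpha>) x * dfeat 1 (j + Suc \<alpha>) y) + (\<Sum>i<Suc \<alpha>. dfeat 1 i x * dfeat 1 i y)"
    using suminf_split_initial_segment[of "\<lambda>i. dfeat 1 i x * dfeat 1 i y" "Suc \<alpha>"] s by (simp add: sums_iff)
  also have "(\<Sum>i<Suc \<alpha>. dfeat 1 i x * dfeat 1 i y) = (\<Sum>i\<in>{..<Suc \<alpha>}. if i \<in> T then bern i x * bern i y else 0)"
    by (rule sum.cong) (auto simp: dfeat_def)
  also have "\<dots> = (\<Sum>\<tau>\<in>T. bern \<tau> x * bern \<tau> y)"
    using T by (subst sum.inter_restrict[symmetric]) (auto intro!: sum.cong)
  finally show "ker x y = (\<Sum>\<tau>\<in>T. bern \<tau> x * bern \<tau> y) + (\<Sum>j. tg \<alpha> j x * tg \<alpha> j y)"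
    by (simp only: t add.commute)
qed

lemma features_tg: "features {0..1} (\<lambda>x y. \<Sum>j. tg \<alpha> j x * tg \<alpha> j y) (tg \<alpha>)"
  by (simp add: features_def ker_eq(1) summable_sums)

text \<open>The surplus \<open>n - \<alpha>\<close> gains at least one factor
  \<open>1 / \<omega> j\<close>, which makes bounded coefficients square-summable with respect to
  \<open>tg \<alpha>\<close>.\<close>

lemma trig_series_elems:
  assumes n: "n > \<alpha>" and b: "\<And>j. \<bar>b j\<bar> \<le> B"
    and f: "\<And>x. x \<in> {0..1} \<Longrightarrow> f x = (\<Sum>j. b j * cos (\<omega> j * x - \<theta> j - real \<alpha> * pi / 2) / \<omega> j ^ n)"
  shows "restr {0..1} f \<in> rk_elems {0..1} (\<lambda>x y. \<Sum>j. tg \<alpha> j x * tg \<alpha> j y)"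
proof -
  define a where "a j = b j / (sqrt 2 * \<omega> j ^ (n - \<alpha>))" for j
  have w: "\<omega> j \<ge> real (Suc j)" "\<omega> j \<ge> 1" for j using \<omega>[of j] by auto
  have B: "B \<ge> 0" using b[of 0] by linarith
  have "\<bar>a j\<bar> \<le> B / real (Suc j)" for j
  proof -
    have "real (Suc j) \<le> \<omega> j ^ (n - \<alpha>)" using w[of j] self_le_power[of "\<omega> j" "n - \<alpha>"] n by simp
    moreover have "1 \<le> sqrt 2" by simp
    ultimately have "1 * real (Suc j) \<le> sqrt 2 * \<omega> j ^ (n - \<alpha>)" using w[of j] by (intro mult_mono) auto
    then show ?thesis using b[of j] B w[of j] unfolding a_def abs_divide abs_mult
      by (intro frac_le) auto
  qed
  then have "(a j)\<^sup>2 \<le> B\<^sup>2 * (1 / (1 * real (Suc j)) ^ 2)" for j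
    using power_mono[of "\<bar>a j\<bar>" "B / real (Suc j)" 2] by (simp add: power_divide)
  then have "norm ((a j)\<^sup>2) \<le> B\<^sup>2 * (1 / (1 * real (Suc j)) ^ 2)" for j by simp
  then have sa: "summable (\<lambda>j. (a j)\<^sup>2)"
    by (intro summable_comparison_test'[OF summable_mult[OF summable_inverse_power[of 2 1], of "B\<^sup>2"], where N = 0]) auto
  have "b j * cos (\<omega> j * x - \<theta> j - real \<alpha> * pi / 2) / \<omega> j ^ n = a j * tg \<alpha> j x" for j x
  proof -
    have "\<omega> j ^ n = \<omega> j ^ (n - \<alpha>) * \<omega> j ^ \<alpha>" using n by (simp flip: power_add)
    then show ?thesis by (simp add: a_def tg_def)
  qed
  then have "restr {0..1} f = restr {0..1} (\<lambda>x. \<Sum>j. a j * tg \<alpha> j x)"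
    using f by (auto simp: restr_def)
  then show ?thesis using features_series(1)[OF features_tg sa] by simp
qed

section \<open>Expansions in the features and their termwise derivatives\<close>

definition expansion :: "(nat \<Rightarrow> real) \<Rightarrow> (real \<Rightarrow> real) \<Rightarrow> bool" where
  "expansion a f \<longleftrightarrow> summable (\<lambda>i. (a i)\<^sup>2) \<and> f = restr {0..1} (\<lambda>x. \<Sum>i. a i * dfeat 1 i x)"

lemma expansion_elems: "expansion a f \<Longrightarrow> f \<in> E"
  and expansion_sqnorm: "expansion a f \<Longrightarrow> N f \<le> (\<Sum>i. (a i)\<^sup>2)"
  using features_series[OF features_ker, of a] by (auto simp: expansion_def)

lemma ex_expansion:
  assumes "f \<in> E"
  obtains a where "expansion a f" "(\<Sum>i. (a i)\<^sup>2) \<le> N f"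
proof -
  obtain a where a: "summable (\<lambda>i. (a i)\<^sup>2)" "(\<Sum>i. (a i)\<^sup>2) \<le> N f"
    "f = restr {0..1} (\<lambda>x. \<Sum>i. a i * dfeat 1 i x)"
    by (rule features_expansion[OF features_ker assms])
  then show ?thesis by (intro that[of a]) (simp_all add: expansion_def)
qed

lemma expansion_summable:
  assumes "expansion a f" "m \<le> \<alpha>" "x \<in> {0..1}"
  shows "summable (\<lambda>i. a i * dfeat m i x)"
proof -
  obtain M where M: "summable (\<lambda>i. (M i)\<^sup>2)" "\<And>m i x. m \<le> \<alpha> \<Longrightarrow> x \<in> {0..1} \<Longrightarrow> \<bar>dfeat m i x\<bar> \<le> M i"
    using dfeat_bound by blast
  have "\<bar>a i * dfeat m i x\<bar> \<le> \<bar>a i * M i\<bar>" for i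
    using M(2)[OF assms(2,3), of i] by (simp add: abs_mult mult_left_mono)
  then have le: "norm (a i * dfeat m i x) \<le> \<bar>a i * M i\<bar>" for i by simp
  have "summable (\<lambda>i. \<bar>a i * M i\<bar>)"
    by (rule square_summable_mult[OF _ M(1)]) (use assms(1) in \<open>simp add: expansion_def\<close>)
  then show ?thesis by (rule summable_comparison_test'[where N = 0]) (rule le)
qed

lemma expansion_deriv:
  assumes a: "expansion a f" and m: "Suc m \<le> \<alpha>" and x: "x \<in> {0..1}"
  shows "((\<lambda>x. \<Sum>i. a i * dfeat m i x) has_real_derivative (\<Sum>i. a i * dfeat (Suc m) i x)) (at x within {0..1})"
proof -
  obtain M where M: "summable (\<lambda>i. (M i)\<^sup>2)" "\<And>m i x. m \<le> \<alpha> \<Longrightarrow> x \<in> {0..1} \<Longrightarrow> \<bar>dfeat m i x\<bar> \<le> M i"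
    using dfeat_bound by blast
  show ?thesis
  proof (rule series_has_real_derivative)
    show "((\<lambda>x. a i * dfeat m i x) has_real_derivative a i * dfeat (Suc m) i x) (at x within {0..1})" for i x
      using m by (intro DERIV_cmult dfeat_deriv) simp
    show "\<bar>a i * dfeat (Suc m) i x\<bar> \<le> \<bar>a i * M i\<bar>" if "x \<in> {0..1}" for i x
      using M(2)[OF m that, of i] by (simp add: abs_mult mult_left_mono)
    show "summable (\<lambda>i. \<bar>a i * M i\<bar>)"
      by (rule square_summable_mult[OF _ M(1)]) (use a in \<open>simp add: expansion_def\<close>)
    show "summable (\<lambda>i. a i * dfeat m i 0)" using m by (intro expansion_summable[OF a]) auto
  qed (use x in auto)
qed

lemma expansion_deriv01:
  assumes a: "expansion a f"
  shows "n < \<alpha> \<Longrightarrow> x \<in> {0..1} \<Longrightarrow> deriv01 n f x = (\<Sum>i. a i * dfeat (Suc n) i x)"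
proof (induction n arbitrary: x)
  case 0
  then show ?case using a by (simp add: expansion_def restr_def)
next
  case (Suc n)
  have "((\<lambda>x. \<Sum>i. a i * dfeat (Suc n) i x) has_real_derivative (\<Sum>i. a i * dfeat (Suc (Suc n)) i x))
      (at x within {0..1})"
    by (rule expansion_deriv[OF a]) (use Suc.prems in auto)
  then have "(deriv01 n f has_real_derivative (\<Sum>i. a i * dfeat (Suc (Suc n)) i x)) (at x within {0..1})"
    by (rule has_field_derivative_transform_within[OF _ zero_less_one]) (use Suc in auto)
  then show ?case
    using Suc.prems by (simp add: vector_derivative_within_closed_interval
        has_real_derivative_iff_has_vector_derivative)
qed

text \<open>Thanks to the antiderivatives \<open>dfeat 0\<close>, the integral is a boundary
  difference like all the other functionals.\<close>

lemma expansion_mean_deriv: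
  assumes a: "expansion a f" and n: "n \<le> \<alpha>"
  shows "(\<lambda>i. a i * (dfeat n i 1 - dfeat n i 0)) sums mean_deriv n f"
proof -
  have "(\<lambda>i. a i * dfeat n i 1 - a i * dfeat n i 0) sums ((\<Sum>i. a i * dfeat n i 1) - (\<Sum>i. a i * dfeat n i 0))"
    by (intro sums_diff summable_sums expansion_summable[OF a n]) auto
  moreover have "(\<Sum>i. a i * dfeat n i 1) - (\<Sum>i. a i * dfeat n i 0) = mean_deriv n f"
  proof (cases n)
    case 0
    have "(f has_integral (\<Sum>i. a i * dfeat 0 i 1) - (\<Sum>i. a i * dfeat 0 i 0)) {0..1}"
    proof (rule fundamental_theorem_of_calculus)
      fix x :: real assume x: "x \<in> {0..1}"
      then have "f x = (\<Sum>i. a i * dfeat (Suc 0) i x)" using a by (simp add: expansion_def restr_def)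
      then show "((\<lambda>x. \<Sum>i. a i * dfeat 0 i x) has_vector_derivative f x) (at x within {0..1})"
        using expansion_deriv[OF a _ x, of 0] \<alpha> by (simp add: has_real_derivative_iff_has_vector_derivative)
    qed simp
    then show ?thesis using 0 by (simp add: mean_deriv_def integral_unique)
  next
    case (Suc m)
    then show ?thesis using expansion_deriv01[OF a, of m] n by (simp add: mean_deriv_def)
  qed
  ultimately show ?thesis by (simp add: right_diff_distrib)
qed

lemma expansion_add:
  assumes "expansion a f" "expansion b g"
  shows "expansion (\<lambda>i. a i + b i) (\<lambda>x. f x + g x)"
proof -
  have "summable (\<lambda>i. (a i)\<^sup>2 + (b i)\<^sup>2 + 2 * (a i * b i))"
    using assms by (intro summable_add summable_mult summable_rabs_cancel[OF square_summable_mult])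
      (simp_all add: expansion_def)
  then have s: "summable (\<lambda>i. (a i + b i)\<^sup>2)" by (simp add: power2_sum mult.assoc)
  have "f x + g x = restr {0..1} (\<lambda>x. \<Sum>i. (a i + b i) * dfeat 1 i x) x" for x
    using expansion_summable[OF assms(1) \<alpha>, of x] expansion_summable[OF assms(2) \<alpha>, of x] assms
    by (auto simp: expansion_def restr_def distrib_right suminf_add)
  with s show ?thesis by (auto simp: expansion_def)
qed

lemma expansion_scale:
  assumes "expansion a f"
  shows "expansion (\<lambda>i. c * a i) (\<lambda>x. c * f x)"
proof -
  have "c * f x = restr {0..1} (\<lambda>x. \<Sum>i. (c * a i) * dfeat 1 i x) x" for x
    using expansion_summable[OF assms \<alpha>, of x] assms
    by (auto simp: expansion_def restr_def mult.assoc suminf_mult)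
  then show ?thesis using assms by (auto simp: expansion_def power_mult_distrib)
qed

lemma deriv01_add:
  assumes "f \<in> E" "g \<in> E" "n < \<alpha>" "x \<in> {0..1}"
  shows "deriv01 n (\<lambda>x. f x + g x) x = deriv01 n f x + deriv01 n g x"
proof -
  obtain a b where ab: "expansion a f" "expansion b g" using assms ex_expansion by metis
  have "Suc n \<le> \<alpha>" using assms by simp
  note s = expansion_summable[OF ab(1) this assms(4)] expansion_summable[OF ab(2) this assms(4)]
  show ?thesis
    using expansion_deriv01[OF expansion_add[OF ab] assms(3,4)] expansion_deriv01[OF ab(1) assms(3,4)]
      expansion_deriv01[OF ab(2) assms(3,4)] suminf_add[OF s] by (simp add: distrib_right)
qed

lemma deriv01_scale:
  assumes "f \<in> E" "n < \<alpha>" "x \<in> {0..1}"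
  shows "deriv01 n (\<lambda>x. c * f x) x = c * deriv01 n f x"
proof -
  obtain a where a: "expansion a f" using assms ex_expansion by metis
  have "Suc n \<le> \<alpha>" using assms by simp
  note s = expansion_summable[OF a this assms(3)]
  show ?thesis
    using expansion_deriv01[OF expansion_scale[OF a, of c] assms(2,3)] expansion_deriv01[OF a assms(2,3)]
      suminf_mult[OF s, of c] by (simp add: mult.assoc)
qed

lemma deriv01_bounded:
  assumes "n < \<alpha>" "x \<in> {0..1}"
  shows "\<exists>C. \<forall>f\<in>E. \<bar>deriv01 n f x\<bar> \<le> C * fnorm (rk {0..1} ker) f"
proof -
  obtain M where M: "summable (\<lambda>i. (M i)\<^sup>2)" "\<And>m i x. m \<le> \<alpha> \<Longrightarrow> x \<in> {0..1} \<Longrightarrow> \<bar>dfeat m i x\<bar> \<le> M i"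
    using dfeat_bound by blast
  have "\<bar>deriv01 n f x\<bar> \<le> sqrt (\<Sum>i. (M i)\<^sup>2) * fnorm (rk {0..1} ker) f" if f: "f \<in> E" for f
  proof -
    obtain a where a: "expansion a f" "(\<Sum>i. (a i)\<^sup>2) \<le> N f" using ex_expansion[OF f] by blast
    have sa: "summable (\<lambda>i. (a i)\<^sup>2)" using a by (simp add: expansion_def)
    have le: "\<bar>a i * dfeat (Suc n) i x\<bar> \<le> \<bar>a i * M i\<bar>" for i
      using M(2)[of "Suc n" x i] assms by (simp add: abs_mult mult_left_mono)
    have sM: "summable (\<lambda>i. \<bar>a i * M i\<bar>)" by (rule square_summable_mult[OF sa M(1)])
    then have sd: "summable (\<lambda>i. \<bar>a i * dfeat (Suc n) i x\<bar>)"
      by (rule summable_comparison_test'[of _ 0]) (use le in simp)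
    have "\<bar>deriv01 n f x\<bar> \<le> (\<Sum>i. \<bar>a i * dfeat (Suc n) i x\<bar>)"
      using expansion_deriv01[OF a(1) assms] summable_rabs[OF sd] by simp
    also have "\<dots> \<le> (\<Sum>i. \<bar>a i * M i\<bar>)" by (rule suminf_le[OF le sd sM])
    also have "\<dots> \<le> sqrt ((\<Sum>i. (a i)\<^sup>2) * (\<Sum>i. (M i)\<^sup>2))"
      by (rule real_le_rsqrt[OF suminf_cauchy_schwarz[OF sa M(1)]])
    also have "\<dots> \<le> sqrt (N f * (\<Sum>i. (M i)\<^sup>2))"
      using a(2) M(1) by (intro real_sqrt_le_mono mult_right_mono suminf_nonneg) auto
    finally show ?thesis by (simp add: fnorm_rk[OF f] real_sqrt_mult mult.commute)
  qed
  then show ?thesis by blast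
qed

lemma mean_deriv_add:
  assumes "f \<in> E" "g \<in> E" "n \<le> \<alpha>"
  shows "mean_deriv n (\<lambda>x. f x + g x) = mean_deriv n f + mean_deriv n g"
proof -
  obtain a b where ab: "expansion a f" "expansion b g" using assms ex_expansion by metis
  have "(\<lambda>i. (a i + b i) * (dfeat n i 1 - dfeat n i 0)) sums (mean_deriv n f + mean_deriv n g)"
    using sums_add[OF expansion_mean_deriv[OF ab(1) assms(3)] expansion_mean_deriv[OF ab(2) assms(3)]]
    by (simp add: distrib_right)
  with expansion_mean_deriv[OF expansion_add[OF ab] assms(3)] show ?thesis by (rule sums_unique2)
qed

lemma mean_deriv_scale:
  assumes "f \<in> E" "n \<le> \<alpha>"
  shows "mean_deriv n (\<lambda>x. c * f x) = c * mean_deriv n f"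
proof -
  obtain a where a: "expansion a f" using assms ex_expansion by metis
  have "(\<lambda>i. (c * a i) * (dfeat n i 1 - dfeat n i 0)) sums (c * mean_deriv n f)"
    using sums_mult[OF expansion_mean_deriv[OF a assms(2)], of c] by (simp add: mult.assoc)
  with expansion_mean_deriv[OF expansion_scale[OF a] assms(2)] show ?thesis by (rule sums_unique2)
qed

section \<open>Bernoulli polynomials as representers of the mean derivatives\<close>

lemma bern_expansion:
  assumes "n \<in> T"
  shows "expansion (\<lambda>i. if i = n then 1 else 0) (restr {0..1} (bern n))"
proof -
  have 1: "(\<lambda>i. (if i = n then 1 else 0) * dfeat 1 i x) = (\<lambda>i. if i = n then dfeat 1 i x else 0)" for x by auto
  have "(\<Sum>i. (if i = n then 1 else 0) * dfeat 1 i x) = bern n x" for x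
    unfolding 1 using sums_single[of n "\<lambda>i. dfeat 1 i x"] assms T by (auto simp: sums_iff dfeat_def)
  moreover have "summable (\<lambda>i. (if i = n then 1 else (0::real))\<^sup>2)"
    by (rule summable_finite[of "{n}"]) auto
  ultimately show ?thesis by (simp add: expansion_def)
qed

lemma bern_elems: "n \<in> T \<Longrightarrow> restr {0..1} (bern n) \<in> E"
  using bern_expansion expansion_elems by blast

lemma bern_sqnorm:
  assumes "n \<in> T"
  shows "N (restr {0..1} (bern n)) \<le> 1"
proof -
  have "(\<Sum>i. (if i = n then 1 else (0::real))\<^sup>2) = 1"
    using sums_single[of n "\<lambda>i. 1 :: real"] by (simp add: sums_iff if_distrib[of "\<lambda>z. z\<^sup>2"] cong: if_cong)
  then show ?thesis using expansion_sqnorm[OF bern_expansion[OF assms]] by simp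
qed

text \<open>By \<open>bern_jump\<close> and the periodicity of the trigonometric features, the
  functional is 1 on \<open>bern n\<close> and 0 on every other feature. In particular this
  coefficient is determined by \<open>f\<close>.\<close>

lemma mean_deriv_eq_coeff:
  assumes a: "expansion a f" and n: "n \<in> T" and per: "\<And>j. tg (Suc \<alpha> - n) j 1 = tg (Suc \<alpha> - n) j 0"
  shows "mean_deriv n f = a n"
proof -
  have n\<alpha>: "n \<le> \<alpha>" using n T by auto
  have "dfeat n i 1 - dfeat n i 0 = (if i = n then 1 else 0)" for i
  proof (cases "i \<in> T \<and> n \<le> i")
    case True
    then have "Suc i - n \<ge> 1" "Suc i - n = 1 \<longleftrightarrow> i = n" by auto
    then show ?thesis using True T bern_jump[of "Suc i - n"] by (auto simp: dfeat_def)
  next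
    case False
    then have "i \<noteq> n" using n by auto
    moreover have "dfeat n i 1 = dfeat n i 0"
      using False per by (auto simp: dfeat_def le_Suc_eq)
    ultimately show ?thesis by simp
  qed
  then have "(\<lambda>i. a i * (dfeat n i 1 - dfeat n i 0)) = (\<lambda>i. if i = n then a i else 0)" by auto
  with expansion_mean_deriv[OF a n\<alpha>] sums_single[of n a] show ?thesis using sums_unique2 by metis
qed

text \<open>A coefficient is bounded by the norm, and \<open>bern n\<close> has coefficient 1 and
  norm at most 1, so \<open>represented_by_unit\<close> applies.\<close>

lemma bern_represents:
  assumes n: "n \<in> T" and per: "\<And>j. tg (Suc \<alpha> - n) j 1 = tg (Suc \<alpha> - n) j 0" and f: "f \<in> E"
  shows "ip (rk {0..1} ker) f (restr {0..1} (bern n)) = mean_deriv n f"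
proof (rule represented_by_unit[OF psd bern_elems[OF n] bern_sqnorm[OF n] _ _ _ _ f])
  have n\<alpha>: "n \<le> \<alpha>" using n T by auto
  show "mean_deriv n (\<lambda>x. f x + g x) = mean_deriv n f + mean_deriv n g" if "f \<in> E" "g \<in> E" for f g
    using that n\<alpha> by (rule mean_deriv_add)
  show "mean_deriv n (\<lambda>x. c * f x) = c * mean_deriv n f" if "f \<in> E" for c f
    using that n\<alpha> by (rule mean_deriv_scale)
  show "mean_deriv n (restr {0..1} (bern n)) = 1"
    using mean_deriv_eq_coeff[OF bern_expansion[OF n] n per] by simp
  show "(mean_deriv n f)\<^sup>2 \<le> N f" if f: "f \<in> E" for f
  proof -
    obtain a where a: "expansion a f" "(\<Sum>i. (a i)\<^sup>2) \<le> N f" using ex_expansion[OF f] by blast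
    have "(\<Sum>i\<in>{n}. (a i)\<^sup>2) \<le> (\<Sum>i. (a i)\<^sup>2)"
      using a(1) by (intro sum_le_suminf) (auto simp: expansion_def)
    then show ?thesis using a mean_deriv_eq_coeff[OF a(1) n per] by simp
  qed
qed

end

section \<open>The univariate kernels in terms of cosine series\<close>

text \<open>The factors of \<open>pi\<close> in the denominators of \<open>per\<close> and
  \<open>hcos\<close> come from differentiating cosines and fit the Sobolev norm;
  \<open>K_cos_eq\<close> and \<open>K_kor_cos_eq\<close> convert to the kernels without
  them.\<close>

definition per :: "nat \<Rightarrow> real \<Rightarrow> real \<Rightarrow> real" where
  "per \<alpha> x y = (\<Sum>i. 2 * cos (2 * pi * real (Suc i) * (x - y)) / (2 * pi * real (Suc i)) ^ (2 * \<alpha>))"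

definition hcos :: "nat \<Rightarrow> real \<Rightarrow> real \<Rightarrow> real" where
  "hcos \<alpha> x y = (\<Sum>i. 2 * (cos (pi * real (Suc i) * x) * cos (pi * real (Suc i) * y)) / (pi * real (Suc i)) ^ (2 * \<alpha>))"

lemma summable_bounded_over_power:
  assumes "\<alpha> \<ge> 1" "a > 0" "\<And>i. \<bar>c i\<bar> \<le> B"
  shows "summable (\<lambda>i. c i / (a * real (Suc i)) ^ (2 * \<alpha>))"
proof (rule summable_comparison_test'[where N = 0])
  show "summable (\<lambda>i. B * (1 / (a * real (Suc i)) ^ (2 * \<alpha>)))"
    using assms(1) by (intro summable_mult summable_inverse_power) simp
  show "norm (c i / (a * real (Suc i)) ^ (2 * \<alpha>)) \<le> B * (1 / (a * real (Suc i)) ^ (2 * \<alpha>))" for i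
    using divide_right_mono[OF assms(3)[of i], of "(a * real (Suc i)) ^ (2 * \<alpha>)"] assms(2) by simp
qed

lemma per_summable: "\<alpha> \<ge> 1 \<Longrightarrow> summable (\<lambda>i. 2 * cos (2 * pi * real (Suc i) * z) / (2 * pi * real (Suc i)) ^ (2 * \<alpha>))"
  by (rule summable_bounded_over_power[where B = 2]) (simp_all add: abs_mult)

lemma hcos_summable: "\<alpha> \<ge> 1 \<Longrightarrow>
    summable (\<lambda>i. 2 * (cos (pi * real (Suc i) * x) * cos (pi * real (Suc i) * y)) / (pi * real (Suc i)) ^ (2 * \<alpha>))"
proof (rule summable_bounded_over_power[where B = 2])
  show "\<bar>2 * (cos (pi * real (Suc i) * x) * cos (pi * real (Suc i) * y))\<bar> \<le> 2" for i
    unfolding abs_mult using mult_le_one[of "\<bar>cos (pi * real (Suc i) * x)\<bar>" "\<bar>cos (pi * real (Suc i) * y)\<bar>"] by simp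
qed auto

lemma fourier_even_bern:
  assumes "\<alpha> \<ge> 1" "z \<in> {0..1}"
  shows "(\<Sum>i. 2 * cos (2 * pi * real (Suc i) * z) / (2 * pi * real (Suc i)) ^ (2 * \<alpha>)) = (-1) ^ (\<alpha> + 1) * bern (2 * \<alpha>) z"
proof -
  have "fourier_term (2 * \<alpha>) i z = (-1) ^ (\<alpha> + 1) * (2 * cos (2 * pi * real (Suc i) * z) / (2 * pi * real (Suc i)) ^ (2 * \<alpha>))" for i
  proof -
    have "cos (2 * pi * real (Suc i) * z - real (2 * \<alpha>) * pi / 2) = (-1) ^ \<alpha> * cos (2 * pi * real (Suc i) * z)"
      by (simp add: cos_diff mult.commute[of _ pi])
    then show ?thesis unfolding fourier_term_def by simp
  qed
  then have "fourier_sum (2 * \<alpha>) z = (-1) ^ (\<alpha> + 1) * (\<Sum>i. 2 * cos (2 * pi * real (Suc i) * z) / (2 * pi * real (Suc i)) ^ (2 * \<alpha>))"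
    unfolding fourier_sum_def using suminf_mult[OF per_summable[OF assms(1)], of "(-1) ^ (\<alpha> + 1)" z] by simp
  moreover have "fourier_sum (2 * \<alpha>) z = bern (2 * \<alpha>) z" using assms by (intro fourier_bern) auto
  ultimately show ?thesis by (simp flip: mult.assoc power_add power_mult_distrib)
qed

lemma per_eq_bern:
  assumes "\<alpha> \<ge> 1" "x \<in> {0..1}" "y \<in> {0..1}"
  shows "per \<alpha> x y = (-1) ^ (\<alpha> + 1) * bern (2 * \<alpha>) \<bar>x - y\<bar>"
proof -
  have "cos (2 * pi * real (Suc i) * (x - y)) = cos (2 * pi * real (Suc i) * \<bar>x - y\<bar>)" for i
  proof (cases "x \<ge> y")
    case False
    then have "\<bar>x - y\<bar> = - (x - y)" by linarith
    then show ?thesis by (simp only: mult_minus_right cos_minus)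
  qed simp
  then have "per \<alpha> x y = (\<Sum>i. 2 * cos (2 * pi * real (Suc i) * \<bar>x - y\<bar>) / (2 * pi * real (Suc i)) ^ (2 * \<alpha>))"
    by (simp only: per_def)
  also have "\<dots> = (-1) ^ (\<alpha> + 1) * bern (2 * \<alpha>) \<bar>x - y\<bar>"
    by (rule fourier_even_bern[OF assms(1)]) (use assms in \<open>auto simp: abs_le_iff\<close>)
  finally show ?thesis .
qed

lemma K_sob_eq:
  assumes "\<alpha> \<ge> 1" "x \<in> {0..1}" "y \<in> {0..1}"
  shows "K_sob \<alpha> x y = (\<Sum>\<tau>\<le>\<alpha>. bern \<tau> x * bern \<tau> y) + per \<alpha> x y"
proof -
  have "(\<Sum>\<tau>\<le>\<alpha>. bern \<tau> x * bern \<tau> y) = 1 + (\<Sum>\<tau>=1..\<alpha>. bern \<tau> x * bern \<tau> y)"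
    by (simp add: sum.atMost_shift sum.atLeast1_atMost_eq)
  then show ?thesis
    unfolding per_eq_bern[OF assms] K_sob_def by (simp add: bern_def power2_eq_square)
qed

lemma K_cos_eq: "\<alpha> \<ge> 1 \<Longrightarrow> K_cos \<alpha> x y = 1 + pi ^ (2 * \<alpha>) * hcos \<alpha> x y"
  unfolding K_cos_def hcos_def
  by (subst suminf_mult[OF hcos_summable, symmetric]) (simp_all add: power_mult_distrib mult.assoc)

lemma K_kor_cos_eq:
  assumes "\<alpha> \<ge> 1"
  shows "K_kor_cos \<alpha> x y = 1 + ((2 * pi) ^ (2 * \<alpha>) / 2 * per \<alpha> x y + pi ^ (2 * \<alpha>) / 2 * hcos \<alpha> x y)"
proof -
  have "(2 * pi) ^ (2 * \<alpha>) / 2 * per \<alpha> x y + pi ^ (2 * \<alpha>) / 2 * hcos \<alpha> x y =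
    (\<Sum>i. (2 * pi) ^ (2 * \<alpha>) / 2 * (2 * cos (2 * pi * real (Suc i) * (x - y)) / (2 * pi * real (Suc i)) ^ (2 * \<alpha>)) +
      pi ^ (2 * \<alpha>) / 2 * (2 * (cos (pi * real (Suc i) * x) * cos (pi * real (Suc i) * y)) / (pi * real (Suc i)) ^ (2 * \<alpha>)))"
    unfolding per_def hcos_def
    using per_summable[OF assms] hcos_summable[OF assms]
    by (simp only: suminf_mult[symmetric] suminf_add summable_mult)
  also have "\<dots> = (\<Sum>k. 1 / real (Suc k) ^ (2 * \<alpha>) *
            (cos (2 * pi * real (Suc k) * (x - y)) + cos (pi * real (Suc k) * x) * cos (pi * real (Suc k) * y)))"
  proof (rule suminf_cong)
    have *: "w ^ n / 2 * (2 * p / (w * k) ^ n) + v ^ n / 2 * (2 * q / (v * k) ^ n) = 1 / k ^ n * (p + q)"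
      if "w > 0" "v > 0" "k > 0" for w v k p q :: real and n
      using that by (simp add: power_mult_distrib field_simps)
    show "(2 * pi) ^ (2 * \<alpha>) / 2 * (2 * cos (2 * pi * real (Suc i) * (x - y)) / (2 * pi * real (Suc i)) ^ (2 * \<alpha>)) +
      pi ^ (2 * \<alpha>) / 2 * (2 * (cos (pi * real (Suc i) * x) * cos (pi * real (Suc i) * y)) / (pi * real (Suc i)) ^ (2 * \<alpha>))
      = 1 / real (Suc i) ^ (2 * \<alpha>) *
            (cos (2 * pi * real (Suc i) * (x - y)) + cos (pi * real (Suc i) * x) * cos (pi * real (Suc i) * y))" for i
      by (rule *) simp_all
  qed
  finally show ?thesis by (simp add: K_kor_cos_def)
qed

lemma sqrt2_mult: "sqrt 2 * a * (sqrt 2 * b) = 2 * (a * b)"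
proof -
  have "sqrt 2 * a * (sqrt 2 * b) = (sqrt 2 * sqrt 2) * (a * b)" by (simp only: mult_ac)
  then show ?thesis by simp
qed

text \<open>The phases compensate the shift in \<open>tg \<alpha>\<close>, such that the features are \<open>cos\<close> and \<open>sin\<close>, alternatingly for the full
  periods, and \<open>cos\<close> for the half periods.\<close>

definition full_freq :: "nat \<Rightarrow> real" where
  "full_freq j = 2 * pi * real (Suc (j div 2))"

definition full_phase :: "nat \<Rightarrow> nat \<Rightarrow> real" where
  "full_phase \<alpha> j = (if even j then 0 else pi / 2) - real \<alpha> * pi / 2"

definition half_freq :: "nat \<Rightarrow> real" where
  "half_freq j = pi * real (Suc j)"

definition half_phase :: "nat \<Rightarrow> nat \<Rightarrow> real" where
  "half_phase \<alpha> j = - (real \<alpha> * pi / 2)"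

lemma full_bern_trig: "\<alpha> \<ge> 1 \<Longrightarrow> T \<subseteq> {..\<alpha>} \<Longrightarrow> bern_trig \<alpha> full_freq T"
proof
  fix j
  have "Suc j \<le> 2 * Suc (j div 2)" by presburger
  then have "real (Suc j) \<le> 2 * real (Suc (j div 2))" using of_nat_mono by fastforce
  also have "\<dots> \<le> full_freq j" using pi_ge_two unfolding full_freq_def
    by (intro mult_right_mono) auto
  finally show "real (Suc j) \<le> full_freq j" .
qed

lemma half_bern_trig: "\<alpha> \<ge> 1 \<Longrightarrow> T \<subseteq> {..\<alpha>} \<Longrightarrow> bern_trig \<alpha> half_freq T"
proof
  fix j
  have "1 * real (Suc j) \<le> pi * real (Suc j)" using pi_ge_two by (intro mult_right_mono) auto
  then show "real (Suc j) \<le> half_freq j" by (simp add: half_freq_def)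
qed

abbreviation full_ker :: "nat \<Rightarrow> nat set \<Rightarrow> real \<Rightarrow> real \<Rightarrow> real" where
  "full_ker \<alpha> \<equiv> bern_trig.ker \<alpha> full_freq (full_phase \<alpha>)"

abbreviation half_ker :: "nat \<Rightarrow> nat set \<Rightarrow> real \<Rightarrow> real \<Rightarrow> real" where
  "half_ker \<alpha> \<equiv> bern_trig.ker \<alpha> half_freq (half_phase \<alpha>)"

lemma full_tg_periodic:
  "bern_trig.tg full_freq (full_phase \<alpha>) n j 1 = bern_trig.tg full_freq (full_phase \<alpha>) n j 0"
proof -
  interpret bern_trig 1 full_freq "full_phase \<alpha>" "{}" by (rule full_bern_trig) auto
  have "cos (2 * pi * real (Suc m) * 1 - t - s) = cos (- t - s)" for m t s
  proof -
    have "2 * pi * real (Suc m) * 1 - t - s = (- t - s) + 2 * pi * of_int (int (Suc m))" by simp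
    then have "cos (2 * pi * real (Suc m) * 1 - t - s) = cos ((- t - s) + 2 * pi * of_int (int (Suc m)))"
      by (rule arg_cong)
    also have "\<dots> = cos (- t - s)" unfolding cos_add cos_int_2pin sin_int_2pin by simp
    finally show ?thesis .
  qed
  then show ?thesis unfolding tg_def full_freq_def by simp
qed

text \<open>The features \<open>2 * i\<close> and \<open>2 * i + 1\<close> are the cosine and the
  sine of one frequency; the addition theorem merges their products into
  \<open>cos (w * (x - y))\<close>.\<close>

lemma full_ker_eq:
  assumes "\<alpha> \<ge> 1" "T \<subseteq> {..\<alpha>}" "x \<in> {0..1}" "y \<in> {0..1}"
  shows "full_ker \<alpha> T x y = (\<Sum>\<tau>\<in>T. bern \<tau> x * bern \<tau> y) + per \<alpha> x y"
proof -
  interpret bern_trig \<alpha> full_freq "full_phase \<alpha>" T by (rule full_bern_trig) fact+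
  have "(\<lambda>i. sum (\<lambda>j. tg \<alpha> j x * tg \<alpha> j y) {i * 2..<i * 2 + 2}) sums (\<Sum>j. tg \<alpha> j x * tg \<alpha> j y)"
    by (rule sums_group[OF summable_sums[OF ker_eq(1)[OF assms(3,4)]]]) simp
  moreover have "sum (\<lambda>j. tg \<alpha> j x * tg \<alpha> j y) {i * 2..<i * 2 + 2} =
      2 * cos (2 * pi * real (Suc i) * (x - y)) / (2 * pi * real (Suc i)) ^ (2 * \<alpha>)" for i
  proof -
    define w where "w = 2 * pi * real (Suc i)"
    have e: "tg \<alpha> (i * 2) z = sqrt 2 * (cos (w * z) / w ^ \<alpha>)" for z
      by (simp add: tg_def full_freq_def full_phase_def w_def)
    have o: "tg \<alpha> (Suc (i * 2)) z = sqrt 2 * (sin (w * z) / w ^ \<alpha>)" for z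
    proof -
      have "w * z - full_phase \<alpha> (Suc (i * 2)) - real \<alpha> * pi / 2 = w * z - pi / 2"
        by (simp add: full_phase_def)
      moreover have "cos (w * z - pi / 2) = sin (w * z)" by (simp add: cos_diff)
      moreover have "full_freq (Suc (i * 2)) = w" by (simp add: full_freq_def w_def)
      ultimately show ?thesis by (simp only: tg_def)
    qed
    have "{i * 2..<i * 2 + 2} = {i * 2, Suc (i * 2)}" by auto
    then have "sum (\<lambda>j. tg \<alpha> j x * tg \<alpha> j y) {i * 2..<i * 2 + 2} =
        2 * (cos (w * x) * cos (w * y) + sin (w * x) * sin (w * y)) / (w ^ \<alpha> * w ^ \<alpha>)"
      by (simp add: e o add_divide_distrib sqrt2_mult)
    also have "\<dots> = 2 * cos (w * (x - y)) / w ^ (2 * \<alpha>)"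
      by (simp add: right_diff_distrib cos_diff power_even_eq power2_eq_square)
    finally show ?thesis by (simp only: w_def)
  qed
  ultimately have "(\<Sum>j. tg \<alpha> j x * tg \<alpha> j y) = per \<alpha> x y" by (simp add: per_def sums_iff)
  then show ?thesis using ker_eq(2)[OF assms(3,4)] by simp
qed

lemma half_tg: "\<alpha> \<ge> 1 \<Longrightarrow> bern_trig.tg half_freq (half_phase \<alpha>) \<alpha> j z =
    sqrt 2 * (cos (pi * real (Suc j) * z) / (pi * real (Suc j)) ^ \<alpha>)"
  using bern_trig.tg_def[OF half_bern_trig[of \<alpha> "{}"], of "half_phase \<alpha>" \<alpha> j z]
  by (simp add: half_freq_def half_phase_def)

lemma half_ker_eq:
  assumes "\<alpha> \<ge> 1" "T \<subseteq> {..\<alpha>}" "x \<in> {0..1}" "y \<in> {0..1}"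
  shows "half_ker \<alpha> T x y = (\<Sum>\<tau>\<in>T. bern \<tau> x * bern \<tau> y) + hcos \<alpha> x y"
proof -
  interpret bern_trig \<alpha> half_freq "half_phase \<alpha>" T by (rule half_bern_trig) fact+
  have "tg \<alpha> i x * tg \<alpha> i y =
    2 * (cos (pi * real (Suc i) * x) * cos (pi * real (Suc i) * y)) / (pi * real (Suc i)) ^ (2 * \<alpha>)" for i
    by (simp add: half_tg[OF assms(1)] power_even_eq power2_eq_square)
  then show ?thesis using ker_eq(2)[OF assms(3,4)] by (simp add: hcos_def)
qed

section \<open>The subspaces of the Sobolev space\<close>

lemma H_sob_eq:
  assumes "\<alpha> \<ge> 1"
  shows "H_sob \<alpha> = rk {0..1} (full_ker \<alpha> {..\<alpha>})"
proof -
  interpret bern_trig \<alpha> full_freq "full_phase \<alpha>" "{..\<alpha>}" by (rule full_bern_trig) (use assms in auto)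
  have "rkhs {0..1} (K_sob \<alpha>) = rkhs {0..1} (full_ker \<alpha> {..\<alpha>})"
    using assms by (intro rkhs_cong) (simp add: K_sob_eq full_ker_eq)
  then show ?thesis by (simp add: rkhs_eq_rk psd_ker)
qed

lemma is_rkhs_mean_deriv_zero:
  assumes \<alpha>: "\<alpha> \<ge> 1" and I: "I \<subseteq> {..\<alpha>}"
    and P: "\<And>f. P f \<longleftrightarrow> (\<forall>n\<in>I. mean_deriv n f = 0)"
  shows "is_rkhs {0..1} (full_ker \<alpha> ({..\<alpha>} - I)) (subspace_where (H_sob \<alpha>) P)"
proof -
  interpret bern_trig \<alpha> full_freq "full_phase \<alpha>" "{..\<alpha>}" by (rule full_bern_trig) (use \<alpha> in auto)
  note per = full_tg_periodic
  define e where "e n = restr {0..1} (bern n)" for n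
  have fin: "finite I" using I finite_subset by blast
  have e: "e n \<in> elems (rk {0..1} ker)" if "n \<in> I" for n
    using that I bern_elems[of n] by (auto simp: e_def)
  have rep: "ip (rk {0..1} ker) f (e n) = mean_deriv n f" if "f \<in> elems (rk {0..1} ker)" "n \<in> I" for f n
    unfolding e_def using that I by (intro bern_represents per) auto
  have orth: "ip (rk {0..1} ker) (e m) (e n) = (if m = n then 1 else 0)" if "m \<in> I" "n \<in> I" for m n
  proof -
    have "mean_deriv n (restr {0..1} (bern m)) = (if n = m then 1 else 0)"
      using that I by (intro mean_deriv_eq_coeff[OF bern_expansion] per) auto
    then show ?thesis using rep[OF e] that by (simp add: e_def)
  qed
  have "is_rkhs {0..1} (\<lambda>x y. ker x y - (\<Sum>i\<in>I. e i x * e i y)) (subspace_where (rk {0..1} ker) P)"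
    by (rule is_rkhs_orthogonal_complement[OF is_rkhs_rk fin e orth]) (simp_all add: P rep)
  moreover have "ker x y - (\<Sum>i\<in>I. e i x * e i y) = full_ker \<alpha> ({..\<alpha>} - I) x y"
    if "x \<in> {0..1}" "y \<in> {0..1}" for x y
  proof -
    have "(\<Sum>\<tau>\<in>{..\<alpha>} - I. bern \<tau> x * bern \<tau> y) = (\<Sum>\<tau>\<le>\<alpha>. bern \<tau> x * bern \<tau> y) - (\<Sum>\<tau>\<in>I. bern \<tau> x * bern \<tau> y)"
      by (rule sum_diff) (use I in auto)
    then show ?thesis using that \<alpha> by (simp add: full_ker_eq e_def restr_def)
  qed
  ultimately show ?thesis
    using is_rkhs_cong[of "{0..1}" "\<lambda>x y. ker x y - (\<Sum>i\<in>I. e i x * e i y)" "full_ker \<alpha> ({..\<alpha>} - I)"]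
    by (simp add: H_sob_eq[OF \<alpha>])
qed

text \<open>Boundary values of the derivative of order \<tau> belong to the degree
  \<open>Suc \<tau>\<close>, so odd orders become even degrees. The offset \<open>k\<close> is 0 for
  the condition \<open>odd\<close> and 1 for \<open>odd+\<alpha>\<close>.\<close>

lemma odd_conditions:
  "(\<forall>\<tau>. odd \<tau> \<and> \<tau> + Suc k \<le> \<alpha> \<longrightarrow> deriv01 \<tau> f 0 = deriv01 \<tau> f 1) \<longleftrightarrow>
    (\<forall>n\<in>{n. even n \<and> 2 \<le> n \<and> n + k \<le> \<alpha>}. mean_deriv n f = 0)" (is "?L \<longleftrightarrow> ?R")
proof
  assume L: ?L
  show ?R
  proof
    fix n assume n: "n \<in> {n. even n \<and> 2 \<le> n \<and> n + k \<le> \<alpha>}"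
    then have "odd (n - 1) \<and> n - 1 + Suc k \<le> \<alpha>" by auto
    with L have "deriv01 (n - 1) f 0 = deriv01 (n - 1) f 1" by blast
    then show "mean_deriv n f = 0" using n by (simp add: mean_deriv_def)
  qed
next
  assume R: ?R
  show ?L
  proof (intro allI impI)
    fix \<tau> assume "odd \<tau> \<and> \<tau> + Suc k \<le> \<alpha>"
    then have "Suc \<tau> \<in> {n. even n \<and> 2 \<le> n \<and> n + k \<le> \<alpha>}" by (auto elim!: oddE)
    with R have "mean_deriv (Suc \<tau>) f = 0" by blast
    then show "deriv01 \<tau> f 0 = deriv01 \<tau> f 1" by (simp add: mean_deriv_def)
  qed
qed

lemma K_sob_odd_eq:
  assumes "\<alpha> \<ge> 1" "x \<in> {0..1}" "y \<in> {0..1}"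
  shows "K_sob_odd \<alpha> x y = full_ker \<alpha> ({..\<alpha>} - {n. even n \<and> 2 \<le> n \<and> n \<le> \<alpha>}) x y"
  unfolding K_sob_odd_def
  by (rule reproducing_kernel_eq[OF is_rkhs_mean_deriv_zero assms(2,3)])
    (use assms odd_conditions[of 0 \<alpha>] in auto)

lemma K_sob_odd_plus_eq:
  assumes "\<alpha> \<ge> 1" "x \<in> {0..1}" "y \<in> {0..1}"
  shows "K_sob_odd_plus \<alpha> x y = full_ker \<alpha> ({..\<alpha>} - {n. even n \<and> 2 \<le> n \<and> n + 1 \<le> \<alpha>}) x y"
  unfolding K_sob_odd_plus_def
  by (rule reproducing_kernel_eq[OF is_rkhs_mean_deriv_zero assms(2,3)])
    (use assms odd_conditions[of 1 \<alpha>] in auto)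

definition bdry0 :: "nat \<Rightarrow> (real \<Rightarrow> real) \<Rightarrow> bool" where
  "bdry0 \<alpha> f \<longleftrightarrow> (\<forall>\<tau>. odd \<tau> \<and> \<tau> + 1 \<le> \<alpha> \<longrightarrow> deriv01 \<tau> f 0 = 0 \<and> deriv01 \<tau> f 1 = 0)"

text \<open>Each odd order imposes two conditions, which are not given by orthonormal representers.
  Existence of the kernel therefore rests on bounded functionals and the Riesz representation, and
  no formula results.\<close>

lemma is_rkhs_bdry0:
  assumes \<alpha>: "\<alpha> \<ge> 1"
  shows "is_rkhs {0..1} (K_sob_odd_bdry0 \<alpha>) (subspace_where (H_sob \<alpha>) (bdry0 \<alpha>))"
proof -
  interpret bern_trig \<alpha> full_freq "full_phase \<alpha>" "{..\<alpha>}" by (rule full_bern_trig) (use \<alpha> in auto)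
  let ?V = "rk {0..1} ker"
  let ?F = "\<Union>\<tau>\<in>{\<tau>. odd \<tau> \<and> \<tau> < \<alpha>}. {\<lambda>f. deriv01 \<tau> f 0, \<lambda>f. deriv01 \<tau> f 1}"
  let ?S = "subspace_where (H_sob \<alpha>) (bdry0 \<alpha>)"
  have F: "\<exists>\<tau> x. \<tau> < \<alpha> \<and> x \<in> {0..1} \<and> L = (\<lambda>f. deriv01 \<tau> f x)" if L: "L \<in> ?F" for L
  proof -
    from L obtain \<tau> where "\<tau> < \<alpha>" "L = (\<lambda>f. deriv01 \<tau> f 0) \<or> L = (\<lambda>f. deriv01 \<tau> f 1)" by auto
    then show ?thesis by (metis atLeastAtMost_iff order_refl zero_le_one)
  qed
  have S: "?S = subspace_where ?V (bdry0 \<alpha>)" by (simp add: H_sob_eq[OF \<alpha>])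
  have h: "hilbert_fun_space {0..1} ?S"
    unfolding S
  proof (rule hilbert_subspace_where[OF hilbert_fun_space_rk, where F = ?F])
    show "bdry0 \<alpha> f \<longleftrightarrow> (\<forall>L\<in>?F. L f = 0)" for f by (auto simp: bdry0_def)
    fix L assume "L \<in> ?F"
    then obtain \<tau> x where L: "\<tau> < \<alpha>" "x \<in> {0..1}" "L = (\<lambda>f. deriv01 \<tau> f x)" using F by blast
    show "L (\<lambda>x. f x + g x) = L f + L g" if "f \<in> elems ?V" "g \<in> elems ?V" for f g
      using that L deriv01_add by simp
    show "L (\<lambda>x. c * f x) = c * L f" if "f \<in> elems ?V" for c f
      using that L deriv01_scale by simp
    show "\<exists>C. \<forall>f\<in>elems ?V. \<bar>L f\<bar> \<le> C * fnorm ?V f"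
      using L deriv01_bounded by simp
  qed
  have "\<exists>C. \<forall>f\<in>elems ?S. \<bar>f x\<bar> \<le> C * fnorm ?S f" if "x \<in> {0..1}" for x
  proof (intro exI ballI)
    fix f assume "f \<in> elems ?S"
    then have "f \<in> E" "bdry0 \<alpha> f" by (auto simp: S subspace_where_simps)
    then show "\<bar>f x\<bar> \<le> sqrt (ker x x) * fnorm ?S f"
      using pointwise_le[OF _ that] by (simp add: S subspace_where_simps)
  qed
  from hilbert_fun_space_has_kernel[OF h this] obtain K where K: "is_rkhs {0..1} K ?S" .
  have "K_sob_odd_bdry0 \<alpha> = reproducing_kernel {0..1} ?S"
    by (simp add: K_sob_odd_bdry0_def bdry0_def[abs_def])
  then have "is_rkhs {0..1} (K_sob_odd_bdry0 \<alpha>) ?S \<longleftrightarrow> is_rkhs {0..1} K ?S"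
    using reproducing_kernel_eq[OF K] by (intro is_rkhs_cong) simp
  then show ?thesis using K by simp
qed

section \<open>Comparison of the univariate kernels\<close>

text \<open>Converse of \<open>dominated_rank_one\<close>: with \<open>t = ev v f\<close>, the bound
  of \<open>t * t\<close> by \<open>c\<close> times the form and
  \<open>2 * c * t \<le> t * t + c * c\<close> bound the supremum by \<open>c\<close>.\<close>

lemma rank_one_elems:
  assumes K: "psd X K" and d: "dominated X (\<lambda>x y. f x * f y) K"
  shows "restr X f \<in> rk_elems X K"
proof -
  interpret psd_kernel X K by unfold_locales (rule K)
  obtain c where c: "c \<ge> 1" "\<forall>v\<in>functionals X. qf (\<lambda>x y. f x * f y) v v \<le> c * qf K v v"
    by (rule dominatedE[OF d K])
  show ?thesis
  proof (rule elemsI)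
    fix v assume v: "v \<in> functionals X"
    define t where "t = ev v f"
    have "t * t \<le> c * qf K v v" using bspec[OF c(2) v] by (simp add: qf_prod t_def)
    moreover have "2 * c * t - t * t \<le> c * c" using zero_le_power2[of "t - c"] by (simp add: power2_eq_square algebra_simps)
    ultimately have "c * (2 * t - qf K v v) \<le> c * c" by (simp add: algebra_simps)
    then show "2 * ev v (restr X f) - qf K v v \<le> c" using c(1) v by (simp add: t_def)
  qed (simp add: restr_def)
qed

lemma elems_rank_one:
  assumes K: "psd X K" and f: "restr X f \<in> rk_elems X K"
  shows "dominated X (\<lambda>x y. f x * f y) K"
  using dominated_rank_one[OF K f] dominated_cong[of X "\<lambda>x y. restr X f x * restr X f y" "\<lambda>x y. f x * f y" K K]
  by (simp add: restr_def)

lemma restr_elems_sum: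
  assumes K: "psd X K" and "finite I" "\<And>i. i \<in> I \<Longrightarrow> c i \<noteq> 0 \<Longrightarrow> restr X (f i) \<in> rk_elems X K"
  shows "restr X (\<lambda>x. \<Sum>i\<in>I. c i * f i x) \<in> rk_elems X K"
proof -
  interpret psd_kernel X K by unfold_locales (rule K)
  have "(\<lambda>x. \<Sum>i\<in>I. c i * restr X (f i) x) \<in> elems (rk X K)"
    unfolding elems_rk
  proof (rule space.sum_mem[unfolded elems_rk, OF assms(2)])
    fix i assume "i \<in> I"
    then show "(\<lambda>x. c i * restr X (f i) x) \<in> E"
      using assms(3)[of i] zero_elems by (cases "c i = 0") (auto intro: scale_elems)
  qed
  moreover have "(\<lambda>x. \<Sum>i\<in>I. c i * restr X (f i) x) = restr X (\<lambda>x. \<Sum>i\<in>I. c i * f i x)"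
    by (auto simp: restr_def)
  ultimately show ?thesis by simp
qed

lemma restr_elems_add:
  assumes "psd X K" "restr X f \<in> rk_elems X K" "restr X g \<in> rk_elems X K"
  shows "restr X (\<lambda>x. a * f x + b * g x) \<in> rk_elems X K"
proof -
  interpret psd_kernel X K by unfold_locales (rule assms)
  have "(\<lambda>x. a * restr X f x + b * restr X g x) \<in> E" by (intro add_elems scale_elems assms)
  moreover have "(\<lambda>x. a * restr X f x + b * restr X g x) = restr X (\<lambda>x. a * f x + b * g x)"
    by (auto simp: restr_def)
  ultimately show ?thesis by simp
qed

lemma dominated_sum_rank_one:
  assumes "psd X K" "finite I" "\<And>i. i \<in> I \<Longrightarrow> restr X (f i) \<in> rk_elems X K"
  shows "dominated X (\<lambda>x y. \<Sum>i\<in>I. f i x * f i y) K"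
  using assms by (intro dominated_sum elems_rank_one) auto

lemma sum_rank_one_elems:
  assumes "finite I" "i \<in> I"
  shows "restr X (f i) \<in> rk_elems X (\<lambda>x y. \<Sum>i\<in>I. f i x * f i y)"
proof (rule rank_one_elems)
  show "psd X (\<lambda>x y. \<Sum>i\<in>I. f i x * f i y)" by (intro psd_sum psd_rank_one assms)
  show "dominated X (\<lambda>x y. f i x * f i y) (\<lambda>x y. \<Sum>i\<in>I. f i x * f i y)"
  proof (rule dominatedI[of _ _ 1])
    fix v show "qf (\<lambda>x y. f i x * f i y) v v \<le> 1 * qf (\<lambda>x y. \<Sum>i\<in>I. f i x * f i y) v v"
      using member_le_sum[of i I "\<lambda>i. ev v (f i) * ev v (f i)"] assms by (simp add: qf_prod qf_sum)
  qed
qed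

text \<open>Substitution in a triangular system. The entries with odd row and even column vanish, so
  the odd indices form a system of their own.\<close>

lemma triangular_elems:
  fixes q :: "nat \<Rightarrow> real \<Rightarrow> real"
  assumes K: "psd X K"
    and q: "\<And>i x. odd i \<Longrightarrow> i < n \<Longrightarrow> q i x = (\<Sum>j\<le>i. A i j * p j x)"
    and A: "\<And>i j. odd i \<Longrightarrow> even j \<Longrightarrow> j \<le> i \<Longrightarrow> A i j = 0" and Ai: "\<And>i. odd i \<Longrightarrow> A i i \<noteq> 0"
    and m: "\<And>i. odd i \<Longrightarrow> i < n \<Longrightarrow> restr X (q i) \<in> rk_elems X K"
  shows "odd i \<Longrightarrow> i < n \<Longrightarrow> restr X (p i) \<in> rk_elems X K"
proof (induction i rule: less_induct)
  case (less i)
  have "restr X (\<lambda>x. \<Sum>j\<in>{..<i}. A i j * p j x) \<in> rk_elems X K"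
  proof (rule restr_elems_sum[OF K])
    fix j assume "j \<in> {..<i}" "A i j \<noteq> 0"
    then have "odd j" "j < i" using A[OF less.prems(1), of j] by (auto intro: ccontr)
    then show "restr X (p j) \<in> rk_elems X K" using less by simp
  qed simp
  from restr_elems_add[OF K m[OF less.prems] this, of "1 / A i i" "- (1 / A i i)"]
  have "restr X (\<lambda>x. 1 / A i i * q i x + - (1 / A i i) * (\<Sum>j<i. A i j * p j x)) \<in> rk_elems X K" .
  moreover have "1 / A i i * q i x + - (1 / A i i) * (\<Sum>j<i. A i j * p j x) = p i x" for x
  proof -
    have "q i x = (\<Sum>j<i. A i j * p j x) + A i i * p i x"
      using q[OF less.prems, of x] by (simp add: lessThan_Suc_atMost[symmetric])
    then show ?thesis using Ai[OF less.prems(1)] by (simp add: field_simps)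
  qed
  ultimately show ?case by simp
qed

text \<open>Subtracting \<open>2 ^ Suc n\<close> times the value at \<open>t / 2\<close> from the
  value at \<open>t\<close> cancels the top coefficient and multiplies the others by nonzero
  constants, so induction on the degree applies. The top coefficient is then recovered at
  \<open>t = r\<close>.\<close>

lemma coefficients_elems:
  fixes w :: "nat \<Rightarrow> real \<Rightarrow> real"
  assumes K: "psd X K"
    and "\<And>t. \<bar>t\<bar> \<le> r \<Longrightarrow> restr X (\<lambda>x. \<Sum>j\<le>n. t ^ j * w j x) \<in> rk_elems X K" "r > 0" "j \<le> n"
  shows "restr X (w j) \<in> rk_elems X K"
  using assms(2-)
proof (induction n arbitrary: w j)
  case 0
  then show ?case using "0.prems"(1)[of 0] by simp
next
  case (Suc n)
  let ?w = "\<lambda>j x. (1 - 2 ^ (Suc n - j)) * w j x"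
  have "restr X (\<lambda>x. \<Sum>j\<le>n. t ^ j * ?w j x) \<in> rk_elems X K" if t: "\<bar>t\<bar> \<le> r" for t
  proof -
    have t2: "\<bar>t / 2\<bar> \<le> r" using t by simp
    have "restr X (\<lambda>x. 1 * (\<Sum>j\<le>Suc n. t ^ j * w j x) + (- (2 ^ Suc n)) * (\<Sum>j\<le>Suc n. (t / 2) ^ j * w j x)) \<in> rk_elems X K"
      by (intro restr_elems_add[OF K] Suc.prems(1) t t2)
    moreover have "1 * (\<Sum>j\<le>Suc n. t ^ j * w j x) + (- (2 ^ Suc n)) * (\<Sum>j\<le>Suc n. (t / 2) ^ j * w j x) =
        (\<Sum>j\<le>n. t ^ j * ?w j x)" for x
    proof -
      have "2 ^ Suc n * ((t / 2) ^ j * w j x) = 2 ^ (Suc n - j) * (t ^ j * w j x)" if "j \<le> Suc n" for j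
      proof -
        have "(2::real) ^ Suc n = 2 ^ (Suc n - j) * 2 ^ j" using that by (simp flip: power_add del: power_Suc)
        then show ?thesis by (simp add: power_divide)
      qed
      then have "2 ^ Suc n * (\<Sum>j\<le>Suc n. (t / 2) ^ j * w j x) = (\<Sum>j\<le>Suc n. 2 ^ (Suc n - j) * (t ^ j * w j x))"
        unfolding sum_distrib_left by (intro sum.cong) auto
      moreover have "(\<Sum>j\<le>Suc n. t ^ j * ?w j x) =
          (\<Sum>j\<le>Suc n. t ^ j * w j x) - (\<Sum>j\<le>Suc n. 2 ^ (Suc n - j) * (t ^ j * w j x))"
        unfolding sum_subtractf[symmetric] by (intro sum.cong) (auto simp: algebra_simps)
      moreover have "(\<Sum>j\<le>Suc n. t ^ j * ?w j x) = (\<Sum>j\<le>n. t ^ j * ?w j x)" by simp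
      ultimately show ?thesis by (simp only: mult_minus_left mult_1)
    qed
    ultimately show ?thesis by simp
  qed
  from Suc.IH[of ?w, OF this Suc.prems(2)]
  have IH: "restr X (?w i) \<in> rk_elems X K" if "i \<le> n" for i using that by simp
  have low: "restr X (w i) \<in> rk_elems X K" if "i \<le> n" for i
  proof -
    have "(2::real) ^ (Suc n - i) \<noteq> 1" using that by (simp add: Suc_diff_le)
      (metis one_less_numeral_iff one_less_power semiring_norm(76) zero_less_Suc less_irrefl power_Suc)
    moreover have "restr X (\<lambda>x. (1 / (1 - 2 ^ (Suc n - i))) * ?w i x + 0 * ?w i x) \<in> rk_elems X K"
      by (intro restr_elems_add[OF K] IH that)
    ultimately show ?thesis by simp
  qed
  show ?case
  proof (cases "j \<le> n")
    case True
    then show ?thesis by (rule low)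
  next
    case False
    then have j: "j = Suc n" using Suc.prems by simp
    have "restr X (\<lambda>x. \<Sum>i\<le>n. r ^ i * w i x) \<in> rk_elems X K"
      by (intro restr_elems_sum[OF K]) (auto intro: low)
    from restr_elems_add[OF K Suc.prems(1)[of r] this, of "1 / r ^ Suc n" "- (1 / r ^ Suc n)"] Suc.prems(2)
    have "restr X (\<lambda>x. 1 / r ^ Suc n * (\<Sum>i\<le>Suc n. r ^ i * w i x) + - (1 / r ^ Suc n) * (\<Sum>i\<le>n. r ^ i * w i x)) \<in> rk_elems X K"
      by simp
    moreover have "1 / r ^ Suc n * (\<Sum>i\<le>Suc n. r ^ i * w i x) + - (1 / r ^ Suc n) * (\<Sum>i\<le>n. r ^ i * w i x) = w j x" for x
      using Suc.prems(2) by (simp add: j distrib_left del: power_Suc)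
    ultimately show ?thesis by simp
  qed
qed

text \<open>The symmetry about 1/2, read off the Fourier series, whose terms all vanish there;
  degree 1 precedes the range of \<open>fourier_bern\<close> and is treated directly.\<close>

lemma bern_half_odd:
  assumes "odd m"
  shows "bern m (1/2) = 0"
proof (cases "m = 1")
  case True
  then show ?thesis by (simp add: bern_1)
next
  case False
  with assms have m: "m \<ge> 2" by (cases m) auto
  have "cos (2 * pi * real (Suc i) * (1/2) - real m * pi / 2) = 0" for i
  proof -
    obtain k where k: "m = 2 * k + 1" using assms by (auto elim: oddE)
    have "cos (real m * pi / 2) = cos (real k * pi + pi / 2)" by (simp add: k field_simps)
    also have "\<dots> = 0" by (simp add: cos_add)
    finally have c: "cos (real m * pi / 2) = 0" .
    have "2 * pi * real (Suc i) * (1/2) = real (Suc i) * pi" by simp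
    then have "sin (2 * pi * real (Suc i) * (1/2)) = 0" by (simp only: sin_npi)
    then show ?thesis unfolding cos_diff c by simp
  qed
  then have "fourier_sum m (1/2) = 0" unfolding fourier_sum_def fourier_term_def by simp
  then show ?thesis using fourier_bern[OF m, of "1/2"] by simp
qed

text \<open>In terms of \<open>X = x - 1/2\<close> this is \<open>bern i (1/2 + X/2)\<close>, an odd polynomial for odd \<open>i\<close>.\<close>

definition ushift :: "nat \<Rightarrow> real \<Rightarrow> real" where
  "ushift i x = bern i (1/4 + x/2)"

lemma bern_centered: "bern i x = (\<Sum>j\<le>i. bern (i - j) (1/2) / fact j * (x - 1/2) ^ j)"
  using bern_add[of i "1/2" "x - 1/2"] by (simp add: mult.commute)

lemma ushift_centered: "ushift i x = (\<Sum>j\<le>i. bern (i - j) (1/2) / (2 ^ j * fact j) * (x - 1/2) ^ j)"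
proof -
  have "1/4 + x/2 = 1/2 + (x - 1/2) / 2" by (simp add: field_simps)
  then have "ushift i x = (\<Sum>j\<le>i. bern (i - j) (1/2) * (((x - 1/2) / 2) ^ j / fact j))"
    unfolding ushift_def by (simp only: bern_add)
  then show ?thesis by (simp add: power_divide)
qed

lemma bern_difference:
  "bern n (z - h) - bern n (z + h) = (\<Sum>j\<le>n. (if odd j then -2 / fact j else 0) * h ^ j * bern (n - j) z)"
proof -
  have "bern n (z - h) = (\<Sum>j\<le>n. bern (n - j) z * ((- h) ^ j / fact j))" using bern_add[of n z "- h"] by simp
  moreover have "bern n (z + h) = (\<Sum>j\<le>n. bern (n - j) z * (h ^ j / fact j))" by (rule bern_add)
  ultimately show ?thesis by (simp add: sum_subtractf[symmetric]) (intro sum.cong, auto)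
qed


subsection \<open>The full-period and the half-period kernel differ by an odd polynomial kernel\<close>

text \<open>A function of period 2, for arguments in [0, 2] a multiple of a Bernoulli polynomial.
  Each of \<open>per\<close> and \<open>hcos\<close> is a sum of two of its values.\<close>

definition half_cos_sum :: "nat \<Rightarrow> real \<Rightarrow> real" where
  "half_cos_sum \<alpha> w = (\<Sum>i. cos (pi * real (Suc i) * w) / (pi * real (Suc i)) ^ (2 * \<alpha>))"

lemma half_cos_sum_summable:
  "\<alpha> \<ge> 1 \<Longrightarrow> summable (\<lambda>i. cos (pi * real (Suc i) * w) / (pi * real (Suc i)) ^ (2 * \<alpha>))"
  by (rule summable_bounded_over_power[where B = 1]) simp_all

lemma half_cos_sum_bern:
  assumes \<alpha>: "\<alpha> \<ge> 1" and w: "w \<in> {0..2}"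
  shows "half_cos_sum \<alpha> w = (-1) ^ (\<alpha> + 1) * 2 ^ (2 * \<alpha>) / 2 * bern (2 * \<alpha>) (w / 2)"
proof -
  have "2 * cos (2 * pi * real (Suc i) * (w / 2)) / (2 * pi * real (Suc i)) ^ (2 * \<alpha>) =
      2 / 2 ^ (2 * \<alpha>) * (cos (pi * real (Suc i) * w) / (pi * real (Suc i)) ^ (2 * \<alpha>))" for i
    by (simp add: power_mult_distrib mult.assoc)
  then have "(\<Sum>i. 2 * cos (2 * pi * real (Suc i) * (w / 2)) / (2 * pi * real (Suc i)) ^ (2 * \<alpha>)) =
      2 / 2 ^ (2 * \<alpha>) * half_cos_sum \<alpha> w"
    unfolding half_cos_sum_def using suminf_mult[OF half_cos_sum_summable[OF \<alpha>], of "2 / 2 ^ (2 * \<alpha>)" w]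
    by (simp only:)
  with fourier_even_bern[OF \<alpha>, of "w / 2"] w
  have "2 / 2 ^ (2 * \<alpha>) * half_cos_sum \<alpha> w = (-1) ^ (\<alpha> + 1) * bern (2 * \<alpha>) (w / 2)" by simp
  then show ?thesis by (simp add: field_simps)
qed

lemma hcos_half_cos_sum:
  assumes \<alpha>: "\<alpha> \<ge> 1"
  shows "hcos \<alpha> x y = half_cos_sum \<alpha> (x - y) + half_cos_sum \<alpha> (x + y)"
proof -
  have "2 * (cos (pi * real (Suc i) * x) * cos (pi * real (Suc i) * y)) / (pi * real (Suc i)) ^ (2 * \<alpha>) =
      cos (pi * real (Suc i) * (x - y)) / (pi * real (Suc i)) ^ (2 * \<alpha>) +
      cos (pi * real (Suc i) * (x + y)) / (pi * real (Suc i)) ^ (2 * \<alpha>)" for i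
    by (simp add: cos_times_cos right_diff_distrib distrib_left add_divide_distrib)
  then show ?thesis
    unfolding hcos_def half_cos_sum_def
    by (simp only: suminf_add[OF half_cos_sum_summable[OF \<alpha>] half_cos_sum_summable[OF \<alpha>]])
qed

text \<open>A shift by 1 changes the sign of the odd half-period frequencies, so they cancel and the
  full periods remain.\<close>

lemma per_half_cos_sum:
  assumes \<alpha>: "\<alpha> \<ge> 1"
  shows "per \<alpha> x y = half_cos_sum \<alpha> (x - y) + half_cos_sum \<alpha> (x - y + 1)"
proof -
  let ?z = "x - y"
  define g where "g i = cos (pi * real (Suc i) * ?z) / (pi * real (Suc i)) ^ (2 * \<alpha>) +
      cos (pi * real (Suc i) * (?z + 1)) / (pi * real (Suc i)) ^ (2 * \<alpha>)" for i
  have "g sums (half_cos_sum \<alpha> ?z + half_cos_sum \<alpha> (?z + 1))"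
    unfolding g_def half_cos_sum_def by (intro sums_add summable_sums half_cos_sum_summable \<alpha>)
  then have "(\<lambda>n. sum g {n * 2..<n * 2 + 2}) sums (half_cos_sum \<alpha> ?z + half_cos_sum \<alpha> (?z + 1))"
    by (rule sums_group) simp
  moreover have "sum g {n * 2..<n * 2 + 2} = 2 * cos (2 * pi * real (Suc n) * ?z) / (2 * pi * real (Suc n)) ^ (2 * \<alpha>)" for n
  proof -
    have shift: "cos (pi * real k * (?z + 1)) = cos (pi * real k * ?z) * (-1) ^ k" for k
      by (simp add: distrib_left cos_add cos_npi2 sin_npi2)
    have "g (n * 2) = 0" unfolding g_def shift by simp
    moreover have "g (Suc (n * 2)) = 2 * cos (2 * pi * real (Suc n) * ?z) / (2 * pi * real (Suc n)) ^ (2 * \<alpha>)"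
    proof -
      have e: "pi * real (Suc (Suc (n * 2))) = 2 * pi * real (Suc n)" by (simp add: algebra_simps)
      show ?thesis unfolding g_def shift unfolding e by (simp del: of_nat_Suc)
    qed
    moreover have "{n * 2..<n * 2 + 2} = {n * 2, Suc (n * 2)}" by auto
    ultimately show ?thesis by simp
  qed
  ultimately show ?thesis by (simp add: per_def sums_iff)
qed

definition diff_coeff :: "nat \<Rightarrow> nat \<Rightarrow> real" where
  "diff_coeff \<alpha> j = (-1) ^ (\<alpha> + 1) * 2 ^ (2 * \<alpha>) / 2 * ((if odd j then - 2 / fact j else 0) / 2 ^ j)"

text \<open>The value at \<open>x - y\<close>, whose absolute value causes the lack of smoothness on
  the diagonal, is common to both kernels and cancels. The remaining arguments
  \<open>x - y + 1\<close> and \<open>x + y\<close> stay in [0, 2], where the function is a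
  polynomial. They lie symmetrically about \<open>x + 1/2\<close>, hence only odd powers of
  \<open>y - 1/2\<close> survive.\<close>

lemma per_minus_hcos:
  assumes \<alpha>: "\<alpha> \<ge> 1" and xy: "x \<in> {0..1}" "y \<in> {0..1}"
  shows "per \<alpha> x y - hcos \<alpha> x y = (\<Sum>j\<le>2 * \<alpha>. (y - 1/2) ^ j * (diff_coeff \<alpha> j * ushift (2 * \<alpha> - j) x))"
proof -
  define r :: real where "r = (-1) ^ (\<alpha> + 1) * 2 ^ (2 * \<alpha>) / 2"
  have "per \<alpha> x y - hcos \<alpha> x y = half_cos_sum \<alpha> (x - y + 1) - half_cos_sum \<alpha> (x + y)"
    unfolding per_half_cos_sum[OF \<alpha>] hcos_half_cos_sum[OF \<alpha>] by simp
  also have "\<dots> = r * (bern (2 * \<alpha>) ((x - y + 1) / 2) - bern (2 * \<alpha>) ((x + y) / 2))"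
    using xy by (simp add: half_cos_sum_bern[OF \<alpha>] r_def right_diff_distrib)
  also have "(x - y + 1) / 2 = (1/4 + x/2) - (y - 1/2) / 2" by (simp add: field_simps)
  also have "(x + y) / 2 = (1/4 + x/2) + (y - 1/2) / 2" by (simp add: field_simps)
  also have "r * (bern (2 * \<alpha>) ((1/4 + x/2) - (y - 1/2) / 2) - bern (2 * \<alpha>) ((1/4 + x/2) + (y - 1/2) / 2)) =
      (\<Sum>j\<le>2 * \<alpha>. (y - 1/2) ^ j * (diff_coeff \<alpha> j * ushift (2 * \<alpha> - j) x))"
    unfolding bern_difference sum_distrib_left
  proof (intro sum.cong refl)
    fix j
    have "diff_coeff \<alpha> j = r * ((if odd j then - 2 / fact j else 0) / 2 ^ j)"
      by (simp only: diff_coeff_def r_def)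
    then show "r * ((if odd j then - 2 / fact j else 0) * ((y - 1/2) / 2) ^ j * bern (2 * \<alpha> - j) (1/4 + x/2)) =
        (y - 1/2) ^ j * (diff_coeff \<alpha> j * ushift (2 * \<alpha> - j) x)"
      by (simp add: ushift_def power_divide)
  qed
  finally show ?thesis .
qed

abbreviation cpow :: "nat \<Rightarrow> real \<Rightarrow> real" where
  "cpow j x \<equiv> (x - 1/2) ^ j"

text \<open>A reference kernel: it is dominated by \<open>K\<close> as soon as all the odd powers
  lie in the space of \<open>K\<close>, and it dominates every kernel built from odd polynomials of
  these degrees.\<close>

definition odd_powers :: "nat \<Rightarrow> real \<Rightarrow> real \<Rightarrow> real" where
  "odd_powers \<alpha> x y = (\<Sum>j\<in>{j. odd j \<and> j < 2 * \<alpha>}. cpow j x * cpow j y)"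

lemma psd_odd_powers: "psd X (odd_powers \<alpha>)"
  unfolding odd_powers_def[abs_def] by (intro psd_sum psd_rank_one) simp

lemma cpow_elems: "odd j \<Longrightarrow> j < 2 * \<alpha> \<Longrightarrow> restr X (cpow j) \<in> rk_elems X (odd_powers \<alpha>)"
  unfolding odd_powers_def[abs_def] by (rule sum_rank_one_elems) auto

lemma odd_powers_dominated:
  assumes "psd X K" "\<And>j. odd j \<Longrightarrow> j < 2 * \<alpha> \<Longrightarrow> restr X (cpow j) \<in> rk_elems X K"
  shows "dominated X (odd_powers \<alpha>) K"
  unfolding odd_powers_def[abs_def] using assms by (intro dominated_sum_rank_one) auto

text \<open>By \<open>bern_half_odd\<close>, the coefficients of the even powers of
  \<open>x - 1/2\<close> vanish in both expansions.\<close>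

lemma bern_in_cpow_span:
  assumes K: "psd X K" and "\<And>j. odd j \<Longrightarrow> j < n \<Longrightarrow> restr X (cpow j) \<in> rk_elems X K" and i: "odd i" "i < n"
  shows "restr X (bern i) \<in> rk_elems X K" and "restr X (ushift i) \<in> rk_elems X K"
proof -
  have m: "restr X (cpow j) \<in> rk_elems X K" if "j \<le> i" "bern (i - j) (1/2) \<noteq> 0" for j
  proof -
    have "odd j" using that bern_half_odd[of "i - j"] i by auto
    then show ?thesis using assms(2) that i by simp
  qed
  show "restr X (bern i) \<in> rk_elems X K"
    unfolding bern_centered[of i, abs_def] by (intro restr_elems_sum[OF K]) (auto intro: m)
  show "restr X (ushift i) \<in> rk_elems X K"
    unfolding ushift_centered[of i, abs_def] by (intro restr_elems_sum[OF K]) (auto intro: m)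
qed

lemma cpow_from_bern:
  assumes K: "psd X K" and m: "\<And>i. odd i \<Longrightarrow> i < n \<Longrightarrow> restr X (bern i) \<in> rk_elems X K"
    and i: "odd i" "i < n"
  shows "restr X (cpow i) \<in> rk_elems X K"
proof (rule triangular_elems[OF K _ _ _ m i, of _ "\<lambda>i j. bern (i - j) (1/2) / fact j" cpow])
  show "bern i x = (\<Sum>j\<le>i. bern (i - j) (1/2) / fact j * cpow j x)" for i x by (rule bern_centered)
  show "bern (i - j) (1/2) / fact j = 0" if "odd i" "even j" "j \<le> i" for i j
    using that bern_half_odd[of "i - j"] by simp
qed auto

lemma cpow_from_ushift:
  assumes K: "psd X K" and m: "\<And>i. odd i \<Longrightarrow> i < n \<Longrightarrow> restr X (ushift i) \<in> rk_elems X K"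
    and i: "odd i" "i < n"
  shows "restr X (cpow i) \<in> rk_elems X K"
proof (rule triangular_elems[OF K _ _ _ m i, of _ "\<lambda>i j. bern (i - j) (1/2) / (2 ^ j * fact j)" cpow])
  show "ushift i x = (\<Sum>j\<le>i. bern (i - j) (1/2) / (2 ^ j * fact j) * cpow j x)" for i x by (rule ushift_centered)
  show "bern (i - j) (1/2) / (2 ^ j * fact j) = 0" if "odd i" "even j" "j \<le> i" for i j
    using that bern_half_odd[of "i - j"] by simp
qed auto

abbreviation odd_upto :: "nat \<Rightarrow> nat set" where
  "odd_upto \<alpha> \<equiv> {n. odd n \<and> n \<le> \<alpha>}"

text \<open>The odd degrees \<open>n\<close> for which the derivative of order \<open>n\<close>
  still has boundary values; these will reveal the coefficient of \<open>bern n\<close>.\<close>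

abbreviation odd_below :: "nat \<Rightarrow> nat set" where
  "odd_below \<alpha> \<equiv> {n. odd n \<and> n < \<alpha>}"

section \<open>Odd polynomials in the full-period and half-period spaces\<close>

context
  fixes \<alpha> :: nat
  assumes \<alpha>: "\<alpha> \<ge> 1"
begin

lemma psd_full: "T \<subseteq> {..\<alpha>} \<Longrightarrow> psd {0..1} (full_ker \<alpha> T)"
  using bern_trig.psd_ker[OF full_bern_trig[OF \<alpha>]] .

lemma psd_half: "T \<subseteq> {..\<alpha>} \<Longrightarrow> psd {0..1} (half_ker \<alpha> T)"
  using bern_trig.psd_ker[OF half_bern_trig[OF \<alpha>]] .

lemma psd_per: "psd {0..1} (per \<alpha>)"
  using psd_full[of "{}"] psd_cong[of "{0..1}" "full_ker \<alpha> {}" "per \<alpha>"] full_ker_eq[OF \<alpha>, of "{}"] by simp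

lemma psd_hcos: "psd {0..1} (hcos \<alpha>)"
  using psd_half[of "{}"] psd_cong[of "{0..1}" "half_ker \<alpha> {}" "hcos \<alpha>"] half_ker_eq[OF \<alpha>, of "{}"] by simp

lemma bern_kernel_mono:
  assumes k: "\<And>T x y. T \<subseteq> {..\<alpha>} \<Longrightarrow> x \<in> {0..1} \<Longrightarrow> y \<in> {0..1} \<Longrightarrow>
      k T x y = (\<Sum>\<tau>\<in>T. bern \<tau> x * bern \<tau> y) + R x y"
    and psd: "\<And>T. T \<subseteq> {..\<alpha>} \<Longrightarrow> psd {0..1} (k T)" and ST: "S \<subseteq> T" "T \<subseteq> {..\<alpha>}"
  shows "dominated {0..1} (k S) (k T)"
proof -
  have fin: "finite T" using ST finite_subset by blast
  have S: "S \<subseteq> {..\<alpha>}" using ST by blast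
  let ?L = "\<lambda>x y. k S x y + (\<Sum>\<tau>\<in>T - S. bern \<tau> x * bern \<tau> y)"
  have "k T x y = ?L x y" if "x \<in> {0..1}" "y \<in> {0..1}" for x y
    using sum.subset_diff[OF ST(1) fin, of "\<lambda>\<tau>. bern \<tau> x * bern \<tau> y"]
    by (simp add: k[OF S that] k[OF ST(2) that])
  moreover have "dominated {0..1} (k S) ?L"
    using fin by (intro dominated_add_right1 dominated_refl psd psd_sum psd_rank_one S) auto
  ultimately show ?thesis using dominated_cong[of "{0..1}" "k S" "k S" "k T" ?L] by simp
qed

lemma full_mono: "S \<subseteq> T \<Longrightarrow> T \<subseteq> {..\<alpha>} \<Longrightarrow> dominated {0..1} (full_ker \<alpha> S) (full_ker \<alpha> T)"
  by (rule bern_kernel_mono[OF full_ker_eq[OF \<alpha>] psd_full])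

lemma half_mono: "S \<subseteq> T \<Longrightarrow> T \<subseteq> {..\<alpha>} \<Longrightarrow> dominated {0..1} (half_ker \<alpha> S) (half_ker \<alpha> T)"
  by (rule bern_kernel_mono[OF half_ker_eq[OF \<alpha>] psd_half])

lemma per_le_full: "T \<subseteq> {..\<alpha>} \<Longrightarrow> dominated {0..1} (per \<alpha>) (full_ker \<alpha> T)"
  using full_mono[of "{}" T] dominated_cong[of "{0..1}" "full_ker \<alpha> {}" "per \<alpha>" "full_ker \<alpha> T" "full_ker \<alpha> T"]
    full_ker_eq[OF \<alpha>, of "{}"] by simp

lemma hcos_le_half: "T \<subseteq> {..\<alpha>} \<Longrightarrow> dominated {0..1} (hcos \<alpha>) (half_ker \<alpha> T)"
  using half_mono[of "{}" T] dominated_cong[of "{0..1}" "half_ker \<alpha> {}" "hcos \<alpha>" "half_ker \<alpha> T" "half_ker \<alpha> T"]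
    half_ker_eq[OF \<alpha>, of "{}"] by simp

text \<open>For odd \<open>j\<close> both factors of the summand are odd polynomials of degree below
  \<open>2 * \<alpha>\<close>, and for even \<open>j\<close> the summand is 0. Since domination
  bounds a form only from above, both signs of \<open>a\<close> are wanted.\<close>

lemma difference_dominated:
  "dominated {0..1} (\<lambda>x y. a * (per \<alpha> x y - hcos \<alpha> x y)) (odd_powers \<alpha>)"
proof -
  let ?u = "\<lambda>j. restr {0..1} (ushift (2 * \<alpha> - j))" and ?c = "\<lambda>j. restr {0..1} (cpow j)"
  have "dominated {0..1} (\<lambda>x y. (a * diff_coeff \<alpha> j) * (?u j x * ?c j y)) (odd_powers \<alpha>)" if "j \<in> {..2 * \<alpha>}" for j
  proof (cases "odd j")
    case True
    then have j: "j < 2 * \<alpha>" "odd (2 * \<alpha> - j)" "2 * \<alpha> - j < 2 * \<alpha>" using that \<alpha> by (auto simp: le_less elim: oddE)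
    show ?thesis
      by (rule dominated_rank_two[OF psd_odd_powers bern_in_cpow_span(2)[OF psd_odd_powers cpow_elems j(2,3)] cpow_elems[OF True j(1)]])
  next
    case False
    then show ?thesis by (simp add: diff_coeff_def dominated_zero)
  qed
  then have "dominated {0..1} (\<lambda>x y. \<Sum>j\<le>2 * \<alpha>. (a * diff_coeff \<alpha> j) * (?u j x * ?c j y)) (odd_powers \<alpha>)"
    by (intro dominated_sum) auto
  moreover have "(\<Sum>j\<le>2 * \<alpha>. (a * diff_coeff \<alpha> j) * (?u j x * ?c j y)) = a * (per \<alpha> x y - hcos \<alpha> x y)"
    if "x \<in> {0..1}" "y \<in> {0..1}" for x y
    unfolding per_minus_hcos[OF \<alpha> that] sum_distrib_left using that by (intro sum.cong) (auto simp: restr_def)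
  ultimately show ?thesis
    using dominated_cong[of "{0..1}" "\<lambda>x y. \<Sum>j\<le>2 * \<alpha>. (a * diff_coeff \<alpha> j) * (?u j x * ?c j y)"
        "\<lambda>x y. a * (per \<alpha> x y - hcos \<alpha> x y)" "odd_powers \<alpha>" "odd_powers \<alpha>"] by simp
qed

lemma per_dominatedI:
  assumes "psd {0..1} K" "dominated {0..1} (hcos \<alpha>) K" "dominated {0..1} (odd_powers \<alpha>) K"
  shows "dominated {0..1} (per \<alpha>) K"
  using dominated_add[OF assms(2) dominated_trans[OF difference_dominated[of 1] assms(3) psd_odd_powers]] by simp

lemma hcos_dominatedI:
  assumes "psd {0..1} K" "dominated {0..1} (per \<alpha>) K" "dominated {0..1} (odd_powers \<alpha>) K"
  shows "dominated {0..1} (hcos \<alpha>) K"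
  using dominated_add[OF assms(2) dominated_trans[OF difference_dominated[of "-1"] assms(3) psd_odd_powers]] by simp

text \<open>For every phase \<open>t\<close>, the kernel \<open>per\<close> splits into the kernels with features \<open>cos (w * x - t)\<close> and
  \<open>sin (w * x - t)\<close>. For \<open>t = n * pi / 2\<close> the Fourier series of \<open>bern n\<close> only involves the former.\<close>

lemma bern_in_per:
  assumes n: "n > \<alpha>"
  shows "restr {0..1} (bern n) \<in> rk_elems {0..1} (per \<alpha>)"
proof -
  let ?w = "\<lambda>j. 2 * pi * real (Suc j)"
  have bt: "bern_trig \<alpha> ?w {}"
  proof
    show "real (Suc j) \<le> 2 * pi * real (Suc j)" for j
      using mult_right_mono[of 1 "2 * pi" "real (Suc j)"] pi_ge_two by simp
  qed (use \<alpha> in auto)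
  \<comment> \<open>Chosen so that the features of order \<alpha> become multiples of
    \<open>cos (?w j * x - t)\<close>; the phase \<open>t + pi / 2\<close> then gives the
    sines.\<close>
  define p where "p = (\<lambda>t j :: nat. t - real \<alpha> * pi / 2)"
  define L where "L t = (\<lambda>x y. \<Sum>j. bern_trig.tg ?w (p t) \<alpha> j x * bern_trig.tg ?w (p t) \<alpha> j y)" for t
  have tg: "bern_trig.tg ?w (p t) \<alpha> j x = sqrt 2 * (cos (?w j * x - t) / ?w j ^ \<alpha>)" for t j x
    unfolding bern_trig.tg_def[OF bt] p_def by simp
  have feat: "features {0..1} (L t) (bern_trig.tg ?w (p t) \<alpha>)" for t
    unfolding L_def by (rule bern_trig.features_tg[OF bt])
  have split: "L t x y + L (t + pi / 2) x y = per \<alpha> x y" if "x \<in> {0..1}" "y \<in> {0..1}" for t x y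
  proof -
    have "(\<lambda>j. bern_trig.tg ?w (p t) \<alpha> j x * bern_trig.tg ?w (p t) \<alpha> j y +
        bern_trig.tg ?w (p (t + pi/2)) \<alpha> j x * bern_trig.tg ?w (p (t + pi/2)) \<alpha> j y) sums (L t x y + L (t + pi / 2) x y)"
      using feat that by (intro sums_add) (auto simp: features_def)
    moreover have "bern_trig.tg ?w (p t) \<alpha> j x * bern_trig.tg ?w (p t) \<alpha> j y +
        bern_trig.tg ?w (p (t + pi/2)) \<alpha> j x * bern_trig.tg ?w (p (t + pi/2)) \<alpha> j y =
        2 * cos (?w j * (x - y)) / ?w j ^ (2 * \<alpha>)" for j
    proof -
      have s: "cos (?w j * z - (t + pi / 2)) = sin (?w j * z - t)" for z
      proof -
        have "cos (a - pi / 2) = sin a" for a :: real by (simp add: cos_diff)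
        then show ?thesis by (simp only: diff_diff_eq[symmetric])
      qed
      have "cos (?w j * (x - y)) = cos ((?w j * x - t) - (?w j * y - t))" by (simp add: right_diff_distrib)
      also have "\<dots> = cos (?w j * x - t) * cos (?w j * y - t) + sin (?w j * x - t) * sin (?w j * y - t)"
        by (rule cos_diff)
      finally have c: "cos (?w j * (x - y)) = cos (?w j * x - t) * cos (?w j * y - t) + sin (?w j * x - t) * sin (?w j * y - t)" .
      have "sqrt 2 * (a / q) * (sqrt 2 * (b / q)) + sqrt 2 * (a' / q) * (sqrt 2 * (b' / q)) = 2 * (a * b + a' * b') / (q * q)"
        for a b a' b' q :: real
        by (simp only: sqrt2_mult) (simp add: add_divide_distrib)
      then show ?thesis unfolding tg s c power_even_eq power2_eq_square .
    qed
    ultimately show ?thesis by (simp add: per_def sums_iff)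
  qed
  define t where "t = real n * pi / 2"
  have "restr {0..1} (bern n) \<in> rk_elems {0..1} (L t)"
    unfolding L_def
  proof (rule bern_trig.trig_series_elems[OF bt n, of "\<lambda>_. -2" 2])
    fix x :: real assume "x \<in> {0..1}"
    then have "bern n x = fourier_sum n x" using n \<alpha> by (intro fourier_bern[symmetric]) auto
    then show "bern n x = (\<Sum>j. - 2 * cos (2 * pi * real (Suc j) * x - p t j - real \<alpha> * pi / 2) / (2 * pi * real (Suc j)) ^ n)"
      by (simp add: fourier_sum_def fourier_term_def p_def t_def)
  qed simp
  moreover have "dominated {0..1} (L t) (\<lambda>x y. L t x y + L (t + pi / 2) x y)"
    by (intro dominated_add_right1 dominated_refl features_psd[OF feat])
  moreover have "dominated {0..1} (L t) (\<lambda>x y. L t x y + L (t + pi / 2) x y) \<longleftrightarrow> dominated {0..1} (L t) (per \<alpha>)"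
    by (rule dominated_cong) (simp_all add: split)
  ultimately show ?thesis using dominated_elems[OF features_psd[OF feat] psd_per] by blast
qed

lemma bern_in_full:
  assumes T: "T \<subseteq> {..\<alpha>}" and n: "n \<in> T \<or> n > \<alpha>"
  shows "restr {0..1} (bern n) \<in> rk_elems {0..1} (full_ker \<alpha> T)"
proof (cases "n \<in> T")
  case True
  then show ?thesis using bern_trig.bern_elems[OF full_bern_trig[OF \<alpha> T]] by blast
next
  case False
  then show ?thesis
    using n dominated_elems[OF psd_per psd_full[OF T] per_le_full[OF T] bern_in_per] by blast
qed

text \<open>Odd degrees up to \<alpha> are included in the kernel, and higher degrees lie in the
  space of \<open>per\<close> by \<open>bern_in_per\<close>. The powers follow from the Bernoulli
  polynomials by substitution.\<close>

lemma odd_powers_le_full: "dominated {0..1} (odd_powers \<alpha>) (full_ker \<alpha> (odd_upto \<alpha>))"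
proof (rule odd_powers_dominated)
  have T: "odd_upto \<alpha> \<subseteq> {..\<alpha>}" by auto
  then show "psd {0..1} (full_ker \<alpha> (odd_upto \<alpha>))" by (rule psd_full)
  fix j assume j: "odd j" "j < 2 * \<alpha>"
  show "restr {0..1} (cpow j) \<in> rk_elems {0..1} (full_ker \<alpha> (odd_upto \<alpha>))"
    by (rule cpow_from_bern[OF psd_full[OF T] bern_in_full[OF T] j]) auto
qed

text \<open>Up to a constant factor, the following functions are the Euler polynomials.\<close>

lemma half_difference_elems:
  assumes m: "odd m" "m \<ge> \<alpha>"
  shows "restr {0..1} (\<lambda>x. bern (Suc m) (x / 2) - bern (Suc m) ((x + 1) / 2)) \<in> rk_elems {0..1} (hcos \<alpha>)"
proof -
  obtain b where b: "Suc m = 2 * b" "b \<ge> 1"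
  proof -
    from m(1) obtain k where "m = 2 * k + 1" by (rule oddE)
    then show ?thesis using that[of "Suc k"] by simp
  qed
  define r :: real where "r = (-1) ^ (b + 1) * 2 ^ (2 * b) / 2"
  have bt: "bern_trig \<alpha> half_freq {}" by (rule half_bern_trig[OF \<alpha>]) simp
  let ?f = "\<lambda>x. half_cos_sum b x - half_cos_sum b (x + 1)"
  have "restr {0..1} ?f \<in> rk_elems {0..1} (\<lambda>x y. \<Sum>j. bern_trig.tg half_freq (half_phase \<alpha>) \<alpha> j x *
      bern_trig.tg half_freq (half_phase \<alpha>) \<alpha> j y)"
  proof (rule bern_trig.trig_series_elems[OF bt, of "2 * b" "\<lambda>j. 1 - (-1) ^ Suc j" 2])
    show "2 * b > \<alpha>" using m b by linarith
    show "\<bar>1 - (-1) ^ Suc j\<bar> \<le> (2 :: real)" for j by (cases "even j") auto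
    fix x :: real
    have "?f x = (\<Sum>j. cos (pi * real (Suc j) * x) / (pi * real (Suc j)) ^ (2 * b) -
        cos (pi * real (Suc j) * (x + 1)) / (pi * real (Suc j)) ^ (2 * b))"
      unfolding half_cos_sum_def by (rule suminf_diff[OF half_cos_sum_summable[OF b(2)] half_cos_sum_summable[OF b(2)]])
    moreover have "cos (pi * real k * (x + 1)) = cos (pi * real k * x) * (-1) ^ k" for k
      by (simp add: distrib_left cos_add cos_npi2 sin_npi2)
    ultimately show "?f x = (\<Sum>j. (1 - (-1) ^ Suc j) *
        cos (half_freq j * x - half_phase \<alpha> j - real \<alpha> * pi / 2) / half_freq j ^ (2 * b))"
      by (simp add: half_freq_def half_phase_def diff_divide_distrib left_diff_distrib distrib_right
          add_divide_distrib mult.commute del: of_nat_Suc)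
  qed
  moreover have "(\<lambda>x y. \<Sum>j. bern_trig.tg half_freq (half_phase \<alpha>) \<alpha> j x *
      bern_trig.tg half_freq (half_phase \<alpha>) \<alpha> j y) = hcos \<alpha>"
    by (simp add: hcos_def[abs_def] half_tg[OF \<alpha>] sqrt2_mult power_even_eq power2_eq_square del: of_nat_Suc)
  ultimately have f: "restr {0..1} ?f \<in> rk_elems {0..1} (hcos \<alpha>)" by simp
  interpret psd_kernel "{0..1}" "hcos \<alpha>" by unfold_locales (rule psd_hcos)
  have "restr {0..1} (\<lambda>x. bern (Suc m) (x / 2) - bern (Suc m) ((x + 1) / 2)) = (\<lambda>x. 1 / r * restr {0..1} ?f x)"
  proof
    fix x
    show "restr {0..1} (\<lambda>x. bern (Suc m) (x / 2) - bern (Suc m) ((x + 1) / 2)) x = 1 / r * restr {0..1} ?f x"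
    proof (cases "x \<in> {0..1}")
      case True
      then have "half_cos_sum b x = r * bern (2 * b) (x / 2)"
        "half_cos_sum b (x + 1) = r * bern (2 * b) ((x + 1) / 2)"
        by (auto simp: half_cos_sum_bern[OF b(2)] r_def)
      moreover have "r \<noteq> 0" by (simp add: r_def)
      ultimately show ?thesis using True by (simp add: restr_def b(1) flip: right_diff_distrib)
    qed (auto simp: restr_def)
  qed
  then show ?thesis using scale_elems[OF f, of "1 / r"] by simp
qed

text \<open>Below \<alpha> the Bernoulli polynomials are included in the kernel. From \<alpha> on,
  each half difference lies in the space of \<open>hcos\<close> and equals a multiple of
  \<open>ushift i\<close> plus terms of lower odd index, so induction yields all of them.\<close>

lemma odd_powers_le_half: "dominated {0..1} (odd_powers \<alpha>) (half_ker \<alpha> (odd_below \<alpha>))"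
proof -
  let ?K = "half_ker \<alpha> (odd_below \<alpha>)"
  have T: "odd_below \<alpha> \<subseteq> {..\<alpha>}" by auto
  note K = psd_half[OF T]
  have b: "restr {0..1} (bern i) \<in> rk_elems {0..1} ?K" if "odd i" "i < \<alpha>" for i
    using bern_trig.bern_elems[OF half_bern_trig[OF \<alpha> T]] that by simp
  have c: "restr {0..1} (cpow i) \<in> rk_elems {0..1} ?K" if i: "odd i" "i < \<alpha>" for i
    by (rule cpow_from_bern[OF K _ i]) (rule b)
  have u: "restr {0..1} (ushift i) \<in> rk_elems {0..1} ?K" if "odd i" for i
    using that
  proof (induction i rule: less_induct)
    case (less i)
    show ?case
    proof (cases "i < \<alpha>")
      case True
      show ?thesis by (rule bern_in_cpow_span(2)[OF K _ less.prems True]) (rule c)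
    next
      case False
      define c where "c j = (if odd j then - 2 / fact j else 0) * (1/4 :: real) ^ j" for j
      let ?e = "\<lambda>x. bern (Suc i) (x / 2) - bern (Suc i) ((x + 1) / 2)"
      have e: "restr {0..1} ?e \<in> rk_elems {0..1} ?K"
        using half_difference_elems[of i] less.prems False
        by (intro dominated_elems[OF psd_hcos K hcos_le_half[OF T]]) simp
      have s: "restr {0..1} (\<lambda>x. \<Sum>j\<in>{..Suc i} - {1}. c j * ushift (Suc i - j) x) \<in> rk_elems {0..1} ?K"
      proof (rule restr_elems_sum[OF K])
        fix j assume j: "j \<in> {..Suc i} - {1}" "c j \<noteq> 0"
        then have "odd j" by (auto simp: c_def split: if_splits)
        then have "odd (Suc i - j)" "Suc i - j < i" using j less.prems by (auto elim!: oddE)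
        then show "restr {0..1} (ushift (Suc i - j)) \<in> rk_elems {0..1} ?K" by (intro less.IH)
      qed simp
      \<comment> \<open>The term \<open>j = 1\<close> has the coefficient
        \<open>c 1 = - 1/2\<close>; its index \<open>Suc i - 1\<close> is the one sought.\<close>
      have "(-2) * ?e x + 2 * (\<Sum>j\<in>{..Suc i} - {1}. c j * ushift (Suc i - j) x) = ushift i x" for x
      proof -
        have "x / 2 = (1/4 + x/2) - 1/4" "(x + 1) / 2 = (1/4 + x/2) + 1/4" by (simp_all add: field_simps)
        then have "?e x = bern (Suc i) ((1/4 + x/2) - 1/4) - bern (Suc i) ((1/4 + x/2) + 1/4)" by (simp only:)
        also have "\<dots> = (\<Sum>j\<le>Suc i. c j * ushift (Suc i - j) x)"
          unfolding bern_difference by (simp only: c_def ushift_def)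
        also have "\<dots> = c 1 * ushift (Suc i - 1) x + (\<Sum>j\<in>{..Suc i} - {1}. c j * ushift (Suc i - j) x)"
          by (rule sum.remove) auto
        finally show ?thesis by (simp add: c_def)
      qed
      then show ?thesis using restr_elems_add[OF K e s, of "-2" 2] by simp
    qed
  qed
  show ?thesis
    by (rule odd_powers_dominated[OF K cpow_from_ushift[OF K u]])
qed

text \<open>The sections of \<open>per - hcos\<close> lie in the space of the sum, hence so do their coefficients with
  respect to the powers of \<open>y - 1/2\<close>.\<close>

lemma odd_powers_le_sum: "dominated {0..1} (odd_powers \<alpha>) (\<lambda>x y. per \<alpha> x y + hcos \<alpha> x y)"
proof -
  let ?K = "\<lambda>x y. per \<alpha> x y + hcos \<alpha> x y"
  have K: "psd {0..1} ?K" by (rule psd_add[OF psd_per psd_hcos])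
  let ?w = "\<lambda>j x. diff_coeff \<alpha> j * ushift (2 * \<alpha> - j) x"
  have sec: "restr {0..1} (\<lambda>x. L x y) \<in> rk_elems {0..1} L" if "psd {0..1} L" "y \<in> {0..1}" for L and y :: real
    using psd_kernel.section_comb_elems[OF psd_kernel.intro[OF that(1)], of "[(1, y)]"] that(2)
    by (simp add: section_comb_def)
  have "restr {0..1} (\<lambda>x. \<Sum>j\<le>2 * \<alpha>. t ^ j * ?w j x) \<in> rk_elems {0..1} ?K" if t: "\<bar>t\<bar> \<le> 1/2" for t
  proof -
    have y: "t + 1/2 \<in> {0..1}" using t by (auto simp: abs_le_iff)
    have "restr {0..1} (\<lambda>x. per \<alpha> x (t + 1/2)) \<in> rk_elems {0..1} ?K"
      by (rule dominated_elems[OF psd_per K dominated_add_right1[OF dominated_refl psd_per psd_hcos] sec[OF psd_per y]])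
    moreover have "restr {0..1} (\<lambda>x. hcos \<alpha> x (t + 1/2)) \<in> rk_elems {0..1} ?K"
      by (rule dominated_elems[OF psd_hcos K dominated_add_right2[OF dominated_refl psd_per psd_hcos] sec[OF psd_hcos y]])
    ultimately have "restr {0..1} (\<lambda>x. 1 * per \<alpha> x (t + 1/2) + (-1) * hcos \<alpha> x (t + 1/2)) \<in> rk_elems {0..1} ?K"
      by (rule restr_elems_add[OF K])
    moreover have "restr {0..1} (\<lambda>x. 1 * per \<alpha> x (t + 1/2) + (-1) * hcos \<alpha> x (t + 1/2)) =
        restr {0..1} (\<lambda>x. \<Sum>j\<le>2 * \<alpha>. t ^ j * ?w j x)"
      using per_minus_hcos[OF \<alpha> _ y] by (auto simp: restr_def)
    ultimately show ?thesis by simp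
  qed
  then have w: "restr {0..1} (?w j) \<in> rk_elems {0..1} ?K" if "j \<le> 2 * \<alpha>" for j
    by (rule coefficients_elems[OF K, where r = "1/2" and n = "2 * \<alpha>"]) (use that in auto)
  have "restr {0..1} (ushift i) \<in> rk_elems {0..1} ?K" if i: "odd i" "i < 2 * \<alpha>" for i
  proof -
    define j where "j = 2 * \<alpha> - i"
    have "odd j" "j \<le> 2 * \<alpha>" "2 * \<alpha> - j = i" using i by (auto simp: j_def)
    moreover have "diff_coeff \<alpha> j \<noteq> 0" using \<open>odd j\<close> by (simp add: diff_coeff_def)
    ultimately show ?thesis
      using restr_elems_add[OF K w w, of j j "1 / diff_coeff \<alpha> j" 0] by simp
  qed
  then show ?thesis by (intro odd_powers_dominated[OF K cpow_from_ushift[OF K]]) auto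
qed

lemma bern_sum_dominated:
  assumes K: "psd {0..1} K" and d: "dominated {0..1} (odd_powers \<alpha>) K" and T: "T \<subseteq> odd_upto \<alpha>"
  shows "dominated {0..1} (\<lambda>x y. \<Sum>\<tau>\<in>T. bern \<tau> x * bern \<tau> y) K"
proof (rule dominated_sum_rank_one[OF K])
  show "finite T" using T by (rule finite_subset) simp
  fix i assume "i \<in> T"
  then have i: "odd i" "i < 2 * \<alpha>" using T \<alpha> by auto
  show "restr {0..1} (bern i) \<in> rk_elems {0..1} K"
    by (rule bern_in_cpow_span(1)[OF K dominated_elems[OF psd_odd_powers K d cpow_elems] i])
qed

lemma bern_kernel_dominatedI:
  assumes K: "psd {0..1} K" and d: "dominated {0..1} (odd_powers \<alpha>) K" and T: "T \<subseteq> odd_upto \<alpha>"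
    and R: "dominated {0..1} R K"
    and k: "\<And>x y. x \<in> {0..1} \<Longrightarrow> y \<in> {0..1} \<Longrightarrow> k x y = (\<Sum>\<tau>\<in>T. bern \<tau> x * bern \<tau> y) + R x y"
  shows "dominated {0..1} k K"
  using dominated_add[OF bern_sum_dominated[OF K d T] R] k
    dominated_cong[of "{0..1}" k "\<lambda>x y. (\<Sum>\<tau>\<in>T. bern \<tau> x * bern \<tau> y) + R x y" K K] by simp

lemma full_dominatedI:
  assumes "psd {0..1} K" "dominated {0..1} (odd_powers \<alpha>) K" "T \<subseteq> odd_upto \<alpha>" "dominated {0..1} (per \<alpha>) K"
  shows "dominated {0..1} (full_ker \<alpha> T) K"
  by (rule bern_kernel_dominatedI[OF assms full_ker_eq[OF \<alpha>]]) (use assms(3) in auto)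

lemma half_dominatedI:
  assumes "psd {0..1} K" "dominated {0..1} (odd_powers \<alpha>) K" "T \<subseteq> odd_upto \<alpha>" "dominated {0..1} (hcos \<alpha>) K"
  shows "dominated {0..1} (half_ker \<alpha> T) K"
  by (rule bern_kernel_dominatedI[OF assms half_ker_eq[OF \<alpha>]]) (use assms(3) in auto)

text \<open>For odd \<alpha> the degree \<alpha> itself is absent on the right; it is supplied by
  \<open>odd_powers_le_half\<close>.\<close>

lemma full_le_half: "dominated {0..1} (full_ker \<alpha> (odd_upto \<alpha>)) (half_ker \<alpha> (odd_below \<alpha>))"
proof -
  have T: "odd_below \<alpha> \<subseteq> {..\<alpha>}" by auto
  show ?thesis
    by (intro full_dominatedI per_dominatedI psd_half odd_powers_le_half hcos_le_half T order_refl)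
qed

lemma half_le_full: "dominated {0..1} (half_ker \<alpha> (odd_below \<alpha>)) (full_ker \<alpha> (odd_upto \<alpha>))"
proof -
  have T: "odd_upto \<alpha> \<subseteq> {..\<alpha>}" "odd_below \<alpha> \<subseteq> odd_upto \<alpha>" by auto
  show ?thesis
    by (intro half_dominatedI hcos_dominatedI psd_full odd_powers_le_full per_le_full T)
qed

lemma hcos_le_full: "dominated {0..1} (hcos \<alpha>) (full_ker \<alpha> (odd_upto \<alpha>))"
proof -
  have T: "odd_below \<alpha> \<subseteq> {..\<alpha>}" by auto
  show ?thesis by (rule dominated_trans[OF hcos_le_half[OF T] half_le_full psd_half[OF T]])
qed

lemma combination_le_full:
  assumes "a \<ge> 0" "b \<ge> 0"
  shows "dominated {0..1} (\<lambda>x y. a * per \<alpha> x y + b * hcos \<alpha> x y) (full_ker \<alpha> (odd_upto \<alpha>))"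
proof -
  have T: "odd_upto \<alpha> \<subseteq> {..\<alpha>}" by auto
  show ?thesis by (intro dominated_add dominated_cmult assms hcos_le_full per_le_full[OF T])
qed

lemma full_le_combination:
  assumes "a > 0" "b > 0"
  shows "dominated {0..1} (full_ker \<alpha> (odd_upto \<alpha>)) (\<lambda>x y. a * per \<alpha> x y + b * hcos \<alpha> x y)"
proof -
  let ?K = "\<lambda>x y. a * per \<alpha> x y + b * hcos \<alpha> x y"
  have a: "psd {0..1} (\<lambda>x y. a * per \<alpha> x y)" and b: "psd {0..1} (\<lambda>x y. b * hcos \<alpha> x y)"
    using assms by (auto intro: psd_cmult psd_per psd_hcos)
  have K: "psd {0..1} ?K" by (rule psd_add[OF a b])
  have p: "dominated {0..1} (per \<alpha>) ?K"
    using assms by (intro dominated_add_right1 dominated_cmult_right dominated_refl a b)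
  have h: "dominated {0..1} (hcos \<alpha>) ?K"
    using assms by (intro dominated_add_right2 dominated_cmult_right dominated_refl a b)
  have "dominated {0..1} (odd_powers \<alpha>) ?K"
    by (rule dominated_trans[OF odd_powers_le_sum dominated_add[OF p h] psd_add[OF psd_per psd_hcos]])
  then show ?thesis by (intro full_dominatedI K p order_refl)
qed

end

section \<open>Vanishing odd derivatives at the boundary\<close>

lemma dominated_add_one:
  assumes "dominated X K L" "psd X L"
  shows "dominated X (\<lambda>x y. 1 + K x y) (\<lambda>x y. 1 + L x y)"
proof -
  have one: "psd X (\<lambda>x y. 1 :: real)" by (rule psd_const) simp
  show ?thesis
    by (intro dominated_add dominated_add_right1[OF dominated_refl one assms(2)]
        dominated_add_right2[OF assms(1) one assms(2)])
qed

context
  fixes \<alpha> :: nat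
  assumes \<alpha>: "\<alpha> \<ge> 1"
begin

text \<open>\<open>V\<close> is the Sobolev space and \<open>F\<close> its subspace for the
  condition \<open>odd\<close>. \<open>G\<close> will turn out to have the functions of
  \<open>F\<close> with an equivalent norm, in a form where boundary values separate the Bernoulli
  from the cosine coefficients. \<open>C\<close> is the cosine space with the constants.\<close>

interpretation V: bern_trig \<alpha> full_freq "full_phase \<alpha>" "{..\<alpha>}"
  by (rule full_bern_trig[OF \<alpha>]) simp

interpretation F: bern_trig \<alpha> full_freq "full_phase \<alpha>" "insert 0 (odd_upto \<alpha>)"
  by (rule full_bern_trig[OF \<alpha>]) auto

interpretation G: bern_trig \<alpha> half_freq "half_phase \<alpha>" "insert 0 (odd_below \<alpha>)"
  by (rule half_bern_trig[OF \<alpha>]) auto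

interpretation C: bern_trig \<alpha> half_freq "half_phase \<alpha>" "{0}"
  by (rule half_bern_trig[OF \<alpha>]) simp

text \<open>Odd derivatives of the half-period cosines are multiples of sines that vanish at both
  ends.\<close>

lemma half_tg_boundary:
  assumes "odd n" "n < \<alpha>" "x \<in> {0, 1}"
  shows "G.tg (\<alpha> - n) j x = 0"
proof -
  obtain k where k: "n = 2 * k + 1" using assms(1) by (rule oddE)
  have "half_freq j * x - half_phase \<alpha> j - real (\<alpha> - n) * pi / 2 = pi * real (Suc j) * x + (real k * pi + pi / 2)"
    using assms(2) by (simp add: half_freq_def half_phase_def k of_nat_diff field_simps)
  moreover have "cos (pi * real (Suc j) * x + (real k * pi + pi / 2)) = 0"
  proof -
    have "sin (pi * real (Suc j) * x) = 0" using assms(3) sin_npi2[of "Suc j"] by auto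
    moreover have "cos (real k * pi + pi / 2) = 0" by (simp add: cos_add)
    ultimately show ?thesis by (simp add: cos_add del: of_nat_Suc)
  qed
  ultimately show ?thesis unfolding G.tg_def by simp
qed

lemma cos_expansion_bdry0:
  assumes "C.expansion a f"
  shows "bdry0 \<alpha> f"
  unfolding bdry0_def
proof (intro allI impI)
  fix n assume n: "odd n \<and> n + 1 \<le> \<alpha>"
  have "deriv01 n f x = 0" if x: "x \<in> {0, 1}" for x
  proof -
    have "C.dfeat (Suc n) i x = 0" for i
      using n half_tg_boundary[of n x "i - Suc \<alpha>"] x by (auto simp: C.dfeat_def elim: oddE)
    then show ?thesis using C.expansion_deriv01[OF assms, of n x] n x by auto
  qed
  then show "deriv01 n f 0 = 0 \<and> deriv01 n f 1 = 0" by simp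
qed

text \<open>Downward induction from the highest degree. In the derivative of order \<open>i\<close>
  at 0, lower degrees are annihilated, the coefficients of higher odd degrees are already 0 and the
  cosine terms vanish; only \<open>bern i\<close> is left and contributes its coefficient.\<close>

lemma bdry0_cos_expansion:
  assumes a: "G.expansion a f" and b: "bdry0 \<alpha> f"
  shows "C.expansion a f"
proof -
  have zero: "a i = 0" if i: "i \<in> odd_below \<alpha>" for i
    using i
  proof (induction "\<alpha> - i" arbitrary: i rule: less_induct)
    case less
    then have i: "odd i" "i < \<alpha>" by auto
    have "(\<lambda>k. a k * G.dfeat (Suc i) k 0) = (\<lambda>k. if k = i then a k else 0)"
    proof
      fix k
      show "a k * G.dfeat (Suc i) k 0 = (if k = i then a k else 0)"
      proof (cases "k \<le> \<alpha>")
        case True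
        have "a k = 0" if "k > i" "k \<in> odd_below \<alpha>" using less.hyps[of k] diff_less_mono2[of i k \<alpha>] that i by simp
        then show ?thesis using True i by (auto simp: G.dfeat_def not_le elim: oddE)
      next
        case False
        then show ?thesis using i half_tg_boundary[of i 0] by (auto simp: G.dfeat_def)
      qed
    qed
    then have "deriv01 i f 0 = a i"
      using G.expansion_deriv01[OF a i(2), of 0] sums_single[of i a] by (simp add: sums_iff)
    then show ?case using b i by (simp add: bdry0_def)
  qed
  have "a i * G.dfeat 1 i x = a i * C.dfeat 1 i x" for i x
    using zero[of i] by (auto simp: G.dfeat_def C.dfeat_def)
  then have "(\<lambda>x. \<Sum>i. a i * G.dfeat 1 i x) = (\<lambda>x. \<Sum>i. a i * C.dfeat 1 i x)" by (simp only:)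
  then show ?thesis using a unfolding G.expansion_def C.expansion_def by (simp only:)
qed

lemma H_sob_odd: "is_rkhs {0..1} F.ker
    (subspace_where (rk {0..1} V.ker) (\<lambda>f. \<forall>\<tau>. odd \<tau> \<and> \<tau> + 1 \<le> \<alpha> \<longrightarrow> deriv01 \<tau> f 0 = deriv01 \<tau> f 1))"
proof -
  have "{..\<alpha>} - {n. even n \<and> 2 \<le> n \<and> n \<le> \<alpha>} = insert 0 (odd_upto \<alpha>)"
    by (auto simp: not_le numeral_2_eq_2 less_Suc_eq)
  then show ?thesis
    using is_rkhs_mean_deriv_zero[OF \<alpha>, of "{n. even n \<and> 2 \<le> n \<and> n \<le> \<alpha>}"] odd_conditions[of 0 \<alpha>]
    by (simp add: H_sob_eq[OF \<alpha>] subset_iff)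
qed

lemma elems_F:
  "F.E = {f \<in> V.E. \<forall>\<tau>. odd \<tau> \<and> \<tau> + 1 \<le> \<alpha> \<longrightarrow> deriv01 \<tau> f 0 = deriv01 \<tau> f 1}"
  and sqnorm_F: "f \<in> F.E \<Longrightarrow> F.N f = V.N f"
proof -
  note eq = is_rkhs_unique[OF H_sob_odd]
  show el: "F.E = {f \<in> V.E. \<forall>\<tau>. odd \<tau> \<and> \<tau> + 1 \<le> \<alpha> \<longrightarrow> deriv01 \<tau> f 0 = deriv01 \<tau> f 1}"
    using arg_cong[OF eq, of elems] by (simp add: subspace_where_simps)
  assume f: "f \<in> F.E"
  have "ip (rk {0..1} F.ker) f f = ip (rk {0..1} V.ker) f f"
    unfolding eq[symmetric] using f el by (intro subspace_where_simps(2)) auto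
  then show "F.N f = V.N f" using f el by (simp add: F.ip_rk_self V.ip_rk_self)
qed

lemma F_G_dominated: "dominated {0..1} F.ker G.ker" "dominated {0..1} G.ker F.ker"
proof -
  have T: "odd_upto \<alpha> \<subseteq> {..\<alpha>}" "odd_below \<alpha> \<subseteq> {..\<alpha>}" by auto
  have "F.ker x y = 1 + full_ker \<alpha> (odd_upto \<alpha>) x y" "G.ker x y = 1 + half_ker \<alpha> (odd_below \<alpha>) x y"
    if "x \<in> {0..1}" "y \<in> {0..1}" for x y
    using that T by (simp_all add: full_ker_eq[OF \<alpha>] half_ker_eq[OF \<alpha>])
  then have "dominated {0..1} F.ker G.ker \<longleftrightarrow> dominated {0..1} (\<lambda>x y. 1 + full_ker \<alpha> (odd_upto \<alpha>) x y) (\<lambda>x y. 1 + half_ker \<alpha> (odd_below \<alpha>) x y)"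
    "dominated {0..1} G.ker F.ker \<longleftrightarrow> dominated {0..1} (\<lambda>x y. 1 + half_ker \<alpha> (odd_below \<alpha>) x y) (\<lambda>x y. 1 + full_ker \<alpha> (odd_upto \<alpha>) x y)"
    by (intro dominated_cong; simp)+
  then show "dominated {0..1} F.ker G.ker" "dominated {0..1} G.ker F.ker"
    using dominated_add_one[OF full_le_half[OF \<alpha>] psd_half[OF \<alpha> T(2)]]
      dominated_add_one[OF half_le_full[OF \<alpha>] psd_full[OF \<alpha> T(1)]] by blast+
qed

section \<open>The space with vanishing boundary derivatives against the cosine space\<close>

abbreviation (input) "B \<equiv> K_sob_odd_bdry0 \<alpha>"

lemma psd_B: "psd {0..1} B"
  by (rule is_rkhs_psd[OF is_rkhs_bdry0[OF \<alpha>]])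

lemma rk_B: "rk {0..1} B = subspace_where (rk {0..1} V.ker) (bdry0 \<alpha>)"
  using is_rkhs_unique[OF is_rkhs_bdry0[OF \<alpha>]] by (simp add: H_sob_eq[OF \<alpha>])

interpretation B: psd_kernel "{0..1}" B
  by unfold_locales (rule psd_B)

lemma elems_B: "B.E = {f \<in> V.E. bdry0 \<alpha> f}"
  using arg_cong[OF rk_B, of elems] by (simp add: subspace_where_simps)

lemma ip_B: "f \<in> B.E \<Longrightarrow> g \<in> B.E \<Longrightarrow> ip (rk {0..1} B) f g = ip (rk {0..1} V.ker) f g"
  unfolding rk_B elems_B by (intro subspace_where_simps(2)) auto

lemma sqnorm_B: "f \<in> B.E \<Longrightarrow> B.N f = V.N f"
  using ip_B[of f f] elems_B by (simp add: B.ip_rk_self V.ip_rk_self)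

text \<open>The norm of \<open>B\<close> is that of \<open>F\<close>, which bounds the norm of
  \<open>G\<close> up to a constant. A shortest expansion in \<open>G\<close> has no Bernoulli part
  of positive degree and is, with the same coefficients, an expansion in \<open>C\<close>.\<close>

lemma bdry0_elems_cos:
  obtains c where "c > 0" "\<And>f. f \<in> B.E \<Longrightarrow> f \<in> C.E \<and> C.N f \<le> c * B.N f"
proof -
  obtain c where c: "c \<ge> 1" "\<forall>v\<in>functionals {0..1}. qf F.ker v v \<le> c * qf G.ker v v"
    by (rule dominatedE[OF F_G_dominated(1) G.psd])
  have "f \<in> C.E \<and> C.N f \<le> c * B.N f" if f: "f \<in> B.E" for f
  proof -
    have fF: "f \<in> F.E" using f unfolding elems_B elems_F by (auto simp: bdry0_def)
    have fG: "f \<in> G.E" "G.N f \<le> c * F.N f"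
      using rk_elems_dominated[OF F.psd G.psd _ c(2) fF] c(1) by auto
    obtain a where a: "G.expansion a f" "(\<Sum>i. (a i)\<^sup>2) \<le> G.N f" by (rule G.ex_expansion[OF fG(1)])
    have aC: "C.expansion a f" using bdry0_cos_expansion[OF a(1)] f by (simp add: elems_B)
    then show ?thesis
      using C.expansion_elems[OF aC] C.expansion_sqnorm[OF aC] a(2) fG(2) sqnorm_F[OF fF] sqnorm_B[OF f] by simp
  qed
  then show ?thesis using that[of c] c(1) by simp
qed

text \<open>Domination puts cosine expansions into \<open>F\<close> with a norm bound; the boundary
  conditions then hold term by term.\<close>

lemma cos_elems_bdry0:
  obtains c where "c > 0" "\<And>f. f \<in> C.E \<Longrightarrow> f \<in> B.E \<and> B.N f \<le> c * C.N f"
proof -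
  have "dominated {0..1} C.ker F.ker"
    by (rule dominated_trans[OF half_mono[OF \<alpha>] F_G_dominated(2) G.psd]) auto
  from dominatedE[OF this F.psd] obtain c
    where c: "c \<ge> 1" "\<forall>v\<in>functionals {0..1}. qf C.ker v v \<le> c * qf F.ker v v" by blast
  have "f \<in> B.E \<and> B.N f \<le> c * C.N f" if f: "f \<in> C.E" for f
  proof -
    have fF: "f \<in> F.E" "F.N f \<le> c * C.N f"
      using rk_elems_dominated[OF C.psd F.psd _ c(2) f] c(1) by auto
    obtain a where "C.expansion a f" by (rule C.ex_expansion[OF f])
    then have "f \<in> B.E" using fF(1) cos_expansion_bdry0 by (simp add: elems_B elems_F)
    then show ?thesis using fF sqnorm_F[OF fF(1)] sqnorm_B by simp
  qed
  then show ?thesis using that[of c] c(1) by simp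
qed

lemma one_eq: "restr {0..1} (\<lambda>_. 1) = restr {0..1} (bern 0)"
  by (auto simp: restr_def)

text \<open>The antiderivatives of the half-period cosines are sines with boundary values 0, which
  is the periodicity that \<open>bern_represents\<close> asks for.\<close>

lemma cos_mean:
  "f \<in> C.E \<Longrightarrow> ip (rk {0..1} C.ker) f (restr {0..1} (\<lambda>_. 1)) = mean_deriv 0 f"
  unfolding one_eq
proof (rule C.bern_represents)
  have "C.tg (Suc \<alpha>) j x = 0" if x: "x \<in> {0, 1}" for j x
  proof -
    have "half_freq j * x - half_phase \<alpha> j - real (Suc \<alpha>) * pi / 2 = pi * real (Suc j) * x - pi / 2"
      by (simp add: half_freq_def half_phase_def field_simps)
    moreover have "cos (pi * real (Suc j) * x - pi / 2) = 0"
      using x sin_npi2[of "Suc j"] by (auto simp: cos_diff simp del: of_nat_Suc)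
    ultimately show ?thesis unfolding C.tg_def by simp
  qed
  then show "C.tg (Suc \<alpha> - 0) j 1 = C.tg (Suc \<alpha> - 0) j 0" for j by simp
qed auto

lemma one_C: "restr {0..1} (\<lambda>_. 1) \<in> C.E"
  unfolding one_eq by (rule C.bern_elems) simp

lemma one_B: "restr {0..1} (\<lambda>_. 1) \<in> B.E"
  using cos_elems_bdry0 one_C by blast

lemma B_mean:
  assumes "f \<in> B.E"
  shows "ip (rk {0..1} B) f (restr {0..1} (\<lambda>_. 1)) = mean_deriv 0 f"
  using ip_B[OF assms one_B] assms V.bern_represents[of 0 f] full_tg_periodic
  unfolding one_eq elems_B by simp

lemma mean_one: "mean_deriv 0 (restr {0..1} (\<lambda>_. 1)) = 1"
  unfolding one_eq using V.mean_deriv_eq_coeff[OF V.bern_expansion[of 0] _ full_tg_periodic] by simp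

lemma psd_B_minus_one: "psd {0..1} (\<lambda>x y. -1 + B x y)"
proof (rule psd_minus_one[OF psd_B one_B])
  show "B.N (restr {0..1} (\<lambda>_. 1)) \<le> 1"
    unfolding sqnorm_B[OF one_B] unfolding one_eq by (rule V.bern_sqnorm) simp
qed

lemma C_minus_one: "x \<in> {0..1} \<Longrightarrow> y \<in> {0..1} \<Longrightarrow> -1 + C.ker x y = hcos \<alpha> x y"
  by (simp add: half_ker_eq[OF \<alpha>])

lemma B_le_hcos: "dominated {0..1} (\<lambda>x y. -1 + B x y) (hcos \<alpha>)"
proof -
  obtain c where c: "\<And>f. f \<in> B.E \<Longrightarrow> f \<in> C.E \<and> C.N f \<le> c * B.N f" using bdry0_elems_cos by blast
  have "dominated {0..1} (\<lambda>x y. -1 + B x y) (\<lambda>x y. -1 + C.ker x y)"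
    using dominated_minus_one[OF psd_B C.psd one_B one_C B_mean cos_mean mean_one, of c] c by blast
  then show ?thesis
    using dominated_cong[of "{0..1}" "\<lambda>x y. -1 + B x y" "\<lambda>x y. -1 + B x y" "\<lambda>x y. -1 + C.ker x y" "hcos \<alpha>"] C_minus_one
    by simp
qed

lemma hcos_le_B: "dominated {0..1} (hcos \<alpha>) (\<lambda>x y. -1 + B x y)"
proof -
  obtain c where c: "\<And>f. f \<in> C.E \<Longrightarrow> f \<in> B.E \<and> B.N f \<le> c * C.N f" using cos_elems_bdry0 by blast
  have "dominated {0..1} (\<lambda>x y. -1 + C.ker x y) (\<lambda>x y. -1 + B x y)"
    using dominated_minus_one[OF C.psd psd_B one_C one_B cos_mean B_mean mean_one, of c] c by blast
  then show ?thesis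
    using dominated_cong[of "{0..1}" "\<lambda>x y. -1 + C.ker x y" "hcos \<alpha>" "\<lambda>x y. -1 + B x y" "\<lambda>x y. -1 + B x y"] C_minus_one
    by simp
qed

end

section \<open>Embeddings of the weighted spaces\<close>

lemma weighted_embeds':
  assumes "\<And>u. u \<subseteq> {1..s} \<Longrightarrow> \<gamma> u \<ge> 0"
    and K: "\<And>x y. x \<in> {0..1} \<Longrightarrow> y \<in> {0..1} \<Longrightarrow> K x y = 1 + K' x y"
    and L: "\<And>x y. x \<in> {0..1} \<Longrightarrow> y \<in> {0..1} \<Longrightarrow> L x y = 1 + L' x y"
    and psd: "psd {0..1} K'" "psd {0..1} L'" and d: "dominated {0..1} K' L'"
  shows "H s \<gamma> K \<hookrightarrow> H s \<gamma> L"
proof (rule weighted_embeds[OF assms(1)])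
  show "psd {0..1} (\<lambda>x y. -1 + K x y)"
    using psd(1) psd_cong[of "{0..1}" "\<lambda>x y. -1 + K x y" K'] K by simp
  show "psd {0..1} (\<lambda>x y. -1 + L x y)"
    using psd(2) psd_cong[of "{0..1}" "\<lambda>x y. -1 + L x y" L'] L by simp
  show "dominated {0..1} (\<lambda>x y. -1 + K x y) (\<lambda>x y. -1 + L x y)"
    using d dominated_cong[of "{0..1}" "\<lambda>x y. -1 + K x y" K' "\<lambda>x y. -1 + L x y" L'] K L by simp
qed

theorem theorem1:
  fixes \<alpha> s :: nat and \<gamma> :: "nat set \<Rightarrow> real"
  assumes "\<alpha> \<ge> 1" and "s \<ge> 1"
    and "\<And>u. u \<subseteq> {1..s} \<Longrightarrow> \<gamma> u \<ge> 0"
  shows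
    "(\<alpha> = 1 \<longrightarrow>
        H s \<gamma> (K_cos \<alpha>) \<asymp> H s \<gamma> (K_kor_cos \<alpha>) \<and>
        H s \<gamma> (K_kor_cos \<alpha>) \<asymp> H s \<gamma> (K_sob \<alpha>) \<and>
        H s \<gamma> (K_sob \<alpha>) = H s \<gamma> (K_sob_odd \<alpha>) \<and>
        H s \<gamma> (K_sob_odd \<alpha>) = H s \<gamma> (K_sob_odd_plus \<alpha>) \<and>
        H s \<gamma> (K_sob_odd_plus \<alpha>) = H s \<gamma> (K_sob_odd_bdry0 \<alpha>)) \<and>
     (odd \<alpha> \<and> \<alpha> > 1 \<longrightarrow>
        H s \<gamma> (K_cos \<alpha>) \<asymp> H s \<gamma> (K_sob_odd_bdry0 \<alpha>) \<and>
        H s \<gamma> (K_sob_odd_bdry0 \<alpha>) \<hookrightarrow> H s \<gamma> (K_kor_cos \<alpha>) \<and>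
        H s \<gamma> (K_kor_cos \<alpha>) \<asymp> H s \<gamma> (K_sob_odd \<alpha>) \<and>
        H s \<gamma> (K_sob_odd \<alpha>) = H s \<gamma> (K_sob_odd_plus \<alpha>) \<and>
        H s \<gamma> (K_sob_odd_plus \<alpha>) \<hookrightarrow> H s \<gamma> (K_sob \<alpha>)) \<and>
     (even \<alpha> \<longrightarrow>
        H s \<gamma> (K_cos \<alpha>) \<asymp> H s \<gamma> (K_sob_odd_bdry0 \<alpha>) \<and>
        H s \<gamma> (K_sob_odd_bdry0 \<alpha>) \<hookrightarrow> H s \<gamma> (K_kor_cos \<alpha>) \<and>
        H s \<gamma> (K_kor_cos \<alpha>) \<asymp> H s \<gamma> (K_sob_odd \<alpha>) \<and>
        H s \<gamma> (K_sob_odd \<alpha>) \<hookrightarrow> H s \<gamma> (K_sob_odd_plus \<alpha>) \<and>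
        H s \<gamma> (K_sob_odd_plus \<alpha>) \<hookrightarrow> H s \<gamma> (K_sob \<alpha>) \<and>
        (\<alpha> = 2 \<longrightarrow> H s \<gamma> (K_sob_odd_plus \<alpha>) = H s \<gamma> (K_sob \<alpha>)))"
proof -
  note \<alpha> = assms(1)
  let ?I = "{0..1} :: real set"
  \<comment> \<open>The degrees left by the condition \<open>odd+\<alpha>\<close>, without 0. Even
    degrees below \<alpha> are removed while \<alpha> itself stays, so this is
    \<open>odd_upto \<alpha>\<close> for odd \<alpha> and all of \<open>{1..\<alpha>}\<close> for
    \<open>\<alpha> \<le> 2\<close>.\<close>
  define Tp where "Tp = {1..\<alpha>} - {n. even n \<and> n < \<alpha>}"
  define L where "L = (\<lambda>x y. (2 * pi) ^ (2 * \<alpha>) / 2 * per \<alpha> x y + pi ^ (2 * \<alpha>) / 2 * hcos \<alpha> x y)"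
  define C where "C = (\<lambda>x y. pi ^ (2 * \<alpha>) * hcos \<alpha> x y)"
  define B where "B = (\<lambda>x y. -1 + K_sob_odd_bdry0 \<alpha> x y)"
  let ?O = "full_ker \<alpha> (odd_upto \<alpha>)" and ?P = "full_ker \<alpha> Tp" and ?S = "full_ker \<alpha> {1..\<alpha>}"
  have T: "odd_upto \<alpha> \<subseteq> Tp" "Tp \<subseteq> {1..\<alpha>}" "odd_upto \<alpha> \<subseteq> {..\<alpha>}" "Tp \<subseteq> {..\<alpha>}" "{1..\<alpha>} \<subseteq> {..\<alpha>}"
    by (auto simp: Tp_def elim: oddE)
  \<comment> \<open>Degree 0 contributes the constant kernel 1, which the weighted kernels
    subtract.\<close>
  have insert0: "full_ker \<alpha> (insert 0 T) x y = 1 + full_ker \<alpha> T x y"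
    if "T \<subseteq> {1..\<alpha>}" "x \<in> ?I" "y \<in> ?I" for T x y
  proof -
    have "T \<subseteq> {..\<alpha>}" "finite T" "0 \<notin> T" using that(1) by (auto intro: finite_subset)
    then show ?thesis using that by (simp add: full_ker_eq[OF \<alpha>])
  qed
  have eqs: "K_cos \<alpha> x y = 1 + C x y" "K_kor_cos \<alpha> x y = 1 + L x y" "K_sob_odd_bdry0 \<alpha> x y = 1 + B x y" for x y
    by (simp_all add: K_cos_eq[OF \<alpha>] K_kor_cos_eq[OF \<alpha>] C_def L_def B_def)
  have sob: "K_sob \<alpha> x y = 1 + ?S x y" and odd: "K_sob_odd \<alpha> x y = 1 + ?O x y"
    and plus: "K_sob_odd_plus \<alpha> x y = 1 + ?P x y" if "x \<in> ?I" "y \<in> ?I" for x y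
  proof -
    have "insert 0 {1..\<alpha>} = {..\<alpha>}" by auto
    then show "K_sob \<alpha> x y = 1 + ?S x y"
      using insert0[of "{1..\<alpha>}", OF _ that] by (simp add: K_sob_eq[OF \<alpha> that] full_ker_eq[OF \<alpha> _ that])
    have "{..\<alpha>} - {n. even n \<and> 2 \<le> n \<and> n \<le> \<alpha>} = insert 0 (odd_upto \<alpha>)"
      by (auto simp: not_le numeral_2_eq_2 less_Suc_eq)
    then show "K_sob_odd \<alpha> x y = 1 + ?O x y"
      unfolding K_sob_odd_eq[OF \<alpha> that] by (simp only: insert0[OF subset_trans[OF T(1,2)] that])
    have "{..\<alpha>} - {n. even n \<and> 2 \<le> n \<and> n + 1 \<le> \<alpha>} = insert 0 Tp"
      by (auto simp: Tp_def not_le numeral_2_eq_2 less_Suc_eq)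
    then show "K_sob_odd_plus \<alpha> x y = 1 + ?P x y"
      unfolding K_sob_odd_plus_eq[OF \<alpha> that] by (simp only: insert0[OF T(2) that])
  qed
  have "psd ?I C" "psd ?I L"
    unfolding C_def L_def by (intro psd_add psd_cmult psd_per[OF \<alpha>] psd_hcos[OF \<alpha>]; simp)+
  then have psds: "psd ?I C" "psd ?I L" "psd ?I B" "psd ?I ?O" "psd ?I ?P" "psd ?I ?S"
    unfolding B_def using psd_B_minus_one[OF \<alpha>] psd_full[OF \<alpha> T(3)] psd_full[OF \<alpha> T(4)] psd_full[OF \<alpha> T(5)]
    by simp_all
  have CB: "dominated ?I C B" unfolding C_def B_def by (intro dominated_cmult hcos_le_B[OF \<alpha>]) simp
  have BC: "dominated ?I B C" unfolding C_def B_def by (intro dominated_cmult_right B_le_hcos[OF \<alpha>]) simp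
  have CL: "dominated ?I C L"
    unfolding C_def L_def
    by (intro dominated_cmult dominated_add_right2 dominated_cmult_right dominated_refl psd_cmult
        psd_per[OF \<alpha>] psd_hcos[OF \<alpha>]) simp_all
  have LO: "dominated ?I L ?O" unfolding L_def by (rule combination_le_full[OF \<alpha>]) simp_all
  have OL: "dominated ?I ?O L" unfolding L_def by (rule full_le_combination[OF \<alpha>]) simp_all
  have BL: "dominated ?I B L" by (rule dominated_trans[OF BC CL psds(1)])
  have OP: "dominated ?I ?O ?P" and PS: "dominated ?I ?P ?S"
    by (rule full_mono[OF \<alpha>], (rule T)+)+
  note emb = weighted_embeds'[OF assms(3)]
  have cos_bd: "H s \<gamma> (K_cos \<alpha>) \<asymp> H s \<gamma> (K_sob_odd_bdry0 \<alpha>)"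
    unfolding norm_equivalent_def
    by (intro conjI emb[OF _ eqs(1) eqs(3) psds(1,3) CB] emb[OF _ eqs(3) eqs(1) psds(3,1) BC])
  have bd_kc: "H s \<gamma> (K_sob_odd_bdry0 \<alpha>) \<hookrightarrow> H s \<gamma> (K_kor_cos \<alpha>)"
    by (rule emb[OF _ eqs(3) eqs(2) psds(3,2) BL])
  have kc_odd: "H s \<gamma> (K_kor_cos \<alpha>) \<asymp> H s \<gamma> (K_sob_odd \<alpha>)"
    unfolding norm_equivalent_def
    by (intro conjI emb[OF _ eqs(2) odd psds(2,4) LO] emb[OF _ odd eqs(2) psds(4,2) OL])
  have odd_plus: "H s \<gamma> (K_sob_odd \<alpha>) \<hookrightarrow> H s \<gamma> (K_sob_odd_plus \<alpha>)"
    by (rule emb[OF _ odd plus psds(4,5) OP])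
  have plus_sob: "H s \<gamma> (K_sob_odd_plus \<alpha>) \<hookrightarrow> H s \<gamma> (K_sob \<alpha>)"
    by (rule emb[OF _ plus sob psds(5,6) PS])
  have odd_eq_plus: "H s \<gamma> (K_sob_odd \<alpha>) = H s \<gamma> (K_sob_odd_plus \<alpha>)" if "odd \<alpha>"
  proof -
    have "Tp = odd_upto \<alpha>" using that by (auto simp: Tp_def le_less elim: oddE)
    then show ?thesis by (intro weighted_space_cong) (simp add: odd plus)
  qed
  have plus_eq_sob: "H s \<gamma> (K_sob_odd_plus \<alpha>) = H s \<gamma> (K_sob \<alpha>)" if "\<alpha> \<le> 2"
  proof -
    have "Tp = {1..\<alpha>}" using that by (auto simp: Tp_def elim: evenE)
    then show ?thesis by (intro weighted_space_cong) (simp add: sob plus)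
  qed
  have one: ?thesis if "\<alpha> = 1"
  proof -
    \<comment> \<open>No odd order satisfies \<open>\<tau> + 1 \<le> 1\<close>, so both conditions
      are vacuous.\<close>
    have "K_sob_odd_bdry0 \<alpha> = K_sob_odd \<alpha>"
      unfolding K_sob_odd_bdry0_def K_sob_odd_def using that by simp
    moreover have "odd_below \<alpha> = {}" "odd \<alpha>" using that by (auto intro: odd_pos)
    \<comment> \<open>Without odd degrees below 1 the half-period kernel is \<open>hcos\<close>
      itself, so \<open>full_le_half\<close> compares \<open>?O\<close> with \<open>hcos\<close>
      directly.\<close>
    moreover have "dominated ?I L C"
    proof -
      have "half_ker \<alpha> (odd_below \<alpha>) x y = hcos \<alpha> x y" if "x \<in> ?I" "y \<in> ?I" for x y
        unfolding \<open>odd_below \<alpha> = {}\<close> using that by (simp add: half_ker_eq[OF \<alpha>])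
      then have "dominated ?I ?O (hcos \<alpha>)"
        using full_le_half[OF \<alpha>] dominated_cong[of ?I ?O ?O "half_ker \<alpha> (odd_below \<alpha>)" "hcos \<alpha>"] by simp
      then have "dominated ?I ?O C" unfolding C_def by (rule dominated_cmult_right) simp
      then show ?thesis using LO psds(4) dominated_trans by blast
    qed
    then have "H s \<gamma> (K_cos \<alpha>) \<asymp> H s \<gamma> (K_kor_cos \<alpha>)"
      unfolding norm_equivalent_def
      by (intro conjI emb[OF _ eqs(1) eqs(2) psds(1,2) CL] emb[OF _ eqs(2) eqs(1) psds(2,1)])
    ultimately show ?thesis using that kc_odd odd_eq_plus plus_eq_sob by simp
  qed
  show ?thesis
  proof (cases "\<alpha> = 1")
    case False
    have "\<alpha> = 2 \<longrightarrow> H s \<gamma> (K_sob_odd_plus \<alpha>) = H s \<gamma> (K_sob \<alpha>)" by (intro impI plus_eq_sob) simp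
    with False show ?thesis using cos_bd bd_kc kc_odd odd_plus plus_sob odd_eq_plus by blast
  qed (rule one)
qed

end
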